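(* There is a constant $c>0$ such that for every integer $n\ge 3$ there exist a combinatorial triangulation $T$ with $n$ vertices and a set $S$ of $n$ points in general position in the plane such that $T$ has at least $c\cdot 1.31^n$ different drawings, as geometric triangulation, on $S$. (That is, $T$ has $\Omega(1.31^n)$ different drawings on $S$.)
   Context: General position means that no three points of the set are collinear. A combinatorial triangulation with $n\ge 3$ vertices is a maximal planar (simple) graph on $n$ vertices, considered together with its combinatorial plane embedding, with a fixed outer triangular face whose three vertices are labeled $1,2,3$. All its faces are triangles, and its edges need not be straight-line segments. Given a finite set $S$ of points in general position in the plane, a geometric triangulation on $S$ is a maximal crossing-free graph with vertex set $S$ whose edges are straight-line segments (edges may intersect only in a common endpoint). A combinatorial triangulation $T$ can be drawn on $S$ only if $S$ has as many points as $T$ has vertices and the boundary of the convex hull of $S$ has exactly three vertices; these three hull vertices are labeled $1,2,3$ and are required to coincide with the vertices $1,2,3$ of $T$. A drawing of $T$ on $S$ (as geometric triangulation) is a geometric triangulation $G$ on $S$ for which there is a bijection $f$ from the vertices of $T$ to $S$ such that: (i) $f$ maps each outer vertex $1,2,3$ of $T$ to the convex hull vertex of $S$ with the same label; (ii) two distinct vertices $v,w$ are adjacent in $T$ if and only if $f(v),f(w)$ are adjacent in $G$; (iii) three distinct vertices $u,v,w$ define a triangle (triangular face) of $T$ if and only if $f(u),f(v),f(w)$ define a triangle (triangular face) of $G$. Equivalently, two geometric triangulations $T_1,T_2$ on $S$ are drawings of the same combinatorial triangulation if there is a bijection between their vertex sets which fixes every vertex on the boundary of the convex hull of $S$ and preserves,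 in both directions, edges and triangular faces. Two drawings of $T$ on $S$ are different if they are different geometric triangulations on $S$, i.e. their sets of straight-line edges are different. The number of different drawings of $T$ on $S$ is the number of geometric triangulations on $S$ that are drawings of $T$. *)

theory Defs
  imports "HOL-Analysis.Analysis" "HOL-Library.Ramsey"
begin

(* Graphs are pairs of a vertex set V and an edge set E of two-element subsets of V
   (nsets A k is the set of k-element subsets of A).  The plane is the type complex,
   the type for which the library states the Jordan curve theorem. *)

definition simple_graph :: "'v set \<Rightarrow> 'v set set \<Rightarrow> bool" where
  "simple_graph V E \<longleftrightarrow> finite V \<and> E \<subseteq> nsets V 2"

(* A topological drawing: p places the vertices and D e is the curve of the edge e. *)
definition plane_drawing ::
  "'v set \<Rightarrow> 'v set set \<Rightarrow> ('v \<Rightarrow> complex) \<Rightarrow> ('v set \<Rightarrow> complex set) \<Rightarrow> bool" where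
  "plane_drawing V E p D \<longleftrightarrow>
     inj_on p V \<and>
     (\<forall>e\<in>E. \<exists>g. arc g \<and> path_image g = D e \<and> {pathstart g, pathfinish g} = p ` e) \<and>
     (\<forall>e\<in>E. D e \<inter> p ` V = p ` e) \<and>
     (\<forall>e\<in>E. \<forall>e'\<in>E. e \<noteq> e' \<longrightarrow> D e \<inter> D e' \<subseteq> p ` (e \<inter> e'))"

definition planar :: "'v set \<Rightarrow> 'v set set \<Rightarrow> bool" where
  "planar V E \<longleftrightarrow> (\<exists>p D. plane_drawing V E p D)"

definition maximal_planar :: "'v set \<Rightarrow> 'v set set \<Rightarrow> bool" where
  "maximal_planar V E \<longleftrightarrow>
     simple_graph V E \<and> planar V E \<and>
     (\<forall>E'. simple_graph V E' \<and> planar V E' \<and> E \<subseteq> E' \<longrightarrow> E' = E)"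

definition drawing_faces ::
  "'v set \<Rightarrow> 'v set set \<Rightarrow> ('v \<Rightarrow> complex) \<Rightarrow> ('v set \<Rightarrow> complex set) \<Rightarrow> complex set set" where
  "drawing_faces V E p D = components (- (p ` V \<union> \<Union> (D ` E)))"

definition bounds_face ::
  "'v set \<Rightarrow> 'v set set \<Rightarrow> ('v set \<Rightarrow> complex set) \<Rightarrow> 'v set \<Rightarrow> complex set \<Rightarrow> bool" where
  "bounds_face V E D t C \<longleftrightarrow>
     t \<in> nsets V 3 \<and> nsets t 2 \<subseteq> E \<and> frontier C = \<Union> (D ` nsets t 2)"

(* The unbounded face is included if its boundary is a triangle. *)
definition triangular_faces ::
  "'v set \<Rightarrow> 'v set set \<Rightarrow> ('v \<Rightarrow> complex) \<Rightarrow> ('v set \<Rightarrow> complex set) \<Rightarrow> 'v set set" where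
  "triangular_faces V E p D = {t. \<exists>C\<in>drawing_faces V E p D. bounds_face V E D t C}"

(* All faces of a maximal planar graph are triangles, so a combinatorial embedding is recorded
   by the vertex triples of its faces.  The outer vertices are the vertices 1, 2, 3. *)
record comb_graph =
  verts :: "nat set"
  edges :: "nat set set"
  faces :: "nat set set"

definition combinatorial_triangulation :: "nat \<Rightarrow> comb_graph \<Rightarrow> bool" where
  "combinatorial_triangulation n T \<longleftrightarrow>
     3 \<le> n \<and> finite (verts T) \<and> card (verts T) = n \<and>
     maximal_planar (verts T) (edges T) \<and>
     (\<exists>p D. plane_drawing (verts T) (edges T) p D \<and>
        faces T = triangular_faces (verts T) (edges T) p D \<and>
        (\<exists>C\<in>drawing_faces (verts T) (edges T) p D.
           \<not> bounded C \<and> bounds_face (verts T) (edges T) D {1, 2, 3} C))"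

definition general_position :: "complex set \<Rightarrow> bool" where
  "general_position S \<longleftrightarrow> (\<forall>t\<in>nsets S 3. \<not> collinear t)"

(* For a two-element set e of points, convex hull e is the closed segment between them. *)
definition crossing_free :: "complex set \<Rightarrow> complex set set \<Rightarrow> bool" where
  "crossing_free S G \<longleftrightarrow>
     simple_graph S G \<and>
     (\<forall>e\<in>G. \<forall>e'\<in>G. e \<noteq> e' \<longrightarrow> convex hull e \<inter> convex hull e' \<subseteq> e \<inter> e')"

definition geometric_triangulation :: "complex set \<Rightarrow> complex set set \<Rightarrow> bool" where
  "geometric_triangulation S G \<longleftrightarrow>
     crossing_free S G \<and> (\<forall>G'. crossing_free S G' \<and> G \<subseteq> G' \<longrightarrow> G' = G)"

definition geometric_faces :: "complex set \<Rightarrow> complex set set \<Rightarrow> complex set set" where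
  "geometric_faces S G = triangular_faces S G id (\<lambda>e. convex hull e)"

definition hull_labelling :: "complex set \<Rightarrow> (nat \<Rightarrow> complex) \<Rightarrow> bool" where
  "hull_labelling S l \<longleftrightarrow> bij_betw l {1, 2, 3} {x. x extreme_point_of (convex hull S)}"

definition is_drawing ::
  "comb_graph \<Rightarrow> complex set \<Rightarrow> (nat \<Rightarrow> complex) \<Rightarrow> complex set set \<Rightarrow> bool" where
  "is_drawing T S l G \<longleftrightarrow>
     geometric_triangulation S G \<and>
     (\<exists>f. bij_betw f (verts T) S \<and>
        (\<forall>i\<in>{1, 2, 3}. f i = l i) \<and>
        (\<forall>e\<in>nsets (verts T) 2. e \<in> edges T \<longleftrightarrow> f ` e \<in> G) \<and>
        (\<forall>t\<in>nsets (verts T) 3. t \<in> faces T \<longleftrightarrow> f ` t \<in> geometric_faces S G))"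

definition drawings ::
  "comb_graph \<Rightarrow> complex set \<Rightarrow> (nat \<Rightarrow> complex) \<Rightarrow> complex set set set" where
  "drawings T S l = {G. is_drawing T S l G}"

lemma finite_drawings:
  assumes "finite S"
  shows "finite (drawings T S l)"
proof (rule finite_subset)
  show "drawings T S l \<subseteq> Pow (nsets S 2)"
    by (auto simp: drawings_def is_drawing_def geometric_triangulation_def
        crossing_free_def simple_graph_def)
  show "finite (Pow (nsets S 2))"
    using assms by (simp add: finite_imp_finite_nsets)
qed

end

theory Submission imports Defs begin

text \<open>
The bound comes from one small configuration. In a triangle, place six further points as in
\<open>gadget_points\<close>. The combinatorial triangulation of \<open>gadget_edges\<close> and \<open>gadget_faces\<close>
then has six straight-line drawings on these nine points, all with the same labelled outer
triangle: the outer three vertices stay where they are and the inner six are permuted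
(\<open>gadget_drawings\<close>). The configuration was found by a computer search over point sets.

Many copies are combined as follows. Let a system of points inside a triangle \<open>A B X\<close> be given.
Choose a new corner \<open>C\<close> such that \<open>X\<close> lies inside \<open>A B C\<close>, and put one copy of the gadget into
each of the two new triangles \<open>B C X\<close> and \<open>C A X\<close>. This costs \<open>1 + 2 \<cdot> 6 = 13\<close> points.
A bijection that redraws one of the three triangles fixes its corners, so redrawings of the three
triangles can be chosen independently, and the number of drawings grows by the factor
\<open>6 \<cdot> 6 = 36\<close>. Since \<open>36 > 1.31 ^ 13\<close> (the rate is \<open>36 powr (1/13)\<close>, about \<open>1.317\<close>), this
suffices. Adding \<open>C\<close> without the two gadgets costs one point and loses no drawings, which takes care
of the vertex numbers that are not of the form \<open>3 + 13 q\<close>. The step is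
\<open>flexible_system_extend\<close>, and the independence is \<open>mosaic.card_redrawings_Union\<close>.

Three things have to be verified along the way.

Faces. In a crossing-free straight-line graph that contains its triangular hull, the triangular faces
are the hull triangle and the triangles of edges that contain no further point
(\<open>geometric_faces_eq\<close>). Emptiness of a triangle only concerns the region in which it lies, so
a redrawing has to preserve empty triangles in each region separately.

Maximality. A combinatorial triangulation must be maximal among all planar graphs, where planarity
allows arbitrary curves. Instead of Euler's formula, every missing edge \<open>x y\<close> gets its own
obstruction \<open>K5_witness\<close>, a contraction to the complete graph on five vertices: a cycle around
\<open>x\<close>, three of its vertices \<open>A, B, C\<close> adjacent to \<open>x\<close>, and a connected vertex set that contains
\<open>y\<close> and has neighbours \<open>A, B, C\<close>. That such an obstruction is effective
(\<open>K5_witness_blocks_edge\<close>) follows from the Jordan curve theorem and Janiszewski's theorem.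
The obstructions inside the gadget are finitely many and are listed in \<open>gadget_rows\<close>;
those for edges between the interior of a gadget and the rest of the graph arise by contracting the
rest to one additional vertex (\<open>hub_rows\<close>), which makes the argument stable under gluing
(\<open>saturated_glue\<close>).

General position. All properties of the gadget are expressed by the signs of the orientations of
triples of its points (\<open>realizes_grid\<close>). These are invariant under affine maps that preserve
orientation, and stable under small perturbations, so a copy of the gadget can be placed in any triangle in general position with
respect to all points that are already there (\<open>place_gadget\<close>).
\<close>

section \<open>Connected sets approaching a triangle\<close>

text \<open>The basic consequence of Janiszewski's theorem: two connected sets that both reach a point
on each of the two sides \<open>U\<close> and \<open>D\<close> cannot be separated by \<open>U \<union> C \<union> D\<close>. Going through
\<open>a\<close> avoids \<open>D \<union> C\<close>, going through \<open>b\<close> avoids \<open>U \<union> C\<close>, and these two sets meet in the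
connected set \<open>C\<close>.\<close>

lemma connected_component_two_accesses:
  fixes C U D K W :: "complex set"
  assumes "compact C" "connected C" "compact U" "compact D" "U \<inter> D \<subseteq> C"
    and "connected K" "connected W" "K \<inter> (C \<union> U \<union> D) = {}" "W \<inter> (C \<union> U \<union> D) = {}"
    and a: "a \<in> closure K" "a \<in> closure W" "a \<in> U" "a \<notin> C" "a \<notin> D"
    and b: "b \<in> closure K" "b \<in> closure W" "b \<in> D" "b \<notin> C" "b \<notin> U"
    and "k \<in> K" "w \<in> W"
  shows "connected_component (- (C \<union> U \<union> D)) k w"
proof -
  have link: "connected_component (- T) k w"
    if "z \<in> closure K" "z \<in> closure W" "insert z (K \<union> W) \<subseteq> - T" for z T
  proof -
    have "connected (insert z X)" if "connected X" "z \<in> closure X" for X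
      by (rule connected_intermediate_closure[OF that(1)]) (use that closure_subset in auto)
    then have "connected (insert z K)" "connected (insert z W)"
      using that(1,2) assms(6,7) by blast+
    then have "connected (insert z K \<union> insert z W)"
      by (rule connected_Un) auto
    with that(3) \<open>k \<in> K\<close> \<open>w \<in> W\<close> show ?thesis
      unfolding connected_component_def
      by (intro exI[of _ "insert z K \<union> insert z W"]) auto
  qed
  have "connected_component (- ((U \<union> C) \<union> (D \<union> C))) k w"
  proof (rule Janiszewski)
    have "(U \<union> C) \<inter> (D \<union> C) = C" using assms(5) by blast
    then show "connected ((U \<union> C) \<inter> (D \<union> C))" using assms(2) by simp
    show "connected_component (- (U \<union> C)) k w"
      by (rule link[of b]) (use assms in auto)
    show "connected_component (- (D \<union> C)) k w"
      by (rule link[of a]) (use assms in auto)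
  qed (use assms(1,3,4) in \<open>auto simp: compact_Un compact_imp_closed\<close>)
  moreover have "(U \<union> C) \<union> (D \<union> C) = C \<union> U \<union> D" by auto
  ultimately show ?thesis by simp
qed

text \<open>A tripod with legs \<open>LA\<close>, \<open>LB\<close>, \<open>LC\<close> ends in the corners of a triangle with sides
\<open>MAB\<close>, \<open>MBC\<close>, \<open>MCA\<close>. If two further connected sets reach all three corners, then they are not
separated by the tripod and the triangle. Leaving out \<open>MAB\<close>, or leaving out \<open>MCA\<close>, the rest
has the shape treated in the previous lemma, and the two partial results are combined by a third use
of Janiszewski's theorem. In particular, it is impossible that the triangle itself separates the two
sets, which is how the lemma is applied.\<close>

lemma connected_component_around_tripod:
  fixes a b c x :: complex
  assumes L: "compact LA" "connected LA" "compact LB" "connected LB" "compact LC" "connected LC"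
    and M: "compact MAB" "compact MBC" "connected MBC" "compact MCA"
    and LL: "LA \<inter> LB = {x}" "LB \<inter> LC = {x}" "LC \<inter> LA = {x}"
    and MM: "MAB \<inter> MBC = {b}" "MBC \<inter> MCA = {c}" "MCA \<inter> MAB = {a}"
    and LM: "LA \<inter> MAB = {a}" "LA \<inter> MCA = {a}" "LA \<inter> MBC = {}"
      "LB \<inter> MAB = {b}" "LB \<inter> MBC = {b}" "LB \<inter> MCA = {}"
      "LC \<inter> MBC = {c}" "LC \<inter> MCA = {c}" "LC \<inter> MAB = {}"
    and KW: "connected K" "connected W" "k \<in> K" "w \<in> W"
      "(K \<union> W) \<inter> (LA \<union> LB \<union> LC \<union> MAB \<union> MBC \<union> MCA) = {}"
    and cl: "{a, b, c} \<subseteq> closure K" "{a, b, c} \<subseteq> closure W"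
  shows "connected_component (- (LA \<union> LB \<union> LC \<union> MAB \<union> MBC \<union> MCA)) k w"
proof -
  have mem: "a \<in> LA" "a \<in> MCA" "a \<in> MAB" "b \<in> LB" "b \<in> MBC" "b \<in> MAB"
    "c \<in> LC" "c \<in> MBC" "c \<in> MCA" "x \<in> LA" "x \<in> LB" "x \<in> LC"
    using LL LM by auto
  have nmem: "a \<notin> LC" "a \<notin> LB" "a \<notin> MBC" "b \<notin> LA" "b \<notin> LC" "b \<notin> MCA"
    "c \<notin> LA" "c \<notin> LB" "c \<notin> MAB"
    using mem LM(3,6,9) by auto
  have KL: "K \<inter> LA = {}" "K \<inter> LB = {}" "K \<inter> LC = {}" "K \<inter> MAB = {}" "K \<inter> MBC = {}" "K \<inter> MCA = {}"
    "W \<inter> LA = {}" "W \<inter> LB = {}" "W \<inter> LC = {}" "W \<inter> MAB = {}" "W \<inter> MBC = {}" "W \<inter> MCA = {}"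
    using KW(5) by auto
  have 1: "connected_component (- (LC \<union> (LA \<union> MCA) \<union> (LB \<union> MBC))) k w"
  proof (rule connected_component_two_accesses[where K=K and W=W and a=a and b=b])
    show "(LA \<union> MCA) \<inter> (LB \<union> MBC) \<subseteq> LC"
    proof -
      have "(LA \<union> MCA) \<inter> (LB \<union> MBC) = LA \<inter> LB \<union> LA \<inter> MBC \<union> LB \<inter> MCA \<union> MBC \<inter> MCA" by blast
      then show ?thesis by (simp add: LL MM LM mem)
    qed
  qed (use L M KW(1-4) cl mem nmem KL in \<open>simp_all add: compact_Un Int_Un_distrib\<close>)
  have 2: "connected_component (- (LB \<union> (LA \<union> MAB) \<union> (LC \<union> MBC))) k w"
  proof (rule connected_component_two_accesses[where K=K and W=W and a=a and b=c])
    show "(LA \<union> MAB) \<inter> (LC \<union> MBC) \<subseteq> LB"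
    proof -
      have "(LA \<union> MAB) \<inter> (LC \<union> MBC) = LC \<inter> LA \<union> LA \<inter> MBC \<union> LC \<inter> MAB \<union> MAB \<inter> MBC" by blast
      then show ?thesis by (simp add: LL MM LM mem)
    qed
  qed (use L M KW(1-4) cl mem nmem KL in \<open>simp_all add: compact_Un Int_Un_distrib\<close>)
  let ?L = "LA \<union> LB \<union> LC"
  have "connected_component (- ((?L \<union> MCA \<union> MBC) \<union> (?L \<union> MAB \<union> MBC))) k w"
  proof (rule Janiszewski)
    have "(?L \<union> MCA \<union> MBC) \<inter> (?L \<union> MAB \<union> MBC) = ?L \<union> MBC"
    proof -
      have "(?L \<union> MCA \<union> MBC) \<inter> (?L \<union> MAB \<union> MBC) = ?L \<union> MBC \<union> MCA \<inter> MAB" by blast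
      then show ?thesis using mem by (auto simp: MM)
    qed
    moreover have "connected (LA \<union> LB)" by (rule connected_Un) (use L LL in auto)
    then have "connected ?L" by (rule connected_Un) (use L LL in auto)
    then have "connected (?L \<union> MBC)" by (rule connected_Un) (use M LM in auto)
    ultimately show "connected ((?L \<union> MCA \<union> MBC) \<inter> (?L \<union> MAB \<union> MBC))" by simp
    show "connected_component (- (?L \<union> MCA \<union> MBC)) k w" using 1 by (simp add: Un_ac)
    show "connected_component (- (?L \<union> MAB \<union> MBC)) k w" using 2 by (simp add: Un_ac)
  qed (use L M in \<open>auto simp: compact_Un compact_imp_closed\<close>)
  moreover have "(?L \<union> MCA \<union> MBC) \<union> (?L \<union> MAB \<union> MBC) = LA \<union> LB \<union> LC \<union> MAB \<union> MBC \<union> MCA" by auto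
  ultimately show ?thesis by simp
qed

section \<open>Obstructions to adding an edge to a plane drawing\<close>

fun trail :: "('v set \<Rightarrow> complex set) \<Rightarrow> 'v list \<Rightarrow> complex set" where
  "trail D (u # v # q) = D {u, v} \<union> trail D (v # q)"
| "trail D q = {}"

abbreviation walk :: "'v set set \<Rightarrow> 'v list \<Rightarrow> bool" where
  "walk E \<equiv> successively (\<lambda>u v. {u, v} \<in> E)"

definition graph_path :: "'v set set \<Rightarrow> 'v list \<Rightarrow> bool" where
  "graph_path E q \<longleftrightarrow> 2 \<le> length q \<and> distinct q \<and> walk E q"

text \<open>Connectedness of a set of vertices. Joining two linked sets by an edge, rather than
quantifying over paths, makes it a rule induction to find a connected set in the plane that contains
the drawing of such a set, and it directly fits the gluing steps below.\<close>

inductive linked :: "'v set set \<Rightarrow> 'v set \<Rightarrow> bool" for E where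
  single: "linked E {v}"
| link: "linked E X \<Longrightarrow> linked E Y \<Longrightarrow> u \<in> X \<Longrightarrow> v \<in> Y \<Longrightarrow> {u, v} \<in> E \<Longrightarrow> linked E (X \<union> Y)"

text \<open>A contraction of the graph with the edge \<open>x y\<close> to the complete graph on five vertices:
the branch sets are \<open>{x}\<close>, the set \<open>Y\<close> containing \<open>y\<close>, and three parts of the cycle that is
composed of the paths \<open>q1\<close>, \<open>q2\<close>, \<open>q3\<close>, each part containing one of the corners at which the
paths meet.\<close>

definition K5_witness :: "'v set set \<Rightarrow> 'v \<Rightarrow> 'v \<Rightarrow> bool" where
  "K5_witness E x y \<longleftrightarrow> (\<exists>q1 q2 q3 Y.
     graph_path E q1 \<and> graph_path E q2 \<and> graph_path E q3 \<and>
     last q1 = hd q2 \<and> last q2 = hd q3 \<and> last q3 = hd q1 \<and>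
     set q1 \<inter> set q2 = {hd q2} \<and> set q2 \<inter> set q3 = {hd q3} \<and> set q3 \<inter> set q1 = {hd q1} \<and>
     linked E Y \<and> y \<in> Y \<and> x \<notin> Y \<and>
     (set q1 \<union> set q2 \<union> set q3) \<inter> insert x Y = {} \<and>
     (\<forall>a \<in> {hd q1, hd q2, hd q3}. {x, a} \<in> E \<and> (\<exists>u\<in>Y. {u, a} \<in> E)))"

lemma linked_mono: "linked E Y \<Longrightarrow> E \<subseteq> E' \<Longrightarrow> linked E' Y"
  by (induction rule: linked.induct) (auto intro: linked.intros)

lemma plane_drawingD:
  assumes "plane_drawing V E p D"
  shows "inj_on p V"
    and "e \<in> E \<Longrightarrow> D e \<inter> p ` V = p ` e"
    and "e \<in> E \<Longrightarrow> e' \<in> E \<Longrightarrow> e \<noteq> e' \<Longrightarrow> D e \<inter> D e' \<subseteq> p ` (e \<inter> e')"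
    and "e \<in> E \<Longrightarrow> \<exists>g. arc g \<and> path_image g = D e \<and> {pathstart g, pathfinish g} = p ` e"
proof -
  note * = assms[unfolded plane_drawing_def]
  show "inj_on p V" using * by simp
  show "D e \<inter> p ` V = p ` e" if "e \<in> E" using * that by simp
  show "D e \<inter> D e' \<subseteq> p ` (e \<inter> e')" if "e \<in> E" "e' \<in> E" "e \<noteq> e'" using * that by metis
  show "\<exists>g. arc g \<and> path_image g = D e \<and> {pathstart g, pathfinish g} = p ` e" if "e \<in> E"
    using * that by simp
qed

lemma edge_arc:
  assumes "plane_drawing V E p D" "{u, v} \<in> E"
  obtains g where "arc g" "path_image g = D {u, v}" "pathstart g = p u" "pathfinish g = p v"
proof -
  obtain g where g: "arc g" "path_image g = D {u, v}" "{pathstart g, pathfinish g} = {p u, p v}"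
    using plane_drawingD(4)[OF assms] by auto
  then consider "pathstart g = p u" "pathfinish g = p v" | "pathstart g = p v" "pathfinish g = p u"
    by (auto simp: doubleton_eq_iff)
  then show thesis
    using that[of g] that[of "reversepath g"] g arc_reversepath[of g] by cases auto
qed

text \<open>A half-open edge approaches a vertex without containing it. This is how branch sets are
made to reach the corners of a cycle while staying disjoint from it.\<close>

lemma half_open_edge:
  assumes pd: "plane_drawing V E p D" and "{u, v} \<in> E"
  shows "connected (D {u, v} - {p v})" "p v \<in> closure (D {u, v} - {p v})"
proof -
  obtain g where g: "arc g" "path_image g = D {u, v}" "pathfinish g = p v"
    using edge_arc[OF assms] by metis
  have cont: "continuous_on {0..1} g" and inj: "inj_on g {0..1}"
    using g(1) by (auto simp: arc_def path_def)
  have eq: "D {u, v} - {p v} = g ` {0..<1}"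
  proof -
    have "g ` {0..<1} = g ` ({0..1} - {1})" by (rule arg_cong[of _ _ "image g"]) auto
    also have "\<dots> = g ` {0..1} - {g 1}" using inj by (subst inj_on_image_set_diff) auto
    finally show ?thesis using g by (auto simp: path_image_def pathfinish_def)
  qed
  show "connected (D {u, v} - {p v})"
    unfolding eq by (rule connected_continuous_image[OF continuous_on_subset[OF cont]]) auto
  have "g ` closure {0..<1} \<subseteq> closure (g ` {0..<1})"
    by (rule image_closure_subset) (use cont closure_subset[of "g ` {0..<1}"] in auto)
  moreover have "g 1 \<in> g ` closure {0..<1}" by simp
  ultimately have "g 1 \<in> closure (g ` {0..<1})" by (rule subsetD)
  then show "p v \<in> closure (D {u, v} - {p v})"
    unfolding eq using g(3) by (simp add: pathfinish_def)
qed

lemma trail_edge: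
  assumes "walk E q" "z \<in> trail D q"
  obtains e where "e \<in> E" "e \<subseteq> set q" "z \<in> D e"
proof -
  have "\<exists>e\<in>E. e \<subseteq> set q \<and> z \<in> D e"
    using assms
  proof (induction q rule: induct_list012)
    case (3 u v q)
    from 3(4) consider "z \<in> D {u, v}" | "z \<in> trail D (v # q)" by auto
    then show ?case
    proof cases
      case 1
      then show ?thesis using 3(3) by (intro bexI[of _ "{u, v}"]) auto
    next
      case 2
      then obtain e where "e \<in> E" "e \<subseteq> set (v # q)" "z \<in> D e" using 3 by auto
      then show ?thesis by (intro bexI[of _ e]) auto
    qed
  qed auto
  with that show thesis by blast
qed

lemma trail_Int:
  assumes pd: "plane_drawing V E p D" and E: "E \<subseteq> nsets V 2"
    and q: "walk E q" "walk E q'"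
    and v: "set q \<inter> set q' \<subseteq> {v}"
  shows "trail D q \<inter> trail D q' \<subseteq> {p v}"
proof
  fix z assume z: "z \<in> trail D q \<inter> trail D q'"
  obtain e where e: "e \<in> E" "e \<subseteq> set q" "z \<in> D e" using trail_edge[OF q(1)] z by blast
  obtain e' where e': "e' \<in> E" "e' \<subseteq> set q'" "z \<in> D e'" using trail_edge[OF q(2)] z by blast
  have "e \<noteq> e'"
  proof
    assume "e = e'"
    then have "e \<subseteq> {v}" using e e' v by blast
    then have "card e \<le> 1" using card_mono[of "{v}" e] by simp
    then show False using e(1) E by (auto simp: nsets_def)
  qed
  then have "z \<in> p ` (e \<inter> e')" using plane_drawingD(3)[OF pd e(1) e'(1)] e(3) e'(3) by auto
  then show "z \<in> {p v}" using e e' v by blast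
qed

lemma arc_trail:
  assumes pd: "plane_drawing V E p D" and E: "E \<subseteq> nsets V 2" and "graph_path E q"
  obtains g where "arc g" "path_image g = trail D q" "pathstart g = p (hd q)" "pathfinish g = p (last q)"
proof -
  have "\<exists>g. arc g \<and> path_image g = trail D q \<and> pathstart g = p (hd q) \<and> pathfinish g = p (last q)"
    using assms(3)
  proof (induction q rule: induct_list012)
    case (3 u v q)
    then have uv: "{u, v} \<in> E" "u \<notin> set (v # q)" "distinct (v # q)"
        "walk E (v # q)"
      by (auto simp: graph_path_def)
    obtain g where g: "arc g" "path_image g = D {u, v}" "pathstart g = p u" "pathfinish g = p v"
      using edge_arc[OF pd uv(1)] by metis
    show ?case
    proof (cases q)
      case Nil
      then show ?thesis using g by auto
    next
      case (Cons w q')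
      then have "graph_path E (v # q)" using uv by (auto simp: graph_path_def)
      then obtain h where h: "arc h" "path_image h = trail D (v # q)" "pathstart h = p v"
          "pathfinish h = p (last (v # q))"
        using 3(2) by auto
      have "trail D [u, v] \<inter> trail D (v # q) \<subseteq> {p v}"
        by (rule trail_Int[OF pd E]) (use uv in auto)
      then have "arc (g +++ h)"
        using g h by (intro arc_join) auto
      then show ?thesis
        using g h by (intro exI[of _ "g +++ h"]) (auto simp: path_image_join)
    qed
  qed (auto simp: graph_path_def)
  with that show thesis by blast
qed

lemma vertex_in_edge_curve:
  assumes "plane_drawing V E p D" "E \<subseteq> nsets V 2" "e \<in> E" "v \<in> V" "p v \<in> D e"
  shows "v \<in> e"
proof -
  have "p v \<in> p ` e" using plane_drawingD(2)[OF assms(1,3)] assms(4,5) by blast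
  moreover have "e \<subseteq> V" using assms(2,3) by (auto simp: nsets_def)
  ultimately show ?thesis
    using plane_drawingD(1)[OF assms(1)] assms(4) by (auto simp: inj_on_def)
qed

lemma edge_curve:
  assumes "plane_drawing V E p D" "E \<subseteq> nsets V 2" "e \<in> E"
  shows "compact (D e)" "connected (D e)" "p ` e \<subseteq> D e"
proof -
  obtain g where "arc g" "path_image g = D e" "{pathstart g, pathfinish g} = p ` e"
    using plane_drawingD(4)[OF assms(1,3)] by blast
  moreover have "{pathstart g, pathfinish g} \<subseteq> path_image g"
    by auto
  ultimately show "compact (D e)" "connected (D e)" "p ` e \<subseteq> D e"
    using compact_arc_image[of g] connected_arc_image[of g] by auto
qed

lemma linked_connected:
  assumes "plane_drawing V E p D" "E \<subseteq> nsets V 2" "linked E Y"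
  shows "\<exists>K. connected K \<and> p ` Y \<subseteq> K \<and> K \<subseteq> p ` Y \<union> \<Union> (D ` {e \<in> E. e \<subseteq> Y})"
  using assms(3)
proof (induction rule: linked.induct)
  case (single v)
  then show ?case by (intro exI[of _ "{p v}"]) auto
next
  case (link X Y u v)
  then obtain K L where K: "connected K" "p ` X \<subseteq> K" "K \<subseteq> p ` X \<union> \<Union> (D ` {e \<in> E. e \<subseteq> X})"
    and L: "connected L" "p ` Y \<subseteq> L" "L \<subseteq> p ` Y \<union> \<Union> (D ` {e \<in> E. e \<subseteq> Y})" by blast
  have uv: "connected (D {u, v})" "{p u, p v} \<subseteq> D {u, v}"
    using edge_curve[OF assms(1,2) link(5)] by auto
  have "p u \<in> K \<inter> D {u, v}" "p v \<in> (K \<union> D {u, v}) \<inter> L"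
    using K(2) L(2) uv(2) link(3,4) by auto
  then have "connected (K \<union> D {u, v} \<union> L)"
    using K(1) L(1) uv(1) connected_Un[of K "D {u, v}"] connected_Un[of "K \<union> D {u, v}" L] by blast
  moreover have "K \<union> D {u, v} \<union> L \<subseteq> p ` (X \<union> Y) \<union> \<Union> (D ` {e \<in> E. e \<subseteq> X \<union> Y})"
  proof (intro Un_least)
    show "D {u, v} \<subseteq> p ` (X \<union> Y) \<union> \<Union> (D ` {e \<in> E. e \<subseteq> X \<union> Y})"
      using link(3,4,5) by (intro le_supI2 Union_upper) auto
    show "K \<subseteq> p ` (X \<union> Y) \<union> \<Union> (D ` {e \<in> E. e \<subseteq> X \<union> Y})"
      by (rule order_trans[OF K(3)]) auto
    show "L \<subseteq> p ` (X \<union> Y) \<union> \<Union> (D ` {e \<in> E. e \<subseteq> X \<union> Y})"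
      by (rule order_trans[OF L(3)]) auto
  qed
  ultimately show ?case using K(2) L(2) by (intro exI[of _ "K \<union> D {u, v} \<union> L"]) auto
qed

lemma Jordan_curve_of_three_paths:
  assumes pd: "plane_drawing V E p D" and E: "E \<subseteq> nsets V 2"
    and q: "graph_path E q1" "graph_path E q2" "graph_path E q3"
    and ends: "last q1 = hd q2" "last q2 = hd q3" "last q3 = hd q1"
    and Int: "set q1 \<inter> set q2 = {hd q2}" "set q2 \<inter> set q3 = {hd q3}" "set q3 \<inter> set q1 = {hd q1}"
  obtains J where "simple_path J" "pathfinish J = pathstart J"
    "path_image J = trail D q1 \<union> trail D q2 \<union> trail D q3"
    "trail D q1 \<inter> trail D q2 = {p (hd q2)}" "trail D q2 \<inter> trail D q3 = {p (hd q3)}"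
    "trail D q3 \<inter> trail D q1 = {p (hd q1)}"
proof -
  obtain g1 where g1: "arc g1" "path_image g1 = trail D q1" "pathstart g1 = p (hd q1)" "pathfinish g1 = p (last q1)"
    using arc_trail[OF pd E q(1)] by blast
  obtain g2 where g2: "arc g2" "path_image g2 = trail D q2" "pathstart g2 = p (hd q2)" "pathfinish g2 = p (last q2)"
    using arc_trail[OF pd E q(2)] by blast
  obtain g3 where g3: "arc g3" "path_image g3 = trail D q3" "pathstart g3 = p (hd q3)" "pathfinish g3 = p (last q3)"
    using arc_trail[OF pd E q(3)] by blast
  have i: "trail D q1 \<inter> trail D q2 \<subseteq> {p (hd q2)}" "trail D q2 \<inter> trail D q3 \<subseteq> {p (hd q3)}"
      "trail D q3 \<inter> trail D q1 \<subseteq> {p (hd q1)}"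
    by (rule trail_Int[OF pd E]; use q Int in \<open>auto simp: graph_path_def\<close>)+
  have m: "p (hd q1) \<in> trail D q1" "p (hd q2) \<in> trail D q2" "p (hd q3) \<in> trail D q3"
      "p (hd q2) \<in> trail D q1" "p (hd q3) \<in> trail D q2" "p (hd q1) \<in> trail D q3"
    using g1 g2 g3 ends pathstart_in_path_image[of g1] pathstart_in_path_image[of g2] pathstart_in_path_image[of g3]
      pathfinish_in_path_image[of g1] pathfinish_in_path_image[of g2] pathfinish_in_path_image[of g3] by auto
  have a12: "arc (g1 +++ g2)"
    using g1 g2 ends i by (intro arc_join) auto
  have pi12: "path_image (g1 +++ g2) = trail D q1 \<union> trail D q2"
    using g1 g2 ends by (simp add: path_image_join)
  have "simple_path ((g1 +++ g2) +++ g3)"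
    using a12 g3 g1 g2 ends i pi12 by (intro simple_path_join_loop) auto
  moreover have "path_image ((g1 +++ g2) +++ g3) = trail D q1 \<union> trail D q2 \<union> trail D q3"
    using pi12 g1 g2 g3 ends by (subst path_image_join) auto
  ultimately show thesis
    using g1 g2 g3 ends i m by (intro that[of "(g1 +++ g2) +++ g3"]) auto
qed

lemma graph_path_ends: "graph_path E q \<Longrightarrow> hd q \<noteq> last q"
  by (cases q) (auto simp: graph_path_def dest: last_in_set split: if_splits)

text \<open>The heart of the nonplanarity argument. The edge \<open>x y\<close> forces the drawing of \<open>Y\<close> to the
same side of the cycle as \<open>x\<close>. The other side \<open>W\<close> of the cycle and the drawing of \<open>Y\<close> both
reach the three corners, and both avoid the tripod formed by the edges from \<open>x\<close> to the corners.
By \<open>connected_component_around_tripod\<close> they are connected in the complement of the tripod and the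
cycle, although they lie on different sides of the cycle.\<close>

lemma K5_witness_blocks_edge:
  assumes pd: "plane_drawing V E p D" and E: "E \<subseteq> nsets V 2"
    and xy: "{x, y} \<in> E" and wit: "K5_witness E x y"
  shows False
proof -
  obtain q1 q2 q3 Y where q: "graph_path E q1" "graph_path E q2" "graph_path E q3"
     and ends: "last q1 = hd q2" "last q2 = hd q3" "last q3 = hd q1"
     and Int: "set q1 \<inter> set q2 = {hd q2}" "set q2 \<inter> set q3 = {hd q3}" "set q3 \<inter> set q1 = {hd q1}"
     and Y: "linked E Y" "y \<in> Y" "x \<notin> Y"
     and away: "(set q1 \<union> set q2 \<union> set q3) \<inter> insert x Y = {}"
     and adj: "\<forall>a \<in> {hd q1, hd q2, hd q3}. {x, a} \<in> E \<and> (\<exists>u\<in>Y. {u, a} \<in> E)"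
    using wit unfolding K5_witness_def by metis
  define A B C where "A = hd q1" and "B = hd q2" and "C = hd q3"
  obtain J where J: "simple_path J" "pathfinish J = pathstart J"
    "path_image J = trail D q1 \<union> trail D q2 \<union> trail D q3"
    and tr: "trail D q1 \<inter> trail D q2 = {p B}" "trail D q2 \<inter> trail D q3 = {p C}"
    "trail D q3 \<inter> trail D q1 = {p A}"
    using Jordan_curve_of_three_paths[OF pd E q ends Int] unfolding A_def B_def C_def by metis
  have suc: "walk E q1" "walk E q2"
      "walk E q3" and ne: "q1 \<noteq> []" "q2 \<noteq> []" "q3 \<noteq> []"
    using q by (auto simp: graph_path_def)
  have inq: "A \<in> set q1" "B \<in> set q2" "C \<in> set q3" "B \<in> set q1" "C \<in> set q2" "A \<in> set q3"
    using ne ends hd_in_set last_in_set unfolding A_def B_def C_def by metis+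
  have ABC: "A \<noteq> B" "B \<noteq> C" "C \<noteq> A"
    using q[THEN graph_path_ends] ends unfolding A_def B_def C_def by auto
  have notY: "A \<notin> Y" "B \<notin> Y" "C \<notin> Y" "x \<noteq> A" "x \<noteq> B" "x \<noteq> C"
    using away inq by auto
  have xE: "{x, A} \<in> E" "{x, B} \<in> E" "{x, C} \<in> E"
    using adj unfolding A_def B_def C_def by auto
  obtain uA where uA: "uA \<in> Y" "{uA, A} \<in> E" using adj unfolding A_def by blast
  obtain uB where uB: "uB \<in> Y" "{uB, B} \<in> E" using adj unfolding B_def by blast
  obtain uC where uC: "uC \<in> Y" "{uC, C} \<in> E" using adj unfolding C_def by blast
  have inV: "v \<in> V" if "e \<in> E" "v \<in> e" for e v using that E by (auto simp: nsets_def)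
  have EV: "x \<in> V" "A \<in> V" "B \<in> V" "C \<in> V" using xE inV by blast+
  obtain K0 where K0: "connected K0" "p ` Y \<subseteq> K0" "K0 \<subseteq> p ` Y \<union> \<Union> (D ` {e \<in> E. e \<subseteq> Y})"
    using linked_connected[OF pd E Y(1)] by blast
  define HA HB HC where "HA = D {uA, A} - {p A}" and "HB = D {uB, B} - {p B}" and "HC = D {uC, C} - {p C}"
  define K where "K = K0 \<union> HA \<union> HB \<union> HC"
  have YV: "Y \<subseteq> V"
  proof (cases "\<exists>v. Y = {v}")
    case True then show ?thesis using Y(2) xy inV by blast
  next
    case False
    have "\<forall>v\<in>Y. Y = {v} \<or> (\<exists>e\<in>E. v \<in> e)" using Y(1)
    proof (induction rule: linked.induct)
      case (link X Z u v)
      have "w \<in> X \<Longrightarrow> \<exists>e\<in>E. w \<in> e" "w \<in> Z \<Longrightarrow> \<exists>e\<in>E. w \<in> e" for w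
        using link by (metis insertCI singletonD)+
      then show ?case by blast
    qed auto
    then show ?thesis using False inV by blast
  qed
  have inj: "\<And>u v. u \<in> V \<Longrightarrow> v \<in> V \<Longrightarrow> p u = p v \<Longrightarrow> u = v"
    using plane_drawingD(1)[OF pd] by (auto simp: inj_on_def)
  \<comment> \<open>The blob K is the drawing of Y with half-open edges that reach, but do not contain, the corners.
    It therefore misses the curve of every edge that has no end in Y.\<close>
  have Kavoid: "z \<notin> D e'" if "z \<in> K" "e' \<in> E" "e' \<inter> Y = {}" for z e'
  proof
    assume ze: "z \<in> D e'"
    have edge: False if e: "e \<in> E" "z \<in> D e" "e \<inter> Y \<noteq> {}" "z \<notin> p ` (e - Y)" for e
    proof -
      have "e \<noteq> e'" using e(3) \<open>e' \<inter> Y = {}\<close> by auto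
      then have "z \<in> p ` (e \<inter> e')" using plane_drawingD(3)[OF pd e(1) \<open>e' \<in> E\<close>] ze e(2) by blast
      then show False using e(4) \<open>e' \<inter> Y = {}\<close> by blast
    qed
    from \<open>z \<in> K\<close> consider "z \<in> p ` Y" | e where "e \<in> E" "e \<subseteq> Y" "z \<in> D e"
      | "z \<in> HA" | "z \<in> HB" | "z \<in> HC"
      using K0(3) unfolding K_def by auto
    then show False
    proof cases
      case 1
      then obtain v where v: "v \<in> Y" "z = p v" by auto
      then have "v \<in> e'" using vertex_in_edge_curve[OF pd E \<open>e' \<in> E\<close>, of v] YV ze by auto
      then show False using v \<open>e' \<inter> Y = {}\<close> by auto
    next
      case (2 e)
      have "e \<noteq> {}" using 2 E by (auto simp: nsets_def)
      then show False using edge[OF 2(1,3)] 2(2) by auto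
    next
      case 3 then show False using edge[OF uA(2)] uA(1) unfolding HA_def by auto
    next
      case 4 then show False using edge[OF uB(2)] uB(1) unfolding HB_def by auto
    next
      case 5 then show False using edge[OF uC(2)] uC(1) unfolding HC_def by auto
    qed
  qed
  have Ktrail: "K \<inter> trail D q = {}" if "walk E q" "set q \<inter> Y = {}" for q
  proof -
    have False if z: "z \<in> K" "z \<in> trail D q" for z
    proof -
      obtain e where "e \<in> E" "e \<subseteq> set q" "z \<in> D e"
        using trail_edge[OF \<open>walk E q\<close> z(2)] by blast
      then show False using Kavoid[OF z(1), of e] \<open>set q \<inter> Y = {}\<close> by blast
    qed
    then show ?thesis by blast
  qed
  have Kdisj: "K \<inter> trail D q1 = {}" "K \<inter> trail D q2 = {}" "K \<inter> trail D q3 = {}"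
      "K \<inter> D {x, A} = {}" "K \<inter> D {x, B} = {}" "K \<inter> D {x, C} = {}"
  proof -
    have "set q1 \<inter> Y = {}" "set q2 \<inter> Y = {}" "set q3 \<inter> Y = {}" using away by auto
    then show "K \<inter> trail D q1 = {}" "K \<inter> trail D q2 = {}" "K \<inter> trail D q3 = {}"
      using suc by (auto intro!: Ktrail)
    show "K \<inter> D {x, A} = {}" "K \<inter> D {x, B} = {}" "K \<inter> D {x, C} = {}"
      using Kavoid[OF _ xE(1)] Kavoid[OF _ xE(2)] Kavoid[OF _ xE(3)] notY Y(3) by auto
  qed
  have pend: "p u \<in> D {u, v} - {p v}" if "{u, v} \<in> E" "u \<noteq> v" for u v
    using edge_curve(3)[OF pd E that(1)] inj[of u v] inV[OF that(1)] that(2) by auto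
  have "p uA \<in> K0 \<inter> HA" "p uB \<in> (K0 \<union> HA) \<inter> HB" "p uC \<in> (K0 \<union> HA \<union> HB) \<inter> HC"
    using pend uA uB uC K0(2) notY unfolding HA_def HB_def HC_def by blast+
  moreover have "connected HA" "connected HB" "connected HC"
    using half_open_edge(1)[OF pd] uA uB uC unfolding HA_def HB_def HC_def by auto
  ultimately have "connected K"
    unfolding K_def using K0(1) connected_Un[of K0 HA] connected_Un[of "K0 \<union> HA" HB]
      connected_Un[of "K0 \<union> HA \<union> HB" HC] by blast
  have Kcl: "{p A, p B, p C} \<subseteq> closure K"
    using half_open_edge(2)[OF pd uA(2)] half_open_edge(2)[OF pd uB(2)] half_open_edge(2)[OF pd uC(2)]
      closure_mono[of HA K] closure_mono[of HB K] closure_mono[of HC K]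
    unfolding HA_def HB_def HC_def K_def by blast
  \<comment> \<open>Through the curve of the edge xy, the blob is connected with the star of x without its corners.\<close>
  define Q where "Q = K \<union> D {x, y} \<union> (D {x, A} - {p A}) \<union> (D {x, B} - {p B}) \<union> (D {x, C} - {p C})"
  have "p y \<in> K" using K0(2) Y(2) unfolding K_def by auto
  moreover have xyD: "{p x, p y} \<subseteq> D {x, y}" using edge_curve(3)[OF pd E xy] by auto
  ultimately have 0: "connected (K \<union> D {x, y})"
    using \<open>connected K\<close> edge_curve(2)[OF pd E xy] connected_Un[of K "D {x, y}"] by blast
  have leg: "connected (X \<union> (D {x, a} - {p a}))" if "connected X" "p x \<in> X" "{x, a} \<in> E" "x \<noteq> a" for X a
    by (rule connected_Un[OF that(1) half_open_edge(1)[OF pd that(3)]]) (use that pend[of x a] in auto)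
  have "connected Q"
    unfolding Q_def using xE notY xyD by (intro leg 0) auto
  have sepxy: "x \<notin> set q1 \<union> set q2 \<union> set q3" "y \<notin> set q1 \<union> set q2 \<union> set q3" using away Y by auto
  have LMgen: "D {x, a} \<inter> trail D q \<subseteq> p ` ({x, a} \<inter> set q)"
    if xa: "{x, a} \<in> E" "walk E q" "x \<notin> set q" for a q
  proof
    fix z assume z: "z \<in> D {x, a} \<inter> trail D q"
    then obtain e where e: "e \<in> E" "e \<subseteq> set q" "z \<in> D e" using trail_edge[OF xa(2)] by blast
    then have "{x, a} \<noteq> e" using xa(3) by auto
    then show "z \<in> p ` ({x, a} \<inter> set q)"
      using plane_drawingD(3)[OF pd xa(1) e(1)] z e by blast
  qed
  have qi: "set q1 \<inter> {A, B, C} = {A, B}" "set q2 \<inter> {A, B, C} = {B, C}" "set q3 \<inter> {A, B, C} = {C, A}"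
    using Int inq ABC unfolding A_def B_def C_def by blast+
  have trin: "p A \<in> trail D q1" "p A \<in> trail D q3" "p B \<in> trail D q1" "p B \<in> trail D q2"
     "p C \<in> trail D q2" "p C \<in> trail D q3" using tr by auto
  have legin: "p a \<in> D {x, a}" if "{x, a} \<in> E" for a using edge_curve(3)[OF pd E that] by auto
  have LM: "D {x, A} \<inter> trail D q1 = {p A}" "D {x, A} \<inter> trail D q3 = {p A}" "D {x, A} \<inter> trail D q2 = {}"
      "D {x, B} \<inter> trail D q1 = {p B}" "D {x, B} \<inter> trail D q2 = {p B}" "D {x, B} \<inter> trail D q3 = {}"
      "D {x, C} \<inter> trail D q2 = {p C}" "D {x, C} \<inter> trail D q3 = {p C}" "D {x, C} \<inter> trail D q1 = {}"
    using LMgen[OF xE(1) suc(1)] LMgen[OF xE(1) suc(2)] LMgen[OF xE(1) suc(3)]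
      LMgen[OF xE(2) suc(1)] LMgen[OF xE(2) suc(2)] LMgen[OF xE(2) suc(3)]
      LMgen[OF xE(3) suc(1)] LMgen[OF xE(3) suc(2)] LMgen[OF xE(3) suc(3)]
      sepxy qi ABC trin legin xE by auto
  have LL: "D {x, a} \<inter> D {x, b} = {p x}" if "{x, a} \<in> E" "{x, b} \<in> E" "a \<noteq> b" "x \<noteq> a" for a b
  proof -
    have "{x, a} \<noteq> {x, b}" using that by (auto simp: doubleton_eq_iff)
    then have "D {x, a} \<inter> D {x, b} \<subseteq> p ` ({x, a} \<inter> {x, b})" by (rule plane_drawingD(3)[OF pd that(1,2)])
    moreover have "{x, a} \<inter> {x, b} = {x}" using that by auto
    moreover have "p x \<in> D {x, a}" "p x \<in> D {x, b}" using edge_curve(3)[OF pd E] that by auto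
    ultimately show ?thesis by auto
  qed
  have "D {x, y} \<inter> path_image J = {}"
    using LMgen[OF xy suc(1)] LMgen[OF xy suc(2)] LMgen[OF xy suc(3)] sepxy J(3) by auto
  moreover have "(D {x, a} - {p a}) \<inter> path_image J = {}" if "a \<in> {A, B, C}" for a
    using that LM J(3) by auto
  ultimately have QJ: "Q \<inter> path_image J = {}"
    using Kdisj J(3) unfolding Q_def by auto
  \<comment> \<open>W is the side of the cycle that does not contain x.\<close>
  obtain inner outer where io: "inner \<noteq> {}" "open inner" "connected inner"
      "outer \<noteq> {}" "open outer" "connected outer" "inner \<inter> outer = {}"
      "inner \<union> outer = - path_image J" "frontier inner = path_image J" "frontier outer = path_image J"
    using Jordan_curve[OF J(1,2)] by metis
  have "Q \<subseteq> inner \<or> Q \<subseteq> outer"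
    using connectedD[OF \<open>connected Q\<close> io(2,5)] QJ io(7,8) by blast
  then obtain U W where UW: "Q \<subseteq> U" "open U" "open W" "connected W" "W \<noteq> {}" "U \<inter> W = {}"
      "U \<union> W = - path_image J" "frontier W = path_image J"
    using io by (metis Int_commute Un_commute)
  obtain w where "w \<in> W" using UW by blast
  have WL: "W \<inter> (D {x, A} \<union> D {x, B} \<union> D {x, C} \<union> trail D q1 \<union> trail D q2 \<union> trail D q3) = {}"
  proof -
    have "D {x, A} \<union> D {x, B} \<union> D {x, C} \<subseteq> Q \<union> {p A, p B, p C}" unfolding Q_def by auto
    moreover have "{p A, p B, p C} \<subseteq> path_image J" using trin J(3) by auto
    moreover have "trail D q1 \<union> trail D q2 \<union> trail D q3 = path_image J" using J(3) by simp
    moreover have "W \<inter> Q = {}" "W \<inter> path_image J = {}" using UW by blast+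
    ultimately show ?thesis by blast
  qed
  have trc: "compact (trail D q1)" "compact (trail D q2)" "connected (trail D q2)" "compact (trail D q3)"
    using arc_trail[OF pd E q(1)] arc_trail[OF pd E q(2)] arc_trail[OF pd E q(3)]
      compact_arc_image connected_arc_image by metis+
  have "connected_component (- (D {x, A} \<union> D {x, B} \<union> D {x, C} \<union> trail D q1 \<union> trail D q2 \<union> trail D q3)) (p y) w"
  proof (rule connected_component_around_tripod[where x="p x" and a="p A" and b="p B" and c="p C" and K=K and W=W])
    show "{p A, p B, p C} \<subseteq> closure W"
      using UW(8) trin J(3) by (auto simp: frontier_def)
    show "(K \<union> W) \<inter> (D {x, A} \<union> D {x, B} \<union> D {x, C} \<union> trail D q1 \<union> trail D q2 \<union> trail D q3) = {}"
      using WL Kdisj by (simp add: Int_Un_distrib Int_Un_distrib2)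
    show "D {x, A} \<inter> D {x, B} = {p x}" "D {x, B} \<inter> D {x, C} = {p x}" "D {x, C} \<inter> D {x, A} = {p x}"
      using LL xE ABC notY by auto
  qed (use edge_curve(1,2)[OF pd E] xE trc tr LM Kcl \<open>connected K\<close> UW \<open>p y \<in> K\<close> \<open>w \<in> W\<close> in simp_all)
  then obtain T where T: "connected T" "T \<subseteq> - path_image J" "p y \<in> T" "w \<in> T"
    unfolding connected_component_def using J(3) by blast
  have "p y \<in> U" using UW(1) \<open>p y \<in> K\<close> unfolding Q_def by blast
  then show False
    using connectedD[OF T(1) UW(2,3)] T UW(6,7) \<open>w \<in> W\<close> by blast
qed

section \<open>Gluing graphs to which no edge can be added\<close>

text \<open>The part of \<open>maximal_planar\<close> that is not obvious from a straight-line drawing.\<close>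

definition saturated :: "'v set \<Rightarrow> 'v set set \<Rightarrow> bool" where
  "saturated V E \<longleftrightarrow>
     (\<forall>x\<in>V. \<forall>y\<in>V. x \<noteq> y \<longrightarrow> {x, y} \<notin> E \<longrightarrow> \<not> planar V (insert {x, y} E))"

text \<open>If a gadget is glued into the triangle \<open>t\<close>, then the remaining vertices are to serve as a
single branch set that is adjacent to all three corners. If there are no remaining vertices, nothing
is required.\<close>

definition attached :: "'v set \<Rightarrow> 'v set set \<Rightarrow> 'v set \<Rightarrow> bool" where
  "attached V E t \<longleftrightarrow> V = t \<or> linked E (V - t) \<and> (\<forall>a\<in>t. \<exists>u\<in>V - t. {u, a} \<in> E)"

text \<open>Restricting a drawing to a subgraph. It reduces maximality to the addition of single
edges, and it lets nonplanarity pass from a part to the whole of a glued graph.\<close>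

lemma planar_mono:
  assumes "planar V' E'" "V \<subseteq> V'" "E \<subseteq> E'" "E \<subseteq> nsets V 2"
  shows "planar V E"
proof -
  obtain p D where pd: "plane_drawing V' E' p D" using assms(1) by (auto simp: planar_def)
  have "inj_on p V" using plane_drawingD(1)[OF pd] assms(2) inj_on_subset by blast
  moreover have "D e \<inter> p ` V = p ` e" if "e \<in> E" for e
  proof -
    have "e \<subseteq> V" using that assms(4) by (auto simp: nsets_def)
    moreover have "D e \<inter> p ` V' = p ` e" using plane_drawingD(2)[OF pd] that assms(3) by blast
    ultimately show ?thesis using assms(2) by blast
  qed
  ultimately have "plane_drawing V E p D"
    using plane_drawingD(3,4)[OF pd] assms(3) unfolding plane_drawing_def by (metis subsetD)
  then show ?thesis by (auto simp: planar_def)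
qed

lemma maximal_planarI:
  assumes "simple_graph V E" "planar V E" "saturated V E"
  shows "maximal_planar V E"
  unfolding maximal_planar_def
proof (intro conjI allI impI)
  fix E' assume E': "simple_graph V E' \<and> planar V E' \<and> E \<subseteq> E'"
  show "E' = E"
  proof (rule ccontr)
    assume "E' \<noteq> E"
    then obtain e where "e \<in> E'" "e \<notin> E" using E' by blast
    moreover have "e \<in> nsets V 2" using E' calculation by (auto simp: simple_graph_def)
    then obtain x y where "e = {x, y}" "x \<noteq> y" "x \<in> V" "y \<in> V"
      by (auto simp: nsets_def card_2_iff)
    moreover have "insert e E \<subseteq> E'" "insert e E \<subseteq> nsets V 2"
      using E' calculation by (auto simp: simple_graph_def)
    then have "planar V (insert e E)" using planar_mono[of V E' V] E' by blast
    ultimately show False using assms(3) unfolding saturated_def by blast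
  qed
qed (use assms in auto)

lemma K5_witness_mono:
  assumes "K5_witness E x y" and E: "E \<subseteq> E'"
  shows "K5_witness E' x y"
proof -
  have "graph_path E q \<Longrightarrow> graph_path E' q" for q
    using E by (auto simp: graph_path_def elim!: successively_mono)
  moreover have "(\<forall>a\<in>T. {x, a} \<in> E \<and> (\<exists>u\<in>Y. {u, a} \<in> E)) \<Longrightarrow>
      (\<forall>a\<in>T. {x, a} \<in> E' \<and> (\<exists>u\<in>Y. {u, a} \<in> E'))" for T Y
    using E by blast
  ultimately show ?thesis
    using assms(1) linked_mono[OF _ E] unfolding K5_witness_def
    by (elim exE conjE) (intro exI conjI; assumption | blast)
qed

lemma K5_witness_not_planar:
  assumes "K5_witness E x y" "E \<subseteq> nsets V 2" "x \<in> V" "y \<in> V" "x \<noteq> y"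
  shows "\<not> planar V (insert {x, y} E)"
proof
  assume "planar V (insert {x, y} E)"
  then obtain p D where pd: "plane_drawing V (insert {x, y} E) p D" by (auto simp: planar_def)
  have E: "insert {x, y} E \<subseteq> nsets V 2" using assms(2-5) by (auto simp: nsets_def)
  have "K5_witness (insert {x, y} E) x y" using assms(1) by (rule K5_witness_mono) auto
  then show False by (rule K5_witness_blocks_edge[OF pd E, rotated]) simp
qed

text \<open>Two kinds of new missing edges arise when \<open>N\<close> and \<open>F\<close> are added at the triangle \<open>t\<close>.
Those within \<open>t \<union> N\<close> are blocked by the new part alone. Those between \<open>N\<close> and \<open>V - t\<close> must be
blocked using nothing about the old part but that \<open>V - t\<close> is linked and adjacent to the corners;
therefore \<open>outer\<close> speaks about an arbitrary such set \<open>Y\<close>.\<close>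

lemma saturated_glue:
  assumes sat: "saturated V E" and E: "E \<subseteq> nsets V 2" and t: "t \<subseteq> V" "nsets t 2 \<subseteq> E"
    and att: "attached V E t" and N: "N \<inter> V = {}" and F: "F \<subseteq> nsets (t \<union> N) 2"
    and inner: "\<And>x y. x \<in> t \<union> N \<Longrightarrow> y \<in> N \<Longrightarrow> x \<noteq> y \<Longrightarrow> {x, y} \<notin> F \<Longrightarrow>
      K5_witness (nsets t 2 \<union> F) x y \<or> K5_witness (nsets t 2 \<union> F) y x"
    and outer: "\<And>x y Y E'. x \<in> N \<Longrightarrow> y \<in> Y \<Longrightarrow> Y \<inter> (t \<union> N) = {} \<Longrightarrow> linked E' Y \<Longrightarrow>
      \<forall>a\<in>t. \<exists>u\<in>Y. {u, a} \<in> E' \<Longrightarrow> nsets t 2 \<union> F \<subseteq> E' \<Longrightarrow> K5_witness E' x y"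
  shows "saturated (V \<union> N) (E \<union> F)"
  unfolding saturated_def
proof (intro ballI impI)
  fix x y assume x: "x \<in> V \<union> N" and y: "y \<in> V \<union> N" and xy: "x \<noteq> y" "{x, y} \<notin> E \<union> F"
  have "F \<subseteq> nsets (V \<union> N) 2" "E \<subseteq> nsets (V \<union> N) 2"
    using F E t(1) nsets_mono[of "t \<union> N" "V \<union> N" 2] nsets_mono[of V "V \<union> N" 2] by auto
  then have EF: "E \<union> F \<subseteq> nsets (V \<union> N) 2" by auto
  have wit: "\<not> planar (V \<union> N) (insert {x, y} (E \<union> F))" if "K5_witness (E \<union> F) x y \<or> K5_witness (E \<union> F) y x"
    using that K5_witness_not_planar[OF _ EF x y xy(1)] K5_witness_not_planar[OF _ EF y x] xy(1)
    by (auto simp: insert_commute)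
  have tF: "nsets t 2 \<union> F \<subseteq> E \<union> F" using t by auto
  have out: "K5_witness (E \<union> F) v w" if "v \<in> N" "w \<in> V - t" for v w
  proof (rule outer[OF that])
    show "(V - t) \<inter> (t \<union> N) = {}" using N by auto
    show "linked (E \<union> F) (V - t)" "\<forall>a\<in>t. \<exists>u\<in>V - t. {u, a} \<in> E \<union> F"
      using att that(2) linked_mono[of E "V - t" "E \<union> F"] unfolding attached_def by auto
  qed (rule tF)
  have inn: "K5_witness (E \<union> F) v w \<or> K5_witness (E \<union> F) w v"
    if "v \<in> t \<union> N" "w \<in> N" "v \<noteq> w" "{v, w} \<notin> F" for v w
    using inner[OF that] K5_witness_mono[OF _ tF] by blast
  consider "x \<in> V" "y \<in> V" | "x \<in> N" "y \<in> V - t" | "y \<in> N" "x \<in> V - t"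
    | "x \<in> N" "y \<in> t \<union> N" | "y \<in> N" "x \<in> t \<union> N"
    using x y by blast
  then show "\<not> planar (V \<union> N) (insert {x, y} (E \<union> F))"
  proof cases
    case 1
    then have "\<not> planar V (insert {x, y} E)" using sat xy by (auto simp: saturated_def)
    moreover have "insert {x, y} E \<subseteq> nsets V 2" using 1 E xy(1) by (auto simp: nsets_def)
    ultimately show ?thesis using planar_mono[of "V \<union> N" "insert {x, y} (E \<union> F)" V "insert {x, y} E"] by blast
  next
    case 2 then show ?thesis using out wit by blast
  next
    case 3 then show ?thesis using out wit by blast
  next
    case 4 then show ?thesis using inn[of y x] wit xy by (auto simp: insert_commute)
  next
    case 5 then show ?thesis using inn[of x y] wit xy by auto
  qed
qed

lemma nsets_3_2: "nsets {a, b, c} 2 = {{a, b}, {b, c}, {c, a}}" if "a \<noteq> b" "b \<noteq> c" "c \<noteq> a"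
proof -
  have "e \<in> {{a, b}, {b, c}, {c, a}}" if "e \<subseteq> {a, b, c}" "card e = 2" for e
    using that by (auto simp: card_2_iff insert_commute)
  then show ?thesis using that by (auto simp: nsets_def)
qed

text \<open>The vertex \<open>v\<close> is the centre of the obstruction, the triangle is its cycle, and all old
vertices outside the triangle form the other branch set.\<close>

lemma saturated_add_vertex:
  assumes "saturated V E" "E \<subseteq> nsets V 2" and abc: "{a, b, c} \<subseteq> V" "a \<noteq> b" "b \<noteq> c" "c \<noteq> a"
    and "nsets {a, b, c} 2 \<subseteq> E" "attached V E {a, b, c}" "v \<notin> V"
  shows "saturated (V \<union> {v}) (E \<union> {{v, a}, {v, b}, {v, c}})"
proof (rule saturated_glue[where t="{a, b, c}"])
  have v: "v \<noteq> a" "v \<noteq> b" "v \<noteq> c" using assms by auto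
  show "{{v, a}, {v, b}, {v, c}} \<subseteq> nsets ({a, b, c} \<union> {v}) 2" using v by (auto simp: nsets_def)
  fix x y Y E'
  assume *: "x \<in> {v}" "y \<in> Y" "Y \<inter> ({a, b, c} \<union> {v}) = {}" "linked E' Y"
      "\<forall>a\<in>{a, b, c}. \<exists>u\<in>Y. {u, a} \<in> E'" "nsets {a, b, c} 2 \<union> {{v, a}, {v, b}, {v, c}} \<subseteq> E'"
  then show "K5_witness E' x y"
    unfolding K5_witness_def nsets_3_2[OF abc(2-4)] using abc(2-4) v
    by (intro exI[of _ "[a, b]"] exI[of _ "[b, c]"] exI[of _ "[c, a]"] exI[of _ Y])
       (auto simp: graph_path_def)
qed (use assms in \<open>auto simp: insert_commute\<close>)

text \<open>An executable certificate for \<open>linked\<close>: read from the end, every entry is joined to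
the set collected so far.\<close>

fun linked_order :: "('a \<Rightarrow> 'a \<Rightarrow> bool) \<Rightarrow> 'a list \<Rightarrow> bool" where
  "linked_order r [] = False"
| "linked_order r [y] = True"
| "linked_order r (y # z # ys) \<longleftrightarrow> linked_order r (z # ys) \<and> (\<exists>u\<in>set (z # ys). r u y)"

text \<open>An executable description of a \<open>K5_witness\<close> over labels: the centre \<open>x\<close>, the
branch set \<open>ys\<close> in an order that certifies its connectedness, and the three paths of the cycle. Only
the branch set may use labels beyond \<open>8\<close>.\<close>

definition witness_row ::
  "(nat \<Rightarrow> nat \<Rightarrow> bool) \<Rightarrow> nat \<times> nat list \<times> nat list \<times> nat list \<times> nat list \<Rightarrow> bool" where
  "witness_row r = (\<lambda>(x, ys, q1, q2, q3).
     (\<forall>q\<in>set [q1, q2, q3]. 2 \<le> length q \<and> distinct q \<and> successively r q \<and>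
        (\<forall>v\<in>set q. v < 9 \<and> v \<noteq> x \<and> v \<notin> set ys)) \<and>
     last q1 = hd q2 \<and> last q2 = hd q3 \<and> last q3 = hd q1 \<and>
     (\<forall>v\<in>set q1. v \<in> set q2 \<longrightarrow> v = hd q2) \<and> (\<forall>v\<in>set q2. v \<in> set q3 \<longrightarrow> v = hd q3) \<and>
     (\<forall>v\<in>set q3. v \<in> set q1 \<longrightarrow> v = hd q1) \<and>
     linked_order r ys \<and> x < 9 \<and> x \<notin> set ys \<and>
     (\<forall>a\<in>set [hd q1, hd q2, hd q3]. r x a \<and> (\<exists>u\<in>set ys. r u a)))"

lemma linked_branch_sets:
  assumes "linked_order r ys" "\<forall>i\<in>set ys. linked E (\<phi> i)"
    and "\<And>i j. i \<in> set ys \<Longrightarrow> j \<in> set ys \<Longrightarrow> r i j \<Longrightarrow> \<exists>u\<in>\<phi> i. \<exists>v\<in>\<phi> j. {u, v} \<in> E"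
  shows "linked E (\<Union>i\<in>set ys. \<phi> i)"
  using assms
proof (induction r ys rule: linked_order.induct)
  case (3 r y z ys)
  obtain i where i: "i \<in> set (z # ys)" "r i y" using 3(2) by auto
  then obtain u v where "u \<in> \<phi> i" "v \<in> \<phi> y" "{u, v} \<in> E" using 3(4)[of i y] by auto
  moreover have "linked E (\<Union>i\<in>set (z # ys). \<phi> i)" using 3 by auto
  moreover have "linked E (\<phi> y)" using 3 by auto
  ultimately have "linked E ((\<Union>i\<in>set (z # ys). \<phi> i) \<union> \<phi> y)"
    using i(1) by (intro linked.link[of E _ _ u v]) auto
  then show ?case by (simp add: Un_ac)
qed auto

text \<open>Labels below \<open>9\<close> are single vertices under \<open>h\<close>. Other labels stand for whole
linked vertex sets, so that a finite table covers graphs in which such a set has arbitrary size.\<close>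

lemma K5_witness_of_row:
  assumes row: "witness_row r (x, ys, q1, q2, q3)"
    and h: "inj_on h {..<9}"
    and \<phi>: "\<And>i. i < 9 \<Longrightarrow> \<phi> i = {h i}" "\<And>i. i \<in> set ys \<Longrightarrow> i < 9 \<or> \<phi> i \<inter> h ` {..<9} = {}"
      "\<And>i. i \<in> set ys \<Longrightarrow> linked E (\<phi> i)"
    and r: "\<And>i j. r i j \<Longrightarrow> i < 9 \<or> i \<in> set ys \<Longrightarrow> j < 9 \<or> j \<in> set ys \<Longrightarrow> \<exists>u\<in>\<phi> i. \<exists>v\<in>\<phi> j. {u, v} \<in> E"
    and y: "y \<in> set ys" "y' \<in> \<phi> y"
  shows "K5_witness E (h x) y'"
proof -
  note row = row[unfolded witness_row_def, simplified]
  have sep: "\<forall>v\<in>set q1. v < 9 \<and> v \<noteq> x \<and> v \<notin> set ys" "\<forall>v\<in>set q2. v < 9 \<and> v \<noteq> x \<and> v \<notin> set ys"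
    "\<forall>v\<in>set q3. v < 9 \<and> v \<noteq> x \<and> v \<notin> set ys" using row by blast+
  have lt: "\<forall>v\<in>set q1. v < 9" "\<forall>v\<in>set q2. v < 9" "\<forall>v\<in>set q3. v < 9" and xlt: "x < 9"
    using row by blast+
  have meet: "\<forall>v\<in>set q1. v \<in> set q2 \<longrightarrow> v = hd q2" "\<forall>v\<in>set q2. v \<in> set q3 \<longrightarrow> v = hd q3"
    "\<forall>v\<in>set q3. v \<in> set q1 \<longrightarrow> v = hd q1" using row by blast+
  have ends: "last q1 = hd q2" "last q2 = hd q3" "last q3 = hd q1" using row by blast+
  have hE: "{h i, h j} \<in> E" if "r i j" "i < 9" "j < 9" for i j using r[OF that(1)] that \<phi>(1) by auto
  have path: "graph_path E (map h q)"
    if "2 \<le> length q" "distinct q" "successively r q" "\<forall>v\<in>set q. v < 9" for q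
  proof -
    have "successively (\<lambda>u v. {h u, h v} \<in> E) q"
      using that(3) by (rule successively_mono) (use that hE in auto)
    then show ?thesis using that h by (auto simp: graph_path_def successively_map distinct_map inj_on_def)
  qed
  have ne: "q1 \<noteq> []" "q2 \<noteq> []" "q3 \<noteq> []" using row by auto
  have hin: "hd q1 \<in> set q1" "hd q2 \<in> set q2" "hd q3 \<in> set q3" "hd q2 \<in> set q1" "hd q3 \<in> set q2" "hd q1 \<in> set q3"
    using ne ends hd_in_set last_in_set by metis+
  have int: "h ` set q \<inter> h ` set q' = {h v}"
    if "\<forall>v\<in>set q. v < 9" "\<forall>v\<in>set q'. v < 9" "\<forall>w\<in>set q. w \<in> set q' \<longrightarrow> w = v" "v \<in> set q" "v \<in> set q'" for q q' v
  proof -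
    have "h ` set q \<inter> h ` set q' = h ` (set q \<inter> set q')"
      by (rule inj_on_image_Int[OF h, symmetric]) (use that(1,2) in auto)
    also have "set q \<inter> set q' = {v}" using that(3-5) by blast
    finally show ?thesis by simp
  qed
  let ?Y = "\<Union>i\<in>set ys. \<phi> i"
  have avoid: "h v \<notin> ?Y" if "v < 9" "v \<notin> set ys" for v
  proof
    assume "h v \<in> ?Y"
    then obtain i where i: "i \<in> set ys" "h v \<in> \<phi> i" by auto
    then have "i < 9" using \<phi>(2)[OF i(1)] that(1) by auto
    then show False using i \<phi>(1) h that by (auto simp: inj_on_def)
  qed
  have hx: "h v \<noteq> h x" if "v < 9" "v \<noteq> x" for v using h that xlt by (auto simp: inj_on_def)
  show ?thesis
    unfolding K5_witness_def
  proof (intro exI conjI)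
    show "graph_path E (map h q1)" "graph_path E (map h q2)" "graph_path E (map h q3)"
      by (rule path; use row in blast)+
    show "last (map h q1) = hd (map h q2)" "last (map h q2) = hd (map h q3)" "last (map h q3) = hd (map h q1)"
      using ne ends by (simp_all add: last_map hd_map)
    show "set (map h q1) \<inter> set (map h q2) = {hd (map h q2)}"
      "set (map h q2) \<inter> set (map h q3) = {hd (map h q3)}" "set (map h q3) \<inter> set (map h q1) = {hd (map h q1)}"
      using int[OF lt(1,2) meet(1) hin(4,2)] int[OF lt(2,3) meet(2) hin(5,3)]
        int[OF lt(3,1) meet(3) hin(6,1)] ne by (simp_all only: hd_map set_map not_False_eq_True)
    have "linked_order r ys" using row by blast
    then show "linked E ?Y"
      by (rule linked_branch_sets) (auto intro: \<phi>(3) r)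
    show "y' \<in> ?Y" using y by blast
    show "h x \<notin> ?Y" using avoid row by blast
    show "(set (map h q1) \<union> set (map h q2) \<union> set (map h q3)) \<inter> insert (h x) ?Y = {}"
    proof -
      have "h v \<noteq> h x \<and> h v \<notin> ?Y" if "v \<in> set q1 \<union> set q2 \<union> set q3" for v
        using that sep by (metis Un_iff avoid hx)
      note sepv = this
      show ?thesis
      proof (rule equals0I)
        fix z assume z: "z \<in> (set (map h q1) \<union> set (map h q2) \<union> set (map h q3)) \<inter> insert (h x) ?Y"
        then obtain v where v: "v \<in> set q1 \<union> set q2 \<union> set q3" "z = h v" by auto
        show False using sepv[OF v(1)] z unfolding v(2) by blast
      qed
    qed
    have "{h x, h a} \<in> E \<and> (\<exists>u\<in>?Y. {u, h a} \<in> E)" if a: "a \<in> {hd q1, hd q2, hd q3}" for a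
    proof -
      have "a < 9" using a hin lt by blast
      moreover have ra: "r x a" "\<exists>u\<in>set ys. r u a" using a row by blast+
      then obtain i where i: "i \<in> set ys" "r i a" by blast
      ultimately obtain u where "u \<in> \<phi> i" "{u, h a} \<in> E" using r[of i a] \<phi>(1)[of a] by auto
      then show ?thesis using hE[OF ra(1) xlt \<open>a < 9\<close>] i(1) by blast
    qed
    then show "\<forall>a\<in>{hd (map h q1), hd (map h q2), hd (map h q3)}. {h x, a} \<in> E \<and> (\<exists>u\<in>?Y. {u, a} \<in> E)"
      using ne by (simp add: hd_map)
  qed
qed

section \<open>Straight-line drawings and their faces\<close>

text \<open>Twice the signed area of the triangle; positive if it is traversed counterclockwise.\<close>

definition orient :: "complex \<Rightarrow> complex \<Rightarrow> complex \<Rightarrow> real" where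
  "orient a b c = (Re b - Re a) * (Im c - Im a) - (Im b - Im a) * (Re c - Re a)"

lemma orient_rotate: "orient b c a = orient a b c"
  and orient_swap: "orient b a c = - orient a b c"
  and orient_degenerate [simp]: "orient a a c = 0" "orient a b a = 0" "orient a b b = 0"
  by (simp_all add: orient_def algebra_simps)

lemma orient_affine:
  "orient a b (u *\<^sub>R x + v *\<^sub>R y + w *\<^sub>R z) = u * orient a b x + v * orient a b y + w * orient a b z"
  if "u + v + w = 1"
proof -
  have u: "u = 1 - v - w" using that by simp
  show ?thesis unfolding u by (simp add: orient_def algebra_simps)
qed

lemma orient_segment:
  "orient a b ((1 - u) *\<^sub>R x + u *\<^sub>R y) = (1 - u) * orient a b x + u * orient a b y"
  by (simp add: orient_def algebra_simps)

lemma collinear_iff_orient: "collinear {a, b, c} \<longleftrightarrow> orient a b c = 0"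
proof
  assume "collinear {a, b, c}"
  then obtain u where u: "\<And>x y. x \<in> {a, b, c} \<Longrightarrow> y \<in> {a, b, c} \<Longrightarrow> \<exists>k. x - y = k *\<^sub>R u"
    unfolding collinear_def by blast
  obtain k l where "b - a = k *\<^sub>R u" "c - a = l *\<^sub>R u" using u[of b a] u[of c a] by auto
  then have "Re b - Re a = k * Re u" "Im b - Im a = k * Im u" "Re c - Re a = l * Re u" "Im c - Im a = l * Im u"
    by (metis complex_scaleR minus_complex.sel scaleR_complex.sel)+
  then show "orient a b c = 0" by (simp add: orient_def)
next
  assume 0: "orient a b c = 0"
  show "collinear {a, b, c}"
  proof (cases "b = a")
    case True then show ?thesis by simp
  next
    case False
    define k where "k = (if Re b \<noteq> Re a then (Re c - Re a) / (Re b - Re a) else (Im c - Im a) / (Im b - Im a))"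
    have "c - a = k *\<^sub>R (b - a)"
      using 0 False by (auto simp: complex_eq_iff k_def orient_def field_simps)
    then have "collinear {0, b - a, c - a}" by (auto simp: collinear_lemma)
    then have "collinear {b, a, c}" by (subst collinear_3) (auto simp: collinear_3)
    then show ?thesis by (simp add: insert_commute)
  qed
qed

lemma in_triangle_iff:
  assumes pos: "0 < orient a b c"
  shows "z \<in> convex hull {a, b, c} \<longleftrightarrow> 0 \<le> orient a b z \<and> 0 \<le> orient b c z \<and> 0 \<le> orient c a z"
proof
  assume "z \<in> convex hull {a, b, c}"
  then obtain u v w where uvw: "0 \<le> u" "0 \<le> v" "0 \<le> w" "u + v + w = 1" "z = u *\<^sub>R a + v *\<^sub>R b + w *\<^sub>R c"
    by (auto simp: convex_hull_3)
  then show "0 \<le> orient a b z \<and> 0 \<le> orient b c z \<and> 0 \<le> orient c a z"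
    using pos orient_rotate[of b c a] orient_rotate[of a b c] by (simp add: orient_affine)
next
  assume z: "0 \<le> orient a b z \<and> 0 \<le> orient b c z \<and> 0 \<le> orient c a z"
  define d where "d = orient a b c"
  have sum: "orient b c z + orient c a z + orient a b z = d"
    by (simp add: orient_def d_def algebra_simps)
  have "d *\<^sub>R z = orient b c z *\<^sub>R a + orient c a z *\<^sub>R b + orient a b z *\<^sub>R c"
    by (simp add: complex_eq_iff orient_def d_def algebra_simps)
  then have "z = inverse d *\<^sub>R (orient b c z *\<^sub>R a + orient c a z *\<^sub>R b + orient a b z *\<^sub>R c)"
    using pos by (metis d_def divideR_right less_irrefl)
  then have "z = (orient b c z / d) *\<^sub>R a + (orient c a z / d) *\<^sub>R b + (orient a b z / d) *\<^sub>R c"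
    by (simp add: scaleR_add_right divide_inverse_commute)
  moreover have "orient b c z / d + orient c a z / d + orient a b z / d = 1"
    using sum pos by (simp add: d_def add_divide_distrib[symmetric])
  ultimately show "z \<in> convex hull {a, b, c}"
    unfolding convex_hull_3 using z pos by (intro CollectI exI conjI) (auto simp: d_def)
qed

lemma segments_disjoint:
  assumes "0 < orient a b c * orient a b d"
  shows "convex hull {a, b} \<inter> convex hull {c, d} = {}"
proof -
  have False if z: "z \<in> closed_segment a b" "z \<in> closed_segment c d" for z
  proof -
    obtain u where u: "z = (1 - u) *\<^sub>R a + u *\<^sub>R b" using z(1) by (auto simp: in_segment)
    obtain v where v: "0 \<le> v" "v \<le> 1" "z = (1 - v) *\<^sub>R c + v *\<^sub>R d" using z(2) by (auto simp: in_segment)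
    have "orient a b z = 0" unfolding u by (simp add: orient_segment)
    moreover have "orient a b z = (1 - v) * orient a b c + v * orient a b d" unfolding v by (simp add: orient_segment)
    ultimately have eq: "(1 - v) * orient a b c = - (v * orient a b d)" by simp
    then have "(1 - v) * (orient a b c * orient a b d) = - (v * (orient a b d)^2)"
      by (metis mult.assoc mult.commute mult_minus_left power2_eq_square)
    moreover have "0 \<le> (1 - v) * (orient a b c * orient a b d)" using v assms by simp
    moreover have "0 \<le> v * (orient a b d)^2" using v by simp
    ultimately have "v * (orient a b d)^2 = 0" "(1 - v) * (orient a b c * orient a b d) = 0" by linarith+
    moreover have "orient a b d \<noteq> 0" using assms by auto
    ultimately show False using assms by auto
  qed
  then show ?thesis by (auto simp: segment_convex_hull[symmetric])
qed

lemma segments_common_end: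
  assumes "orient a b c \<noteq> 0"
  shows "convex hull {a, b} \<inter> convex hull {a, c} = {a}"
proof -
  have "z = a" if z: "z \<in> closed_segment a b" "z \<in> closed_segment a c" for z
  proof -
    obtain u where u: "z = (1 - u) *\<^sub>R a + u *\<^sub>R b" using z(1) by (auto simp: in_segment)
    obtain v where v: "z = (1 - v) *\<^sub>R a + v *\<^sub>R c" using z(2) by (auto simp: in_segment)
    have "orient a b z = 0" unfolding u by (simp add: orient_segment)
    then have "v * orient a b c = 0" unfolding v by (simp add: orient_segment)
    then show ?thesis using assms v by simp
  qed
  then show ?thesis by (auto simp: segment_convex_hull[symmetric])
qed

lemma general_position_iff:
  "general_position S \<longleftrightarrow>
     (\<forall>a\<in>S. \<forall>b\<in>S. \<forall>c\<in>S. a \<noteq> b \<longrightarrow> b \<noteq> c \<longrightarrow> c \<noteq> a \<longrightarrow> orient a b c \<noteq> 0)"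
proof -
  have "t \<in> nsets S 3 \<longleftrightarrow> (\<exists>a\<in>S. \<exists>b\<in>S. \<exists>c\<in>S. a \<noteq> b \<and> b \<noteq> c \<and> c \<noteq> a \<and> t = {a, b, c})" for t
    by (auto simp: nsets_def card_3_iff)
  note nsets3 = this
  show ?thesis
    unfolding general_position_def
  proof (intro iffI ballI impI)
    fix a b c
    assume gp: "\<forall>t\<in>nsets S 3. \<not> collinear t" and "a \<in> S" "b \<in> S" "c \<in> S" "a \<noteq> b" "b \<noteq> c" "c \<noteq> a"
    then have "{a, b, c} \<in> nsets S 3" unfolding nsets3 by blast
    then show "orient a b c \<noteq> 0" using gp collinear_iff_orient by blast
  next
    fix t
    assume gp: "\<forall>a\<in>S. \<forall>b\<in>S. \<forall>c\<in>S. a \<noteq> b \<longrightarrow> b \<noteq> c \<longrightarrow> c \<noteq> a \<longrightarrow> orient a b c \<noteq> 0" and "t \<in> nsets S 3"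
    then obtain a b c where "a \<in> S" "b \<in> S" "c \<in> S" "a \<noteq> b" "b \<noteq> c" "c \<noteq> a" and t: "t = {a, b, c}"
      unfolding nsets3 by blast
    then show "\<not> collinear t" unfolding t collinear_iff_orient using gp by simp
  qed
qed

lemma general_position_segment:
  assumes "general_position S" "s \<in> S" "a \<in> S" "b \<in> S" "a \<noteq> b" "s \<in> convex hull {a, b}"
  shows "s \<in> {a, b}"
proof (rule ccontr)
  assume "s \<notin> {a, b}"
  then have "orient a b s \<noteq> 0" using assms(1-5) by (auto simp: general_position_iff)
  moreover obtain u where u: "s = (1 - u) *\<^sub>R a + u *\<^sub>R b"
    using assms(6) by (auto simp: segment_convex_hull[symmetric] in_segment)
  have "orient a b s = 0" unfolding u by (simp add: orient_segment)
  ultimately show False by simp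
qed

text \<open>Triangles of edges, not just of points. In the presence of a triangular hull these are
the bounded faces.\<close>

definition empty_triangles :: "complex set \<Rightarrow> complex set set \<Rightarrow> complex set set" where
  "empty_triangles S G = {t \<in> nsets S 3. nsets t 2 \<subseteq> G \<and> S \<inter> convex hull t \<subseteq> t}"

lemma three_subset:
  assumes "t \<in> nsets S 3"
  obtains a b c where "t = {a, b, c}" "a \<in> S" "b \<in> S" "c \<in> S" "a \<noteq> b" "b \<noteq> c" "c \<noteq> a"
  using assms by (auto simp: nsets_def card_3_iff)

lemma triangle_frontier_interior:
  assumes "t \<in> nsets S 3" "general_position S"
  shows "frontier (convex hull t) = (\<Union>e\<in>nsets t 2. convex hull e)"
    and "interior (convex hull t) \<noteq> {}"
    and "frontier (interior (convex hull t)) = (\<Union>e\<in>nsets t 2. convex hull e)"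
proof -
  obtain a b c where t: "t = {a, b, c}" "a \<in> S" "b \<in> S" "c \<in> S" "a \<noteq> b" "b \<noteq> c" "c \<noteq> a"
    using three_subset[OF assms(1)] by blast
  show fr: "frontier (convex hull t) = (\<Union>e\<in>nsets t 2. convex hull e)"
    unfolding t(1) nsets_3_2[OF t(5-7)] by (simp add: frontier_of_triangle segment_convex_hull Un_ac)
  have "\<not> collinear {a, b, c}" using assms t by (simp add: general_position_def)
  then have int: "interior (convex hull {a, b, c}) = {v. \<exists>x y z. 0 < x \<and> 0 < y \<and> 0 < z \<and> x + y + z = 1 \<and>
      x *\<^sub>R a + y *\<^sub>R b + z *\<^sub>R c = v}"
    by (rule interior_convex_hull_3_minimal) simp
  have "(1/3) *\<^sub>R a + (1/3) *\<^sub>R b + (1/3) *\<^sub>R c \<in> interior (convex hull {a, b, c})"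
    unfolding int by (intro CollectI exI[of _ "1/3::real"]) auto
  then show ne: "interior (convex hull t) \<noteq> {}" unfolding t(1) by blast
  have "closure (interior (convex hull t)) = closure (convex hull t)"
    by (rule convex_closure_interior) (use ne in auto)
  then show "frontier (interior (convex hull t)) = (\<Union>e\<in>nsets t 2. convex hull e)"
    unfolding fr[symmetric] by (simp add: frontier_def)
qed

lemma crossing_freeD:
  assumes "crossing_free S G"
  shows "finite S" "G \<subseteq> nsets S 2"
    "e \<in> G \<Longrightarrow> e' \<in> G \<Longrightarrow> e \<noteq> e' \<Longrightarrow> convex hull e \<inter> convex hull e' \<subseteq> e \<inter> e'"
  using assms by (auto simp: crossing_free_def simple_graph_def)

lemma segment_flip:
  fixes u v z :: complex
  assumes "z \<in> closed_segment v u" "v \<in> closed_segment z u"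
  shows "z = v"
proof -
  have "dist v u = dist v z + dist z u" "dist z u = dist z v + dist v u"
    using assms by (simp_all add: between_mem_segment[symmetric] between)
  then show ?thesis by (simp add: dist_commute)
qed

text \<open>An edge through the interior of an empty triangle would have to leave it across a side,
and it cannot cross a side. Hence both its ends are corners, and it is itself a side.\<close>

lemma edge_avoids_empty_triangle:
  assumes cf: "crossing_free S G" and gp: "general_position S" and t: "t \<in> empty_triangles S G"
    and e: "e \<in> G"
  shows "convex hull e \<inter> interior (convex hull t) = {}"
proof (rule ccontr)
  assume "convex hull e \<inter> interior (convex hull t) \<noteq> {}"
  then obtain z where z: "z \<in> convex hull e" "z \<in> interior (convex hull t)" by blast
  have t3: "t \<in> nsets S 3" and tG: "nsets t 2 \<subseteq> G" and emp: "S \<inter> convex hull t \<subseteq> t"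
    using t by (auto simp: empty_triangles_def)
  note fr = triangle_frontier_interior(1)[OF t3 gp]
  have nfr: "z \<notin> frontier (convex hull t)" using z(2) by (simp add: frontier_def)
  have corner: "u \<in> t" if uv: "e = {u, v}" for u v
  proof (rule ccontr)
    assume "u \<notin> t"
    moreover have "u \<in> S" using e crossing_freeD(2)[OF cf] uv by (auto simp: nsets_def)
    ultimately have ut: "u \<notin> convex hull t" using emp by blast
    have "closed_segment z u \<inter> frontier (convex hull t) \<noteq> {}"
      by (rule connected_Int_frontier) (use z(2) ut interior_subset in auto)
    then obtain w s where w: "w \<in> closed_segment z u" "s \<in> nsets t 2" "w \<in> convex hull s"
      unfolding fr by blast
    have zseg: "z \<in> closed_segment v u" using z(1) uv by (simp add: segment_convex_hull insert_commute)
    then have "closed_segment z u \<subseteq> convex hull e"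
      unfolding uv by (simp add: segment_convex_hull[symmetric] subset_closed_segment closed_segment_commute)
    then have "w \<in> convex hull e" using w(1) by blast
    moreover have "e \<noteq> s" using nfr z(1) w(2) fr by auto
    ultimately have "w \<in> e \<inter> s" using crossing_freeD(3)[OF cf e, of s] w(2,3) tG by blast
    moreover have "s \<subseteq> t" using w(2) by (auto simp: nsets_def)
    ultimately have "w = v" "w \<in> t" using ut uv hull_subset[of t convex] by auto
    then have "z = v" using segment_flip[OF zseg] w(1) by simp
    then have "z \<in> frontier (convex hull t)" using fr w(2,3) \<open>w = v\<close> by auto
    then show False using nfr by simp
  qed
  obtain u v where uv: "e = {u, v}" using e crossing_freeD(2)[OF cf] by (auto simp: nsets_def card_2_iff)
  have "e \<subseteq> t" using corner[of u v] corner[of v u] uv by auto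
  then have "e \<in> nsets t 2" using e crossing_freeD(2)[OF cf] by (auto simp: nsets_def)
  then show False using nfr fr z(1) by auto
qed

text \<open>A connected set is a whole component as soon as its frontier lies outside the space.\<close>

lemma componentI:
  assumes "connected C" "C \<noteq> {}" "C \<subseteq> X" "frontier C \<inter> X = {}"
  shows "C \<in> components X"
  unfolding in_components_maximal
proof (intro conjI allI impI)
  fix D assume D: "D \<noteq> {} \<and> C \<subseteq> D \<and> D \<subseteq> X \<and> connected D"
  then have "D \<inter> frontier C = {}" using assms(4) by blast
  then show "D = C" using connected_Int_frontier[of D C] D assms(2) by blast
qed (use assms in auto)

text \<open>The frontier of a face that is bounded by a triangle \<open>t\<close> separates the interior of
\<open>t\<close> from its exterior, and both of these are connected. So the face is one or the other. In the
first case \<open>t\<close> is empty, in the second it surrounds all of \<open>S\<close> and is the hull triangle.\<close>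

lemma geometric_faces_eq:
  assumes cf: "crossing_free S G" and gp: "general_position S"
    and H: "H \<in> nsets S 3" "nsets H 2 \<subseteq> G" "S \<subseteq> convex hull H"
  shows "geometric_faces S G = insert H (empty_triangles S G)"
    and "- (convex hull H) \<in> components (- (S \<union> (\<Union>e\<in>G. convex hull e)))"
    and "frontier (- (convex hull H)) = (\<Union>e\<in>nsets H 2. convex hull e)"
proof -
  let ?N = "S \<union> (\<Union>e\<in>G. convex hull e)"
  have gf: "geometric_faces S G = {t. \<exists>C\<in>components (- ?N). t \<in> nsets S 3 \<and> nsets t 2 \<subseteq> G \<and>
      frontier C = (\<Union>e\<in>nsets t 2. convex hull e)}"
    by (simp add: geometric_faces_def triangular_faces_def drawing_faces_def bounds_face_def)
  have bd: "bounded (convex hull t)" if "t \<in> nsets S 3" for t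
    using three_subset[OF that] by (metis finite.emptyI finite.insertI finite_imp_bounded bounded_convex_hull)
  have ext: "connected (- (convex hull t))" if "t \<in> nsets S 3" for t
    using connected_complement_bounded_convex[OF bd[OF that]] by (simp add: convex_convex_hull)
  show frH: "frontier (- (convex hull H)) = (\<Union>e\<in>nsets H 2. convex hull e)"
    using triangle_frontier_interior(1)[OF H(1) gp] by (simp add: frontier_complement)
  have NH: "?N \<subseteq> convex hull H"
  proof -
    have "convex hull e \<subseteq> convex hull H" if "e \<in> G" for e
      using that crossing_freeD(2)[OF cf] H(3) by (intro hull_minimal) (auto simp: nsets_def)
    then show ?thesis using H(3) by blast
  qed
  show compH: "- (convex hull H) \<in> components (- ?N)"
  proof (rule componentI)
    show "- (convex hull H) \<noteq> {}"
      using bd[OF H(1)] by (metis double_complement compl_bot_eq not_bounded_UNIV)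
    show "frontier (- (convex hull H)) \<inter> - ?N = {}"
      unfolding frH using H(2) by blast
  qed (use ext[OF H(1)] NH in auto)
  show "geometric_faces S G = insert H (empty_triangles S G)"
  proof (intro equalityI subsetI)
    fix t assume "t \<in> insert H (empty_triangles S G)"
    then show "t \<in> geometric_faces S G"
    proof
      assume "t = H" then show ?thesis unfolding gf using compH frH H by blast
    next
      assume t: "t \<in> empty_triangles S G"
      then have t3: "t \<in> nsets S 3" "nsets t 2 \<subseteq> G" "S \<inter> convex hull t \<subseteq> t"
        by (auto simp: empty_triangles_def)
      note fi = triangle_frontier_interior[OF t3(1) gp]
      have "interior (convex hull t) \<in> components (- ?N)"
      proof (rule componentI)
        have "S \<inter> interior (convex hull t) = {}"
        proof -
          have "s \<in> frontier (convex hull t)" if "s \<in> t" for s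
          proof -
            obtain a b c where "t = {a, b, c}" "a \<noteq> b" "b \<noteq> c" "c \<noteq> a" using three_subset[OF t3(1)] by metis
            then obtain e where "e \<in> nsets t 2" "s \<in> e" using \<open>s \<in> t\<close> nsets_3_2[of a b c] by auto
            then show ?thesis unfolding fi(1) using hull_inc[of s e convex] by blast
          qed
          then show ?thesis using t3(3) interior_subset[of "convex hull t"] unfolding frontier_def by blast
        qed
        then show "interior (convex hull t) \<subseteq> - ?N"
          using edge_avoids_empty_triangle[OF cf gp t] by blast
        show "frontier (interior (convex hull t)) \<inter> - ?N = {}" unfolding fi(3) using t3(2) by blast
      qed (use fi(2) convex_connected convex_interior convex_convex_hull in auto)
      then show ?thesis unfolding gf using fi(3) t3 by blast
    qed
  next
    fix t assume "t \<in> geometric_faces S G"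
    then obtain C where C: "C \<in> components (- ?N)" and t: "t \<in> nsets S 3" "nsets t 2 \<subseteq> G"
      and frC: "frontier C = (\<Union>e\<in>nsets t 2. convex hull e)" unfolding gf by blast
    note fi = triangle_frontier_interior[OF t(1) gp]
    have CN: "C \<subseteq> - ?N" "C \<noteq> {}" "connected C"
      using C in_components_subset in_components_nonempty in_components_connected by blast+
    have frN: "frontier (convex hull t) \<subseteq> ?N" unfolding fi(1) using t(2) by blast
    show "t \<in> insert H (empty_triangles S G)"
    proof (cases "C \<inter> interior (convex hull t) = {}")
      case False
      have "connected (interior (convex hull t))" by (simp add: convex_connected convex_interior)
      moreover have "interior (convex hull t) \<inter> frontier C = {}"
        unfolding frC fi(1)[symmetric] by (auto simp: frontier_def)
      ultimately have "interior (convex hull t) \<subseteq> C"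
        using connected_Int_frontier[of "interior (convex hull t)" C] False by blast
      then have noS: "S \<inter> interior (convex hull t) = {}" using CN by blast
      have "S \<inter> convex hull t \<subseteq> t"
      proof
        fix s assume s: "s \<in> S \<inter> convex hull t"
        then have "s \<in> frontier (convex hull t)" using noS closure_subset[of "convex hull t"] unfolding frontier_def by blast
        then obtain e where e: "e \<in> nsets t 2" "s \<in> convex hull e" unfolding fi(1) by blast
        then obtain a b where ab: "e = {a, b}" "a \<noteq> b" "a \<in> t" "b \<in> t" by (auto simp: nsets_def card_2_iff)
        then have "a \<in> S" "b \<in> S" using t(1) by (auto simp: nsets_def)
        then show "s \<in> t" using general_position_segment[OF gp, of s a b] s e ab by auto
      qed
      then show ?thesis using t by (auto simp: empty_triangles_def)
    next
      case True
      have "closed (convex hull t)"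
        using three_subset[OF t(1)] by (metis compact_imp_closed finite.emptyI finite.insertI finite_imp_compact_convex_hull)
      then have "convex hull t = interior (convex hull t) \<union> frontier (convex hull t)"
        using interior_subset by (auto simp: frontier_def)
      moreover have "C \<inter> frontier (convex hull t) = {}" using CN(1) frN by blast
      ultimately have "C \<inter> convex hull t = {}" using True by (metis Int_Un_distrib sup_bot.right_neutral)
      then have "- (convex hull t) \<inter> C \<noteq> {}" using CN(2) by blast
      moreover have "- (convex hull t) \<inter> frontier C = {}"
        unfolding frC fi(1)[symmetric] using \<open>closed (convex hull t)\<close> by (auto simp: frontier_def)
      ultimately have "- (convex hull t) \<subseteq> C"
        using connected_Int_frontier[OF ext[OF t(1)], of C] by blast
      then have St: "S \<subseteq> convex hull t" using CN(1) by blast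
      have "H \<subseteq> t"
      proof
        fix h assume h: "h \<in> H"
        have "finite t" "t \<subseteq> S" "finite H" "H \<subseteq> S" using t(1) H(1) by (auto simp: nsets_def)
        have hullHt: "convex hull H = convex hull t"
        proof (rule equalityI)
          show "convex hull H \<subseteq> convex hull t"
            by (rule hull_minimal) (use St \<open>H \<subseteq> S\<close> in auto)
          show "convex hull t \<subseteq> convex hull H"
            by (rule hull_minimal) (use H(3) \<open>t \<subseteq> S\<close> in auto)
        qed
        obtain a b c where abc: "H = {a, b, c}" "a \<in> S" "b \<in> S" "c \<in> S" "a \<noteq> b" "b \<noteq> c" "c \<noteq> a"
          using three_subset[OF H(1)] by blast
        then have "\<not> collinear {a, b, c}" using gp H(1) by (auto simp: general_position_def)
        then have "\<not> affine_dependent H" using abc collinear_3_eq_affine_dependent by metis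
        then have "h extreme_point_of (convex hull H)"
          using extreme_point_of_convex_hull_affine_independent h by blast
        then have "h extreme_point_of (convex hull t)" unfolding hullHt .
        then show "h \<in> t" by (rule extreme_point_of_convex_hull)
      qed
      moreover have "card H = card t" "finite t" using t(1) H(1) by (auto simp: nsets_def)
      ultimately have "t = H" using card_subset_eq by metis
      then show ?thesis by simp
    qed
  qed
qed

section \<open>Independent redrawings of several regions\<close>

definition framed :: "complex set \<Rightarrow> complex set \<Rightarrow> complex set set \<Rightarrow> bool" where
  "framed H S G \<longleftrightarrow> crossing_free S G \<and> H \<in> nsets S 3 \<and> nsets H 2 \<subseteq> G \<and> S \<subseteq> convex hull H"

text \<open>The drawings on \<open>S\<close> of the combinatorial type of \<open>G\<^sub>0\<close>, with the points themselves as
vertices. Bijections of \<open>S\<close> take the place of labellings, so systems of points can be enlarged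
without renumbering, and only the empty triangles have to be preserved because \<open>H\<close> is fixed
pointwise.\<close>

definition redrawings ::
    "complex set \<Rightarrow> complex set \<Rightarrow> complex set set \<Rightarrow> complex set set set" where
  "redrawings H S G\<^sub>0 = {G. crossing_free S G \<and>
     (\<exists>f. bij_betw f S S \<and> (\<forall>x\<in>H. f x = x) \<and> (`) f ` G\<^sub>0 = G \<and>
        (`) f ` empty_triangles S G\<^sub>0 = empty_triangles S G)}"

lemma finite_redrawings: "finite S \<Longrightarrow> finite (redrawings H S G)"
  by (rule finite_subset[of _ "Pow (nsets S 2)"])
     (auto simp: redrawings_def dest: crossing_freeD(2) intro: finite_imp_finite_nsets)

lemma framed_redrawing:
  assumes "framed H S G" "G' \<in> redrawings H S G"
  shows "framed H S G'"
proof -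
  obtain f where f: "\<forall>x\<in>H. f x = x" "(`) f ` G = G'" and cf: "crossing_free S G'"
    using assms(2) by (auto simp: redrawings_def)
  have "e \<in> G'" if "e \<in> nsets H 2" for e
  proof -
    have "f ` e = e" using that f(1) by (force simp: nsets_def)
    moreover have "e \<in> G" using that assms(1) by (auto simp: framed_def)
    ultimately show ?thesis using f(2) by (metis imageI)
  qed
  then show ?thesis using assms(1) cf by (auto simp: framed_def)
qed

lemma framed_self_redrawing: "framed H S G \<Longrightarrow> G \<in> redrawings H S G"
  by (auto simp: framed_def redrawings_def intro!: exI[of _ id])

text \<open>Triangular regions that meet at most along common sides. The assumption \<open>hole\<close> excludes
an empty triangle whose three sides come from three different regions, which would be a face that
belongs to none of them.\<close>

locale mosaic =
  fixes I :: "'i set" and H S :: "'i \<Rightarrow> complex set" and G :: "'i \<Rightarrow> complex set set"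
  assumes finite_I: "finite I"
    and framed: "i \<in> I \<Longrightarrow> framed (H i) (S i) (G i)"
    and gp: "general_position (\<Union>i\<in>I. S i)"
    and meet: "i \<in> I \<Longrightarrow> j \<in> I \<Longrightarrow> i \<noteq> j \<Longrightarrow>
      \<exists>e. e \<in> nsets (H i) 2 \<and> e \<in> nsets (H j) 2 \<and> convex hull H i \<inter> convex hull H j \<subseteq> convex hull e"
    and hole: "t \<subseteq> (\<Union>i\<in>I. H i) \<Longrightarrow> card t = 3 \<Longrightarrow> \<forall>i\<in>I. \<not> t \<subseteq> H i \<Longrightarrow>
      \<not> (\<Union>i\<in>I. S i) \<inter> convex hull t \<subseteq> t"
begin

abbreviation "points \<equiv> \<Union>i\<in>I. S i"
abbreviation "lines \<equiv> \<Union>i\<in>I. G i"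

lemma region:
  assumes "i \<in> I"
  shows "crossing_free (S i) (G i)" "finite (S i)" "H i \<subseteq> S i" "nsets (H i) 2 \<subseteq> G i" "S i \<subseteq> convex hull H i"
    "e \<in> G i \<Longrightarrow> e \<subseteq> S i" "e \<in> G i \<Longrightarrow> card e = 2"
    "e \<in> G i \<Longrightarrow> convex hull e \<subseteq> convex hull H i"
proof -
  show *: "crossing_free (S i) (G i)" "finite (S i)" "H i \<subseteq> S i" "nsets (H i) 2 \<subseteq> G i" "S i \<subseteq> convex hull H i"
    "e \<in> G i \<Longrightarrow> e \<subseteq> S i" "e \<in> G i \<Longrightarrow> card e = 2"
    using framed[OF assms] crossing_freeD[of "S i" "G i"] by (auto simp: framed_def nsets_def)
  show "convex hull e \<subseteq> convex hull H i" if "e \<in> G i"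
    by (rule hull_minimal) (use that * in auto)
qed

text \<open>General position turns the side along which two regions meet into exactly two common
points.\<close>

lemma common_side:
  assumes "i \<in> I" "j \<in> I" "i \<noteq> j"
  obtains e where "e \<in> nsets (H i) 2" "e \<in> nsets (H j) 2" "e \<in> G i" "e \<in> G j"
    "convex hull H i \<inter> convex hull H j \<subseteq> convex hull e"
    "points \<inter> convex hull H i \<inter> convex hull H j \<subseteq> e"
proof -
  obtain e where e: "e \<in> nsets (H i) 2" "e \<in> nsets (H j) 2"
      "convex hull H i \<inter> convex hull H j \<subseteq> convex hull e"
    using meet[OF assms] by blast
  moreover obtain u v where uv: "e = {u, v}" "u \<noteq> v" using e(1) by (auto simp: nsets_def card_2_iff)
  moreover have "{u, v} \<subseteq> points" using e(1) uv assms(1) region(3)[OF assms(1)] by (auto simp: nsets_def)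
  then have "points \<inter> convex hull H i \<inter> convex hull H j \<subseteq> e"
    using general_position_segment[OF gp _ _ _ uv(2)] e(3) uv(1) by blast
  ultimately show thesis using that region(4) assms by blast
qed

lemma common_points:
  assumes "i \<in> I" "j \<in> I" "i \<noteq> j" "s \<in> S i" "s \<in> S j"
  shows "s \<in> H i" "s \<in> H j"
proof -
  obtain e where e: "e \<in> nsets (H i) 2" "e \<in> nsets (H j) 2"
      "points \<inter> convex hull H i \<inter> convex hull H j \<subseteq> e"
    using common_side[OF assms(1-3)] by metis
  have "s \<in> convex hull H i" "s \<in> convex hull H j" using assms region(5) by blast+
  then have "s \<in> e" using e(3) assms by blast
  then show "s \<in> H i" "s \<in> H j" using e(1,2) by (auto simp: nsets_def)
qed

lemma points_in_region:
  assumes "i \<in> I" "s \<in> points" "s \<in> convex hull H i"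
  shows "s \<in> S i"
proof -
  obtain j where j: "j \<in> I" "s \<in> S j" using assms(2) by blast
  show ?thesis
  proof (cases "i = j")
    case False
    then obtain e where e: "e \<in> nsets (H i) 2"
        "points \<inter> convex hull H i \<inter> convex hull H j \<subseteq> e"
      using common_side[OF assms(1) j(1)] by metis
    have "s \<in> convex hull H j" using j region(5) by blast
    then have "s \<in> e" using e(2) assms by blast
    then show ?thesis using e(1) region(3)[OF assms(1)] by (auto simp: nsets_def)
  qed (use j in simp)
qed

text \<open>A graph on the union determines its parts, hence different choices of redrawings in the
regions lead to different graphs.\<close>

lemma edges_in_region:
  assumes "i \<in> I" "e \<in> lines" "e \<subseteq> S i"
  shows "e \<in> G i"
proof -
  obtain j where j: "j \<in> I" "e \<in> G j" using assms(2) by blast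
  show ?thesis
  proof (cases "i = j")
    case False
    have "s \<in> H i" if "s \<in> e" for s
      by (rule common_points(1)[OF assms(1) j(1) False]) (use that assms(3) region(6)[OF j] in auto)
    then have "e \<in> nsets (H i) 2" using region(7)[OF j] card_ge_0_finite[of e] by (auto simp: nsets_def)
    then show ?thesis using region(4)[OF assms(1)] by blast
  qed (use j in simp)
qed

lemma crossing_free_Union: "crossing_free points lines"
  unfolding crossing_free_def simple_graph_def
proof (intro conjI ballI impI)
  show "finite points" using finite_I region(2) by blast
  show "lines \<subseteq> nsets points 2"
    using crossing_freeD(2)[OF region(1)] by (fastforce simp: nsets_def)
  fix e e' assume "e \<in> lines" "e' \<in> lines" and ne: "e \<noteq> e'"
  then obtain i j where i: "i \<in> I" "e \<in> G i" and j: "j \<in> I" "e' \<in> G j" by blast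
  note cfi = crossing_freeD(3)[OF region(1)[OF i(1)]] and cfj = crossing_freeD(3)[OF region(1)[OF j(1)]]
  show "convex hull e \<inter> convex hull e' \<subseteq> e \<inter> e'"
  proof (cases "i = j")
    case True then show ?thesis using cfi i j ne by auto
  next
    case False
    then obtain d where d: "d \<in> G i" "d \<in> G j" "convex hull H i \<inter> convex hull H j \<subseteq> convex hull d"
      using common_side[OF i(1) j(1)] by metis
    have sub: "convex hull e \<inter> convex hull e' \<subseteq> convex hull d"
      using region(8)[OF i] region(8)[OF j] d(3) by blast
    consider "e = d" | "e' = d" | "e \<noteq> d" "e' \<noteq> d" by blast
    then show ?thesis
    proof cases
      case 1 then show ?thesis using cfj[OF d(2) j(2)] ne by simp
    next
      case 2 then show ?thesis using cfi[OF i(2) d(1)] ne by simp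
    next
      case 3
      have "convex hull e \<inter> convex hull d \<subseteq> e" using cfi[OF i(2) d(1) 3(1)] by blast
      moreover have "convex hull e' \<inter> convex hull d \<subseteq> e'" using cfj[OF j(2) d(2) 3(2)] by blast
      ultimately show ?thesis using sub by blast
    qed
  qed
qed

text \<open>If the vertices of an empty triangle are not all in one region, then its three sides
belong to three different regions and its vertices are corners of regions, which \<open>hole\<close> rules out.\<close>

lemma empty_triangles_Union:
  "empty_triangles points lines = (\<Union>i\<in>I. empty_triangles (S i) (G i))"
proof (intro equalityI subsetI)
  fix t assume "t \<in> (\<Union>i\<in>I. empty_triangles (S i) (G i))"
  then obtain i where i: "i \<in> I" and t: "t \<in> nsets (S i) 3" "nsets t 2 \<subseteq> G i" "S i \<inter> convex hull t \<subseteq> t"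
    by (auto simp: empty_triangles_def)
  have "convex hull t \<subseteq> convex hull H i"
    by (rule hull_minimal) (use t(1) region(5)[OF i] in \<open>auto simp: nsets_def\<close>)
  then have "points \<inter> convex hull t \<subseteq> t" using points_in_region[OF i] t(3) by blast
  then show "t \<in> empty_triangles points lines"
    using t i by (auto simp: empty_triangles_def nsets_def)
next
  fix t assume "t \<in> empty_triangles points lines"
  then have t: "t \<in> nsets points 3" "nsets t 2 \<subseteq> lines" "points \<inter> convex hull t \<subseteq> t"
    by (auto simp: empty_triangles_def)
  have "\<exists>i\<in>I. t \<subseteq> S i"
  proof (rule ccontr)
    assume none: "\<not> (\<exists>i\<in>I. t \<subseteq> S i)"
    have vertex: "v \<in> (\<Union>i\<in>I. H i)" if uvw: "t = {u, v, w}" "u \<noteq> v" "v \<noteq> w" for u v w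
    proof -
      have "{u, v} \<in> nsets t 2" "{v, w} \<in> nsets t 2" using uvw by (auto simp: nsets_def)
      then obtain i j where ij: "i \<in> I" "{u, v} \<in> G i" "j \<in> I" "{v, w} \<in> G j" using t(2) by blast
      have "u \<in> S i" "v \<in> S i" "v \<in> S j" "w \<in> S j" using region(6)[OF ij(1,2)] region(6)[OF ij(3,4)] by auto
      moreover have "i \<noteq> j" using calculation none ij(1) uvw(1) by auto
      ultimately show ?thesis using common_points(1)[OF ij(1,3)] ij(1) by blast
    qed
    obtain a b c where abc: "t = {a, b, c}" "a \<noteq> b" "b \<noteq> c" "c \<noteq> a" using three_subset[OF t(1)] by metis
    have "a \<in> (\<Union>i\<in>I. H i)" by (rule vertex[of c a b]) (use abc in auto)
    moreover have "b \<in> (\<Union>i\<in>I. H i)" by (rule vertex[of a b c]) (use abc in auto)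
    moreover have "c \<in> (\<Union>i\<in>I. H i)" by (rule vertex[of b c a]) (use abc in auto)
    ultimately have "t \<subseteq> (\<Union>i\<in>I. H i)" using abc(1) by blast
    moreover have "\<forall>i\<in>I. \<not> t \<subseteq> H i" using none region(3) by blast
    moreover have "card t = 3" using t(1) by (simp add: nsets_def)
    ultimately show False using hole t(3) by blast
  qed
  then obtain i where i: "i \<in> I" "t \<subseteq> S i" by blast
  have "e \<in> G i" if "e \<in> nsets t 2" for e
    by (rule edges_in_region[OF i(1)]) (use that t(2) i(2) in \<open>auto simp: nsets_def\<close>)
  then have "t \<in> empty_triangles (S i) (G i)"
    using t(1,3) i by (auto simp: empty_triangles_def nsets_def)
  then show "t \<in> (\<Union>i\<in>I. empty_triangles (S i) (G i))" using i(1) by blast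
qed

lemma mosaic_redrawings:
  assumes "\<And>i. i \<in> I \<Longrightarrow> G' i \<in> redrawings (H i) (S i) (G i)"
  shows "mosaic I H S G'"
proof
  show "framed (H i) (S i) (G' i)" if "i \<in> I" for i
    using framed_redrawing[OF framed assms] that by blast
qed (fact finite_I gp | erule (2) meet | erule (2) hole)+

text \<open>The bijections of the regions agree where they overlap because common points are
corners, and corners are fixed.\<close>

lemma redrawing_Union:
  assumes G': "\<And>i. i \<in> I \<Longrightarrow> G' i \<in> redrawings (H i) (S i) (G i)" and K: "K \<subseteq> (\<Union>i\<in>I. H i)"
  shows "(\<Union>i\<in>I. G' i) \<in> redrawings K points lines"
proof -
  interpret M': mosaic I H S G' by (rule mosaic_redrawings[OF G'])
  have "\<exists>f. bij_betw f (S i) (S i) \<and> (\<forall>x\<in>H i. f x = x) \<and> (`) f ` G i = G' i \<and>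
        (`) f ` empty_triangles (S i) (G i) = empty_triangles (S i) (G' i)" if "i \<in> I" for i
    using G'[OF that] by (simp add: redrawings_def)
  then obtain f where f: "\<And>i. i \<in> I \<Longrightarrow> bij_betw (f i) (S i) (S i)" "\<And>i x. i \<in> I \<Longrightarrow> x \<in> H i \<Longrightarrow> f i x = x"
      "\<And>i. i \<in> I \<Longrightarrow> (`) (f i) ` G i = G' i"
      "\<And>i. i \<in> I \<Longrightarrow> (`) (f i) ` empty_triangles (S i) (G i) = empty_triangles (S i) (G' i)"
    by metis
  define F where "F x = f (SOME i. i \<in> I \<and> x \<in> S i) x" for x
  have F: "F x = f i x" if "i \<in> I" "x \<in> S i" for i x
  proof -
    define j where "j = (SOME i. i \<in> I \<and> x \<in> S i)"
    have j: "j \<in> I" "x \<in> S j" unfolding j_def using that by (metis (mono_tags, lifting) someI_ex)+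
    show ?thesis
    proof (cases "i = j")
      case False
      then have "f i x = x" "f j x = x" using common_points[OF that(1) j(1) False that(2) j(2)] f(2) that j by auto
      then show ?thesis by (simp add: F_def j_def)
    qed (simp add: F_def j_def)
  qed
  have FH: "F x = x" if "i \<in> I" "x \<in> H i" for i x
    using F[OF that(1)] f(2)[OF that] region(3)[OF that(1)] that(2) by auto
  have FS: "F ` S i = S i" if "i \<in> I" for i
    using F[OF that] f(1)[OF that] by (simp add: bij_betw_def)
  have injS: "inj_on F (S i)" if "i \<in> I" for i
    using f(1)[OF that] F[OF that] by (auto simp: bij_betw_def inj_on_def)
  have "inj_on F points"
  proof (rule inj_onI)
    fix x y assume "x \<in> points" "y \<in> points" and eq: "F x = F y"
    then obtain i j where i: "i \<in> I" "x \<in> S i" and j: "j \<in> I" "y \<in> S j" by blast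
    show "x = y"
    proof (cases "i = j")
      case True then show ?thesis using injS[OF i(1)] i j eq by (auto simp: inj_on_def)
    next
      case False
      have z: "F x \<in> S i" "F x \<in> S j" using FS[OF i(1)] FS[OF j(1)] i j eq by blast+
      then have "F (F x) = F x" using FH[OF i(1)] common_points(1)[OF i(1) j(1) False] by blast
      then have "F x = x" "F x = y"
        using injS[OF i(1)] injS[OF j(1)] i j z eq by (auto simp: inj_on_def)
      then show ?thesis by simp
    qed
  qed
  moreover have "F ` points = points" using FS by (simp add: image_UN)
  ultimately have bij: "bij_betw F points points" by (simp add: bij_betw_def)
  have img: "F ` e = f i ` e" if "i \<in> I" "e \<subseteq> S i" for i e using F[OF that(1)] that(2) by (intro image_cong) auto
  have "(`) F ` G i = G' i" if "i \<in> I" for i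
  proof -
    have "(`) F ` G i = (`) (f i) ` G i" by (rule image_cong) (use img that region(6) in auto)
    then show ?thesis using f(3)[OF that] by simp
  qed
  then have GG: "(`) F ` lines = (\<Union>i\<in>I. G' i)" by (simp add: image_UN)
  have "(`) F ` empty_triangles (S i) (G i) = empty_triangles (S i) (G' i)" if "i \<in> I" for i
  proof -
    have "(`) F ` empty_triangles (S i) (G i) = (`) (f i) ` empty_triangles (S i) (G i)"
      by (rule image_cong) (use img that in \<open>auto simp: empty_triangles_def nsets_def\<close>)
    then show ?thesis using f(4)[OF that] by simp
  qed
  then have ET: "(`) F ` empty_triangles points lines = empty_triangles points (\<Union>i\<in>I. G' i)"
    unfolding empty_triangles_Union M'.empty_triangles_Union by (simp add: image_UN)
  show ?thesis
    unfolding redrawings_def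
  proof (intro CollectI conjI exI[of _ F])
    show "\<forall>x\<in>K. F x = x" using FH K by blast
  qed (fact M'.crossing_free_Union bij GG ET)+
qed

lemma card_redrawings_Union:
  assumes "K \<subseteq> (\<Union>i\<in>I. H i)"
  shows "(\<Prod>i\<in>I. card (redrawings (H i) (S i) (G i))) \<le> card (redrawings K points lines)"
proof -
  let ?P = "PiE I (\<lambda>i. redrawings (H i) (S i) (G i))"
  have "inj_on (\<lambda>G'. \<Union>i\<in>I. G' i) ?P"
  proof (rule inj_onI)
    fix G1 G2 assume G: "G1 \<in> ?P" "G2 \<in> ?P" and eq: "(\<Union>i\<in>I. G1 i) = (\<Union>i\<in>I. G2 i)"
    interpret M1: mosaic I H S G1 by (rule mosaic_redrawings) (rule PiE_mem[OF G(1)])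
    interpret M2: mosaic I H S G2 by (rule mosaic_redrawings) (rule PiE_mem[OF G(2)])
    have "G1 i = G2 i" if i: "i \<in> I" for i
    proof (intro equalityI subsetI)
      show "e \<in> G2 i" if "e \<in> G1 i" for e
        by (rule M2.edges_in_region[OF i]) (use eq i that M1.region(6)[OF i] in auto)
      show "e \<in> G1 i" if "e \<in> G2 i" for e
        by (rule M1.edges_in_region[OF i]) (use eq i that M2.region(6)[OF i] in auto)
    qed
    then show "G1 = G2" using G by (intro PiE_ext) auto
  qed
  moreover have "(\<lambda>G'. \<Union>i\<in>I. G' i) ` ?P \<subseteq> redrawings K points lines"
    by (intro image_subsetI redrawing_Union[OF _ assms]) (rule PiE_mem)
  moreover have "finite (redrawings K points lines)"
    by (intro finite_redrawings) (use finite_I region(2) in blast)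
  ultimately have "card ?P \<le> card (redrawings K points lines)"
    by (rule card_inj_on_le)
  then show ?thesis using finite_I by (simp add: card_PiE)
qed

end

section \<open>A triangulation with six drawings on nine points\<close>

text \<open>The first three points are the corners. Only the orientations of triples of these points
matter; the coordinates are a convenient way to record them.\<close>

definition gadget_points :: "(int \<times> int) list" where
  "gadget_points = [(0, 0), (13, 0), (0, 13), (1, 1), (11, 1), (1, 11), (2, 6), (5, 2), (7, 4)]"

definition gadget_edges :: "(nat \<times> nat) list" where
  "gadget_edges = [(0, 1), (0, 2), (0, 3), (0, 5), (0, 6), (1, 2), (1, 3), (1, 4), (1, 7), (2, 4), (2, 5),
     (3, 6), (3, 7), (3, 8), (4, 5), (4, 7), (4, 8), (5, 6), (5, 8), (6, 8), (7, 8)]"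

text \<open>Inner faces, each in counterclockwise order.\<close>

definition gadget_faces :: "(nat \<times> nat \<times> nat) list" where
  "gadget_faces = [(0, 1, 3), (0, 3, 6), (0, 5, 2), (0, 6, 5), (1, 2, 4), (1, 4, 7), (1, 7, 3), (2, 5, 4),
     (5, 6, 8), (5, 8, 4), (8, 3, 7), (8, 6, 3), (8, 7, 4)]"

text \<open>Each list maps the labels \<open>0, ..., 8\<close> of the combinatorial triangulation to indices of
points.\<close>

definition gadget_drawings :: "nat list list" where
  "gadget_drawings = [[0, 1, 2, 3, 4, 5, 6, 7, 8], [0, 1, 2, 4, 5, 3, 7, 8, 6], [0, 1, 2, 7, 5, 6, 3, 4, 8],
     [0, 1, 2, 3, 8, 5, 6, 4, 7], [0, 1, 2, 7, 8, 5, 3, 4, 6], [0, 1, 2, 4, 5, 6, 3, 8, 7]]"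

definition grid_orient :: "nat \<Rightarrow> nat \<Rightarrow> nat \<Rightarrow> int" where
  "grid_orient i j k = (case (gadget_points ! i, gadget_points ! j, gadget_points ! k) of
     ((a, a'), (b, b'), (c, c')) \<Rightarrow> (b - a) * (c' - a') - (b' - a') * (c - a))"

definition gadget_adj :: "nat \<Rightarrow> nat \<Rightarrow> bool" where
  "gadget_adj i j \<longleftrightarrow> (i, j) \<in> set gadget_edges \<or> (j, i) \<in> set gadget_edges"

text \<open>The label \<open>9\<close> represents everything outside the gadget, contracted to one vertex that is
adjacent to the corners.\<close>

definition hub_adj :: "nat \<Rightarrow> nat \<Rightarrow> bool" where
  "hub_adj i j \<longleftrightarrow> gadget_adj i j \<or> i < 3 \<and> j = 9 \<or> i = 9 \<and> j < 3"

text \<open>One obstruction for every missing edge within the gadget. In each row the cycle is formed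
by the neighbours of the first entry, in the order in which they surround it.\<close>

definition gadget_rows :: "(nat \<times> nat list \<times> nat list \<times> nat list \<times> nat list) list" where
  "gadget_rows = [
     (0, [4], [1, 3, 6, 5], [5, 2], [2, 1]),
     (0, [4, 7], [1, 3], [3, 6, 5], [5, 2, 1]),
     (0, [8], [3, 6], [6, 5], [5, 2, 1, 3]),
     (1, [5], [0, 2], [2, 4], [4, 7, 3, 0]),
     (1, [5, 6], [0, 2], [2, 4], [4, 7, 3, 0]),
     (1, [8], [4, 7], [7, 3], [3, 0, 2, 4]),
     (2, [6, 3], [0, 5], [5, 4, 1], [1, 0]),
     (2, [3, 6], [0, 5], [5, 4, 1], [1, 0]),
     (2, [3, 7], [0, 5, 4], [4, 1], [1, 0]),
     (2, [3, 8], [0, 5], [5, 4], [4, 1, 0]),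
     (3, [4], [1, 7], [7, 8], [8, 6, 0, 1]),
     (3, [5], [0, 1, 7, 8], [8, 6], [6, 0]),
     (4, [0, 6], [1, 2], [2, 5], [5, 8, 7, 1]),
     (5, [1, 7], [0, 6, 8], [8, 4], [4, 2, 0]),
     (6, [1, 7], [0, 3], [3, 8], [8, 5, 0])]"

text \<open>One obstruction for every missing edge from an inner vertex of the gadget to the outside.\<close>

definition hub_rows :: "(nat \<times> nat list \<times> nat list \<times> nat list \<times> nat list) list" where
  "hub_rows = [
     (3, [4, 2, 9], [0, 1], [1, 7], [7, 8, 6, 0]),
     (4, [0, 9], [1, 2], [2, 5], [5, 8, 7, 1]),
     (5, [1, 9], [0, 6, 8, 4], [4, 2], [2, 0]),
     (6, [2, 1, 9], [0, 3], [3, 8, 5], [5, 0]),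
     (7, [2, 0, 9], [1, 4], [4, 8, 3], [3, 1]),
     (8, [0, 9], [3, 7, 4, 5], [5, 6], [6, 3])]"

abbreviation labels :: "nat list" where
  "labels \<equiv> [0, 1, 2, 3, 4, 5, 6, 7, 8]"

lemma less_9_iff: "i < 9 \<longleftrightarrow> i \<in> set labels"
  by auto

lemma grid_general_position_check:
  "\<forall>i\<in>set labels. \<forall>j\<in>set labels. \<forall>k\<in>set labels.
     i = j \<or> j = k \<or> k = i \<or> grid_orient i j k \<noteq> 0"
  by code_simp

lemma grid_hull_check:
  "\<forall>k\<in>set labels. 0 \<le> grid_orient 0 1 k \<and> 0 \<le> grid_orient 1 2 k \<and> 0 \<le> grid_orient 2 0 k"
  "0 < grid_orient 0 1 2"
  by code_simp+

lemma gadget_drawings_check: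
  "\<forall>s\<in>set gadget_drawings. length s = 9 \<and> distinct s \<and> (\<forall>i\<in>set s. i < 9) \<and>
     s ! 0 = 0 \<and> s ! 1 = 1 \<and> s ! 2 = 2"
  by code_simp

text \<open>Two edges without common end do not cross if the ends of one of them are on the same side
of the other.\<close>

lemma noncrossing_check:
  "\<forall>s\<in>set gadget_drawings. \<forall>(a, b)\<in>set gadget_edges. \<forall>(c, d)\<in>set gadget_edges.
     a = c \<or> a = d \<or> b = c \<or> b = d \<or>
     0 < grid_orient (s ! a) (s ! b) (s ! c) * grid_orient (s ! a) (s ! b) (s ! d) \<or>
     0 < grid_orient (s ! c) (s ! d) (s ! a) * grid_orient (s ! c) (s ! d) (s ! b)"
  by code_simp

lemma empty_faces_check:
  "\<forall>s\<in>set gadget_drawings. \<forall>(a, b, c)\<in>set gadget_faces.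
     0 < grid_orient (s ! a) (s ! b) (s ! c) \<and>
     (\<forall>d\<in>set labels. d = a \<or> d = b \<or> d = c \<or>
        grid_orient (s ! a) (s ! b) (s ! d) < 0 \<or> grid_orient (s ! b) (s ! c) (s ! d) < 0 \<or>
        grid_orient (s ! c) (s ! a) (s ! d) < 0)"
  by code_simp

text \<open>The outer triangle is the only triangle of the graph that is not a face. So the faces
are determined by the edges once they are known to be empty in each drawing.\<close>

lemma gadget_triangles_check:
  "\<forall>a\<in>set labels. \<forall>b\<in>set labels. \<forall>c\<in>set labels.
     gadget_adj a b \<longrightarrow> gadget_adj b c \<longrightarrow> gadget_adj c a \<longrightarrow>
     {a, b, c} = {0, 1, 2} \<or> (\<exists>(a', b', c')\<in>set gadget_faces. {a, b, c} = {a', b', c'})"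
  by code_simp

lemma gadget_faces_check:
  "\<forall>(a, b, c)\<in>set gadget_faces. a < 9 \<and> b < 9 \<and> c < 9 \<and> a \<noteq> b \<and> b \<noteq> c \<and> c \<noteq> a \<and>
     gadget_adj a b \<and> gadget_adj b c \<and> gadget_adj c a"
  by code_simp

lemma gadget_edges_check:
  "\<forall>(a, b)\<in>set gadget_edges. a < 9 \<and> b < 9 \<and> a \<noteq> b"
  "gadget_adj 0 1" "gadget_adj 1 2" "gadget_adj 2 0"
  by code_simp+

lemma different_drawings_check:
  "\<forall>s\<in>set gadget_drawings. \<forall>s'\<in>set gadget_drawings. s = s' \<or>
     (\<exists>(a, b)\<in>set gadget_edges. \<forall>(c, d)\<in>set gadget_edges. {s ! a, s ! b} \<noteq> {s' ! c, s' ! d})"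
  "distinct gadget_drawings" "length gadget_drawings = 6" "labels \<in> set gadget_drawings"
  by code_simp+

lemma gadget_rows_check:
  "\<forall>i\<in>set labels. \<forall>j\<in>set labels. i = j \<or> gadget_adj i j \<or>
     (\<exists>(x, ys, q1, q2, q3)\<in>set gadget_rows. witness_row gadget_adj (x, ys, q1, q2, q3) \<and>
        (\<forall>y\<in>set ys. y < 9) \<and> (x = i \<and> j \<in> set ys \<or> x = j \<and> i \<in> set ys))"
  by code_simp

lemma hub_rows_check:
  "\<forall>i\<in>set [3, 4, 5, 6, 7, 8]. \<exists>(x, ys, q1, q2, q3)\<in>set hub_rows.
     witness_row hub_adj (x, ys, q1, q2, q3) \<and> (\<forall>y\<in>set ys. y \<le> 9) \<and> x = i \<and> 9 \<in> set ys"
  by code_simp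

text \<open>The first line orders the inner vertices so that they form a linked set; the others give
each corner an inner neighbour.\<close>

lemma gadget_interior_check:
  "linked_order gadget_adj [7, 4, 5, 6, 8, 3]" "gadget_adj 3 0" "gadget_adj 3 1" "gadget_adj 4 2"
  by code_simp+

definition gadget_graph :: "(nat \<Rightarrow> complex) \<Rightarrow> nat list \<Rightarrow> complex set set" where
  "gadget_graph z s = (\<lambda>(a, b). {z (s ! a), z (s ! b)}) ` set gadget_edges"

definition realizes_grid :: "(nat \<Rightarrow> complex) \<Rightarrow> bool" where
  "realizes_grid z \<longleftrightarrow> (\<forall>i<9. \<forall>j<9. \<forall>k<9. sgn (orient (z i) (z j) (z k)) = of_int (sgn (grid_orient i j k)))"

locale gadget =
  fixes z :: "nat \<Rightarrow> complex"
  assumes realizes: "realizes_grid z"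
begin

lemma orient_sign:
  assumes "i < 9" "j < 9" "k < 9"
  shows "0 < orient (z i) (z j) (z k) \<longleftrightarrow> 0 < grid_orient i j k"
    and "orient (z i) (z j) (z k) < 0 \<longleftrightarrow> grid_orient i j k < 0"
    and "orient (z i) (z j) (z k) = 0 \<longleftrightarrow> grid_orient i j k = 0"
proof -
  have "sgn (orient (z i) (z j) (z k)) = of_int (sgn (grid_orient i j k))"
    using realizes assms by (simp add: realizes_grid_def)
  then show "0 < orient (z i) (z j) (z k) \<longleftrightarrow> 0 < grid_orient i j k"
    and "orient (z i) (z j) (z k) < 0 \<longleftrightarrow> grid_orient i j k < 0"
    and "orient (z i) (z j) (z k) = 0 \<longleftrightarrow> grid_orient i j k = 0"
    by (auto simp: sgn_if split: if_splits)
qed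

lemma orient_nonzero:
  assumes "i < 9" "j < 9" "k < 9" "i \<noteq> j" "j \<noteq> k" "k \<noteq> i"
  shows "orient (z i) (z j) (z k) \<noteq> 0"
  using orient_sign(3)[OF assms(1-3)] grid_general_position_check assms unfolding less_9_iff by metis

lemma inj_z: "inj_on z {..<9}"
proof (rule inj_onI, rule ccontr)
  fix i j assume ij: "i \<in> {..<9}" "j \<in> {..<9}" "z i = z j" "i \<noteq> j"
  have "\<exists>k\<in>{0, 1, 2}. k \<noteq> i \<and> k \<noteq> j" by (cases "i = 0"; cases "j = 0"; cases "i = 1"; cases "j = 1") auto
  then obtain k :: nat where k: "k \<in> {0, 1, 2}" "k \<noteq> i" "k \<noteq> j" by blast
  then have "k < 9" by auto
  then have "orient (z i) (z j) (z k) \<noteq> 0" using ij k by (intro orient_nonzero) auto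
  then show False using ij(3) by simp
qed

lemma z_eq_iff: "i < 9 \<Longrightarrow> j < 9 \<Longrightarrow> z i = z j \<longleftrightarrow> i = j"
  using inj_z by (auto simp: inj_on_def)

lemma orient_prod:
  assumes "i < 9" "j < 9" "k < 9" "l < 9" "0 < grid_orient i j k * grid_orient i j l"
  shows "0 < orient (z i) (z j) (z k) * orient (z i) (z j) (z l)"
  using assms(5) orient_sign(1,2)[OF assms(1-3)] orient_sign(1,2)[OF assms(1,2,4)]
  by (auto simp: zero_less_mult_iff)

lemma drawing:
  assumes "s \<in> set gadget_drawings"
  shows "s ! 0 = 0" "s ! 1 = 1" "s ! 2 = 2" "a < 9 \<Longrightarrow> s ! a < 9"
    "a < 9 \<Longrightarrow> b < 9 \<Longrightarrow> s ! a = s ! b \<longleftrightarrow> a = b" "(!) s ` {..<9} = {..<9}"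
proof -
  have s: "length s = 9" "distinct s" "\<forall>i\<in>set s. i < 9" "s ! 0 = 0" "s ! 1 = 1" "s ! 2 = 2"
    using gadget_drawings_check assms by auto
  then show "s ! 0 = 0" "s ! 1 = 1" "s ! 2 = 2" "a < 9 \<Longrightarrow> s ! a < 9"
    "a < 9 \<Longrightarrow> b < 9 \<Longrightarrow> s ! a = s ! b \<longleftrightarrow> a = b"
    by (auto simp: nth_eq_iff_index_eq)
  have "(!) s ` {..<9} = set s" using s(1) by (auto simp: set_conv_nth image_iff)
  moreover have "card (set s) = 9" using s by (simp add: distinct_card)
  ultimately show "(!) s ` {..<9} = {..<9}"
    using s(3) card_subset_eq[of "{..<9::nat}" "set s"] by auto
qed

lemma gadget_edge_cases:
  assumes "e \<in> gadget_graph z s"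
  obtains a b where "(a, b) \<in> set gadget_edges" "e = {z (s ! a), z (s ! b)}" "a < 9" "b < 9" "a \<noteq> b"
proof -
  from assms obtain a b where ab: "(a, b) \<in> set gadget_edges" "e = {z (s ! a), z (s ! b)}"
    by (auto simp: gadget_graph_def)
  moreover have "a < 9 \<and> b < 9 \<and> a \<noteq> b" using gadget_edges_check(1) ab(1) by blast
  ultimately show thesis using that by blast
qed

lemma gadget_graph_iff:
  assumes s: "s \<in> set gadget_drawings" and "a < 9" "b < 9"
  shows "{z (s ! a), z (s ! b)} \<in> gadget_graph z s \<longleftrightarrow> gadget_adj a b"
proof
  assume "{z (s ! a), z (s ! b)} \<in> gadget_graph z s"
  then obtain c d where cd: "(c, d) \<in> set gadget_edges" "{z (s ! a), z (s ! b)} = {z (s ! c), z (s ! d)}" "c < 9" "d < 9"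
    by (rule gadget_edge_cases)
  have "{z (s ! a), z (s ! b)} = {z (s ! c), z (s ! d)} \<longleftrightarrow> a = c \<and> b = d \<or> a = d \<and> b = c"
    using assms(2,3) cd(3,4) drawing(4,5)[OF s] z_eq_iff by (simp add: doubleton_eq_iff)
  then show "gadget_adj a b" using cd by (auto simp: gadget_adj_def)
next
  assume "gadget_adj a b"
  then show "{z (s ! a), z (s ! b)} \<in> gadget_graph z s"
    by (auto simp: gadget_adj_def gadget_graph_def insert_commute image_iff)
qed

lemma common_end:
  assumes "p < 9" "q < 9" "r < 9" "p \<noteq> q" "q \<noteq> r" "r \<noteq> p"
  shows "convex hull {z p, z q} \<inter> convex hull {z p, z r} = {z p}"
  using orient_nonzero[OF assms] by (rule segments_common_end)

lemma gadget_crossing_free: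
  assumes s: "s \<in> set gadget_drawings"
  shows "crossing_free (z ` {..<9}) (gadget_graph z s)"
  unfolding crossing_free_def simple_graph_def
proof (intro conjI ballI impI)
  have "z (s ! a) \<noteq> z (s ! b)" if "a < 9" "b < 9" "a \<noteq> b" for a b
    using that drawing(4,5)[OF s] z_eq_iff by auto
  then show "gadget_graph z s \<subseteq> nsets (z ` {..<9}) 2"
    using drawing(4)[OF s] by (auto elim!: gadget_edge_cases simp: nsets_def)
  fix e e' assume e: "e \<in> gadget_graph z s" and e': "e' \<in> gadget_graph z s" and ne: "e \<noteq> e'"
  obtain a b where ab: "(a, b) \<in> set gadget_edges" "e = {z (s ! a), z (s ! b)}" "a < 9" "b < 9" "a \<noteq> b"
    using e by (rule gadget_edge_cases)
  obtain c d where cd: "(c, d) \<in> set gadget_edges" "e' = {z (s ! c), z (s ! d)}" "c < 9" "d < 9" "c \<noteq> d"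
    using e' by (rule gadget_edge_cases)
  define p q r t where pqrt: "p = s ! a" "q = s ! b" "r = s ! c" "t = s ! d"
  have lt: "p < 9" "q < 9" "r < 9" "t < 9" "p \<noteq> q" "r \<noteq> t"
    using ab cd drawing(4,5)[OF s] by (auto simp: pqrt)
  have ee: "e = {z p, z q}" "e' = {z r, z t}" using ab cd by (auto simp: pqrt)
  have "(a = c \<or> a = d \<or> b = c \<or> b = d) \<or> 0 < grid_orient p q r * grid_orient p q t \<or>
     0 < grid_orient r t p * grid_orient r t q"
    using noncrossing_check s ab(1) cd(1) unfolding pqrt by fastforce
  then consider "p = r" | "p = t" | "q = r" | "q = t" | "0 < grid_orient p q r * grid_orient p q t"
     | "0 < grid_orient r t p * grid_orient r t q"
    using pqrt by blast
  then show "convex hull e \<inter> convex hull e' \<subseteq> e \<inter> e'"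
  proof cases
    case 1
    then have "q \<noteq> t" using ne ee by auto
    then show ?thesis using common_end[of p q t] lt 1 unfolding ee by auto
  next
    case 2
    then have "q \<noteq> r" using ne ee by auto
    then show ?thesis using common_end[of p q r] lt 2 unfolding ee by (auto simp: insert_commute)
  next
    case 3
    then have "p \<noteq> t" using ne ee by auto
    then show ?thesis using common_end[of q p t] lt 3 unfolding ee by (auto simp: insert_commute)
  next
    case 4
    then have "p \<noteq> r" using ne ee by auto
    then show ?thesis using common_end[of q p r] lt 4 unfolding ee by (auto simp: insert_commute)
  next
    case 5
    have "convex hull e \<inter> convex hull e' = {}"
      unfolding ee using orient_prod[OF lt(1-4) 5] by (rule segments_disjoint)
    then show ?thesis by blast
  next
    case 6
    have "convex hull e' \<inter> convex hull e = {}"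
      unfolding ee using orient_prod[OF lt(3,4,1,2) 6] by (rule segments_disjoint)
    then show ?thesis by blast
  qed
qed simp

lemma less_3_set: "{..<3} = {0, 1, 2::nat}" by auto

lemma gadget_framed:
  assumes s: "s \<in> set gadget_drawings"
  shows "framed (z ` {..<3}) (z ` {..<9}) (gadget_graph z s)"
  unfolding framed_def
proof (intro conjI gadget_crossing_free[OF s])
  have ne: "z 0 \<noteq> z 1" "z 1 \<noteq> z 2" "z 2 \<noteq> z 0" using z_eq_iff by auto
  then show "z ` {..<3} \<in> nsets (z ` {..<9}) 3" by (auto simp: nsets_def less_3_set)
  show "nsets (z ` {..<3}) 2 \<subseteq> gadget_graph z s"
    using ne gadget_graph_iff[OF s, of 0 1] gadget_graph_iff[OF s, of 1 2] gadget_graph_iff[OF s, of 2 0]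
      gadget_edges_check drawing(1-3)[OF s] by (simp add: less_3_set nsets_3_2)
  have "0 < orient (z 0) (z 1) (z 2)" using orient_sign(1)[of 0 1 2] grid_hull_check by simp
  note tri = in_triangle_iff[OF this]
  show "z ` {..<9} \<subseteq> convex hull (z ` {..<3})"
  proof
    fix x assume "x \<in> z ` {..<9}"
    then obtain k where k: "k < 9" "x = z k" by auto
    then have "0 \<le> grid_orient 0 1 k \<and> 0 \<le> grid_orient 1 2 k \<and> 0 \<le> grid_orient 2 0 k"
      using grid_hull_check(1) unfolding less_9_iff by blast
    then have "0 \<le> orient (z 0) (z 1) (z k) \<and> 0 \<le> orient (z 1) (z 2) (z k) \<and> 0 \<le> orient (z 2) (z 0) (z k)"
      using orient_sign(2)[of _ _ k] k(1) by (simp add: linorder_not_less[symmetric])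
    then show "x \<in> convex hull (z ` {..<3})" unfolding k(2) less_3_set using tri by simp
  qed
qed

lemma gadget_empty_triangles:
  assumes s: "s \<in> set gadget_drawings"
  shows "empty_triangles (z ` {..<9}) (gadget_graph z s) =
    (\<lambda>(a, b, c). {z (s ! a), z (s ! b), z (s ! c)}) ` set gadget_faces"
proof (intro equalityI subsetI)
  fix t assume "t \<in> empty_triangles (z ` {..<9}) (gadget_graph z s)"
  then have t: "t \<in> nsets (z ` {..<9}) 3" "nsets t 2 \<subseteq> gadget_graph z s" "z ` {..<9} \<inter> convex hull t \<subseteq> t"
    by (auto simp: empty_triangles_def)
  obtain x y w where xyw: "t = {x, y, w}" "x \<in> z ` {..<9}" "y \<in> z ` {..<9}" "w \<in> z ` {..<9}" "x \<noteq> y" "y \<noteq> w" "w \<noteq> x"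
    using three_subset[OF t(1)] by metis
  have "z ` {..<9} = (\<lambda>a. z (s ! a)) ` {..<9}" using drawing(6)[OF s] by (metis image_image)
  then obtain a b c where abc: "x = z (s ! a)" "y = z (s ! b)" "w = z (s ! c)" "a < 9" "b < 9" "c < 9"
    using xyw by auto
  have "gadget_adj a b" "gadget_adj b c" "gadget_adj c a"
    using t(2) nsets_3_2[OF xyw(5-7)] gadget_graph_iff[OF s] abc unfolding xyw(1) by auto
  moreover have "a \<in> set labels" "b \<in> set labels" "c \<in> set labels"
    using abc(4-6) by (simp_all only: less_9_iff)
  ultimately have "{a, b, c} = {0, 1, 2} \<or> (\<exists>(a', b', c')\<in>set gadget_faces. {a, b, c} = {a', b', c'})"
    using gadget_triangles_check[THEN bspec, of a, THEN bspec, of b, THEN bspec, of c] by (simp only: simp_thms)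
  moreover have tt: "t = (\<lambda>a. z (s ! a)) ` {a, b, c}" using xyw(1) abc by simp
  moreover have False if "{a, b, c} = {0, 1, 2}"
  proof -
    have "t = z ` {..<3}" unfolding tt that using drawing(1-3)[OF s] by (simp add: less_3_set)
    moreover have "z ` {..<9} \<subseteq> convex hull (z ` {..<3})" using gadget_framed[OF s] by (simp add: framed_def)
    moreover have "z 3 \<in> z ` {..<9}" by simp
    ultimately have "z 3 \<in> z ` {..<3}" using t(3) by blast
    then show False using z_eq_iff[of 3] by (auto simp: less_3_set)
  qed
  ultimately obtain a' b' c' where "(a', b', c') \<in> set gadget_faces" "t = (\<lambda>a. z (s ! a)) ` {a', b', c'}"
    by blast
  then show "t \<in> (\<lambda>(a, b, c). {z (s ! a), z (s ! b), z (s ! c)}) ` set gadget_faces"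
    by (intro image_eqI[of _ _ "(a', b', c')"]) auto
next
  fix t assume "t \<in> (\<lambda>(a, b, c). {z (s ! a), z (s ! b), z (s ! c)}) ` set gadget_faces"
  then obtain a b c where abc: "(a, b, c) \<in> set gadget_faces" "t = {z (s ! a), z (s ! b), z (s ! c)}" by auto
  have lt: "a < 9" "b < 9" "c < 9" "a \<noteq> b" "b \<noteq> c" "c \<noteq> a" "gadget_adj a b" "gadget_adj b c" "gadget_adj c a"
    using gadget_faces_check abc(1) by auto
  have slt: "s ! a < 9" "s ! b < 9" "s ! c < 9" using lt drawing(4)[OF s] by auto
  have ne: "z (s ! a) \<noteq> z (s ! b)" "z (s ! b) \<noteq> z (s ! c)" "z (s ! c) \<noteq> z (s ! a)"
    using lt slt drawing(5)[OF s] z_eq_iff by auto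
  note check = empty_faces_check[THEN bspec, OF s, THEN bspec, OF abc(1), unfolded case_prod_conv]
  have chk: "0 < grid_orient (s ! a) (s ! b) (s ! c)"
    "\<And>d. d < 9 \<Longrightarrow> d = a \<or> d = b \<or> d = c \<or> grid_orient (s ! a) (s ! b) (s ! d) < 0 \<or>
        grid_orient (s ! b) (s ! c) (s ! d) < 0 \<or> grid_orient (s ! c) (s ! a) (s ! d) < 0"
  proof -
    show "0 < grid_orient (s ! a) (s ! b) (s ! c)" using check by (rule conjunct1)
    show "d = a \<or> d = b \<or> d = c \<or> grid_orient (s ! a) (s ! b) (s ! d) < 0 \<or>
        grid_orient (s ! b) (s ! c) (s ! d) < 0 \<or> grid_orient (s ! c) (s ! a) (s ! d) < 0" if "d < 9" for d
      by (rule conjunct2[OF check, THEN bspec]) (use that in \<open>simp only: less_9_iff\<close>)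
  qed
  have "0 < orient (z (s ! a)) (z (s ! b)) (z (s ! c))" using orient_sign(1)[OF slt] chk(1) by simp
  note tri = in_triangle_iff[OF this]
  have "z ` {..<9} \<inter> convex hull t \<subseteq> t"
  proof
    fix x assume x: "x \<in> z ` {..<9} \<inter> convex hull t"
    have "z ` {..<9} = (\<lambda>a. z (s ! a)) ` {..<9}" using drawing(6)[OF s] by (metis image_image)
    then obtain d where d: "d < 9" "x = z (s ! d)" using x by auto
    have sd: "s ! d < 9" using d(1) drawing(4)[OF s] by auto
    have "0 \<le> orient (z (s ! a)) (z (s ! b)) x" "0 \<le> orient (z (s ! b)) (z (s ! c)) x" "0 \<le> orient (z (s ! c)) (z (s ! a)) x"
      using x tri unfolding abc(2) by auto
    then have "d = a \<or> d = b \<or> d = c"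
      using chk(2)[OF d(1)] orient_sign(2)[OF slt(1,2) sd] orient_sign(2)[OF slt(2,3) sd] orient_sign(2)[OF slt(3,1) sd]
      unfolding d(2) by linarith
    then show "x \<in> t" using d(2) abc(2) by auto
  qed
  moreover have "nsets t 2 \<subseteq> gadget_graph z s"
    unfolding abc(2) nsets_3_2[OF ne] using gadget_graph_iff[OF s] lt by simp
  moreover have "t \<in> nsets (z ` {..<9}) 3" unfolding abc(2) using ne slt by (auto simp: nsets_def)
  ultimately show "t \<in> empty_triangles (z ` {..<9}) (gadget_graph z s)" by (simp add: empty_triangles_def)
qed

lemma labels_drawing: "labels \<in> set gadget_drawings" "i < 9 \<Longrightarrow> labels ! i = i"
  using different_drawings_check(4) by (auto simp: less_9_iff)

lemma gadget_redrawings: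
  assumes s: "s \<in> set gadget_drawings"
  shows "gadget_graph z s \<in> redrawings (z ` {..<3}) (z ` {..<9}) (gadget_graph z labels)"
proof -
  define f where "f x = z (s ! (inv_into {..<9} z x))" for x
  have f: "f (z i) = z (s ! i)" if "i < 9" for i using that inj_z by (simp add: f_def)
  have fi: "f ` z ` A = (\<lambda>i. z (s ! i)) ` A" if "A \<subseteq> {..<9}" for A
    using that f by (auto simp: image_image intro!: image_cong)
  have img: "f ` (z ` {..<9}) = z ` {..<9}" using fi[of "{..<9}"] drawing(6)[OF s] by (metis image_image order_refl)
  then have "bij_betw f (z ` {..<9}) (z ` {..<9})" by (simp add: bij_betw_def finite_surj_inj)
  moreover have "\<forall>x\<in>z ` {..<3}. f x = x" using f drawing(1-3)[OF s] by (simp add: less_3_set)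
  moreover have "(`) f ` gadget_graph z labels = gadget_graph z s"
    unfolding gadget_graph_def image_image
    by (rule image_cong) (use gadget_edges_check(1) f labels_drawing(2) in auto)
  moreover have "(`) f ` empty_triangles (z ` {..<9}) (gadget_graph z labels) = empty_triangles (z ` {..<9}) (gadget_graph z s)"
    unfolding gadget_empty_triangles[OF s] gadget_empty_triangles[OF labels_drawing(1)] image_image
    by (rule image_cong) (use gadget_faces_check f labels_drawing(2) in auto)
  ultimately show ?thesis using gadget_crossing_free[OF s] unfolding redrawings_def by blast
qed

lemma card_gadget_redrawings:
  "6 \<le> card (redrawings (z ` {..<3}) (z ` {..<9}) (gadget_graph z labels))"
proof -
  have "inj_on (gadget_graph z) (set gadget_drawings)"
  proof (rule inj_onI, rule ccontr)
    fix s s' assume s: "s \<in> set gadget_drawings" and s': "s' \<in> set gadget_drawings"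
      and eq: "gadget_graph z s = gadget_graph z s'" and "s \<noteq> s'"
    then obtain a b where ab: "(a, b) \<in> set gadget_edges"
      "\<And>c d. (c, d) \<in> set gadget_edges \<Longrightarrow> {s ! a, s ! b} \<noteq> {s' ! c, s' ! d}"
      using different_drawings_check(1) by fast
    have "{z (s ! a), z (s ! b)} \<in> gadget_graph z s"
      unfolding gadget_graph_def by (rule image_eqI[of _ _ "(a, b)"]) (use ab(1) in auto)
    then have "{z (s ! a), z (s ! b)} \<in> gadget_graph z s'" using eq by simp
    then obtain c d where cd: "(c, d) \<in> set gadget_edges" "{z (s ! a), z (s ! b)} = {z (s' ! c), z (s' ! d)}" "c < 9" "d < 9"
      by (rule gadget_edge_cases)
    have "a < 9" "b < 9" using gadget_edges_check(1) ab(1) by auto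
    then have "z ` {s ! a, s ! b} = z ` {s' ! c, s' ! d} \<longleftrightarrow> {s ! a, s ! b} = {s' ! c, s' ! d}"
      using cd(3,4) drawing(4)[OF s] drawing(4)[OF s'] by (intro inj_on_image_eq_iff[OF inj_z]) auto
    then show False using ab(2)[OF cd(1)] cd(2) by simp
  qed
  then have "card (gadget_graph z ` set gadget_drawings) = 6"
    using different_drawings_check(2,3) by (simp add: card_image distinct_card)
  moreover have "finite (redrawings (z ` {..<3}) (z ` {..<9}) (gadget_graph z labels))"
    by (rule finite_redrawings) simp
  moreover have "gadget_graph z ` set gadget_drawings \<subseteq> redrawings (z ` {..<3}) (z ` {..<9}) (gadget_graph z labels)"
    using gadget_redrawings by blast
  ultimately show ?thesis using card_mono by metis
qed

lemma gadget_interior: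
  assumes "gadget_graph z labels \<subseteq> E"
  shows "linked E (z ` {3..<9})" "\<forall>a\<in>z ` {..<3}. \<exists>u\<in>z ` {3..<9}. {u, a} \<in> E"
proof -
  have adj: "{z i, z j} \<in> E" if "gadget_adj i j" "i < 9" "j < 9" for i j
    using gadget_graph_iff[OF labels_drawing(1), of i j] that labels_drawing(2) assms by auto
  have "linked E (\<Union>i\<in>set [7, 4, 5, 6, 8, 3]. {z i})"
    by (rule linked_branch_sets[OF gadget_interior_check(1)]) (auto intro: linked.single adj)
  moreover have "(\<Union>i\<in>set [7, 4, 5, 6, 8, 3]. {z i}) = z ` {3..<9}"
  proof -
    have "{3..<9} = set [7, 4, 5, 6, 8, 3::nat]" by auto
    then show ?thesis by auto
  qed
  ultimately show "linked E (z ` {3..<9})" by simp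
  show "\<forall>a\<in>z ` {..<3}. \<exists>u\<in>z ` {3..<9}. {u, a} \<in> E"
    using adj[OF gadget_interior_check(2)] adj[OF gadget_interior_check(3)] adj[OF gadget_interior_check(4)]
    by (auto simp: less_3_set)
qed

lemma saturated_add_gadget:
  assumes "saturated V E" "E \<subseteq> nsets V 2" "z ` {..<3} \<subseteq> V" "nsets (z ` {..<3}) 2 \<subseteq> E"
    "attached V E (z ` {..<3})" "z ` {3..<9} \<inter> V = {}"
  shows "saturated (V \<union> z ` {3..<9}) (E \<union> gadget_graph z labels)"
proof (rule saturated_glue[OF assms])
  have un: "z ` {..<3} \<union> z ` {3..<9} = z ` {..<9}" by (auto simp: image_Un[symmetric])
  show "gadget_graph z labels \<subseteq> nsets (z ` {..<3} \<union> z ` {3..<9}) 2"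
    unfolding un using gadget_crossing_free[OF labels_drawing(1)] crossing_freeD(2) by blast
  have adj: "{z i, z j} \<in> E'" if "gadget_adj i j" "i < 9" "j < 9" "gadget_graph z labels \<subseteq> E'" for i j E'
    using gadget_graph_iff[OF labels_drawing(1), of i j] that labels_drawing(2) by auto
  fix x y assume x: "x \<in> z ` {..<3} \<union> z ` {3..<9}" and y: "y \<in> z ` {3..<9}" and "x \<noteq> y"
    and xy: "{x, y} \<notin> gadget_graph z labels"
  let ?F = "nsets (z ` {..<3}) 2 \<union> gadget_graph z labels"
  obtain i j where ij: "x = z i" "i < 9" "y = z j" "j < 9" using x y unfolding un by auto
  have "i \<noteq> j" "\<not> gadget_adj i j" using xy \<open>x \<noteq> y\<close> ij adj[of i j "gadget_graph z labels"] by auto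
  moreover have "i \<in> set labels" "j \<in> set labels" using ij(2,4) by (simp_all only: less_9_iff)
  ultimately have "\<exists>(x, ys, q1, q2, q3)\<in>set gadget_rows. witness_row gadget_adj (x, ys, q1, q2, q3) \<and>
      (\<forall>y\<in>set ys. y < 9) \<and> (x = i \<and> j \<in> set ys \<or> x = j \<and> i \<in> set ys)"
    using gadget_rows_check[THEN bspec, of i, THEN bspec, of j] by (simp only: simp_thms)
  then obtain u ys q1 q2 q3 where row: "witness_row gadget_adj (u, ys, q1, q2, q3)" "\<forall>y\<in>set ys. y < 9"
      "u = i \<and> j \<in> set ys \<or> u = j \<and> i \<in> set ys"
    by fast
  have "K5_witness ?F (z u) (z v)" if "v \<in> set ys" for v
    by (rule K5_witness_of_row[OF row(1) inj_z, where \<phi>="\<lambda>i. {z i}"])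
       (use row(2) that in \<open>auto intro: linked.single adj\<close>)
  then show "K5_witness ?F x y \<or> K5_witness ?F y x" using row(3) ij by auto
next
  fix x y Y E'
  assume x: "x \<in> z ` {3..<9}" and y: "y \<in> Y" and Y: "Y \<inter> (z ` {..<3} \<union> z ` {3..<9}) = {}" "linked E' Y"
    "\<forall>a\<in>z ` {..<3}. \<exists>u\<in>Y. {u, a} \<in> E'" and E': "nsets (z ` {..<3}) 2 \<union> gadget_graph z labels \<subseteq> E'"
  have un: "z ` {..<3} \<union> z ` {3..<9} = z ` {..<9}" by (auto simp: image_Un[symmetric])
  have adj: "{z i, z j} \<in> E'" if "gadget_adj i j" "i < 9" "j < 9" for i j
    using gadget_graph_iff[OF labels_drawing(1), of i j] that labels_drawing(2) E' by auto
  obtain i where i: "x = z i" "3 \<le> i" "i < 9" using x by auto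
  then have "i \<in> set [3, 4, 5, 6, 7, 8]" by auto
  then obtain ys q1 q2 q3 where row: "witness_row hub_adj (i, ys, q1, q2, q3)" "\<forall>y\<in>set ys. y \<le> 9" "9 \<in> set ys"
    using hub_rows_check[THEN bspec, of i] by fast
  define \<phi> where "\<phi> i = (if i < 9 then {z i} else Y)" for i :: nat
  have low: "{z i, z j} \<in> E'" if "hub_adj i j" "i < 9" "j < 9" for i j
    using that adj by (auto simp: hub_adj_def)
  have not99: "\<not> hub_adj 9 9" by code_simp
  have hub: "j < 3" if "hub_adj 9 j" for j
    using that gadget_edges_check(1) by (auto simp: hub_adj_def gadget_adj_def)
  have hub': "j < 3" if "hub_adj j 9" for j
    using that gadget_edges_check(1) by (auto simp: hub_adj_def gadget_adj_def)
  show "K5_witness E' x y"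
    unfolding i(1)
  proof (rule K5_witness_of_row[OF row(1) inj_z, where \<phi>=\<phi>])
    show "\<exists>u\<in>\<phi> i'. \<exists>v\<in>\<phi> j. {u, v} \<in> E'"
      if ij: "hub_adj i' j" "i' < 9 \<or> i' \<in> set ys" "j < 9 \<or> j \<in> set ys" for i' j
    proof -
      have le: "i' \<le> 9" "j \<le> 9" using ij row(2) by auto
      then consider "i' < 9" "j < 9" | "i' = 9" "j < 3" | "i' < 3" "j = 9"
        using ij(1) hub[of j] hub'[of i'] by fastforce
      then show ?thesis
      proof cases
        case 1 then show ?thesis using low ij by (simp add: \<phi>_def)
      next
        case 2 then show ?thesis using Y(3) by (auto simp: \<phi>_def)
      next
        case 3 then show ?thesis using Y(3) by (auto simp: \<phi>_def insert_commute)
      qed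
    qed
    show "9 \<in> set ys" "y \<in> \<phi> 9" using row(3) y by (auto simp: \<phi>_def)
    show "i' < 9 \<or> \<phi> i' \<inter> z ` {..<9} = {}" for i' using Y(1) unfolding un by (simp add: \<phi>_def)
    show "linked E' (\<phi> i')" for i' using Y(2) by (auto simp: \<phi>_def intro: linked.single)
  qed (simp add: \<phi>_def)
qed

end

section \<open>Placing the gadget in general position\<close>

text \<open>Finitely many points and lines are a null set.\<close>

lemma exists_generic_point:
  assumes "finite S" "open U" "U \<noteq> {}"
  obtains w where "w \<in> U" "w \<notin> S" "\<And>a b. a \<in> S \<Longrightarrow> b \<in> S \<Longrightarrow> a \<noteq> b \<Longrightarrow> orient a b w \<noteq> 0"
proof -
  let ?L = "(\<lambda>(a, b). {w. orient a b w = 0}) ` {(a, b). a \<in> S \<and> b \<in> S \<and> a \<noteq> b}"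
  have line: "negligible {w. orient a b w = 0}" if "a \<noteq> b" for a b
  proof -
    define v where "v = Complex (Im a - Im b) (Re b - Re a)"
    have "{w. orient a b w = 0} = {w. v \<bullet> w = v \<bullet> a}"
      by (auto simp: orient_def v_def inner_complex_def algebra_simps)
    moreover have "v \<noteq> 0" using that by (auto simp: v_def complex_eq_iff)
    ultimately show ?thesis by (simp add: negligible_hyperplane)
  qed
  have "finite {(a, b). a \<in> S \<and> b \<in> S \<and> a \<noteq> b}"
    by (rule finite_subset[of _ "S \<times> S"]) (use assms(1) in auto)
  then have "negligible (\<Union>?L)"
    using line by (intro negligible_Union finite_imageI) auto
  then have "negligible (S \<union> \<Union>?L)"
    using negligible_finite[OF assms(1)] by (intro negligible_Un)
  then have "\<not> U \<subseteq> S \<union> \<Union>?L"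
    using open_not_negligible[OF assms(2,3)] negligible_subset by blast
  then obtain w where "w \<in> U" "w \<notin> S" "w \<notin> \<Union>?L" by blast
  then show thesis by (intro that[of w]) auto
qed

lemma general_position_insert:
  assumes "general_position S" "\<And>a b. a \<in> S \<Longrightarrow> b \<in> S \<Longrightarrow> a \<noteq> b \<Longrightarrow> orient a b w \<noteq> 0"
  shows "general_position (insert w S)"
  unfolding general_position_iff
proof (intro ballI impI)
  fix a b c assume abc: "a \<in> insert w S" "b \<in> insert w S" "c \<in> insert w S" "a \<noteq> b" "b \<noteq> c" "c \<noteq> a"
  then consider "a \<in> S" "b \<in> S" "c \<in> S" | "a = w" "b \<in> S" "c \<in> S" | "a \<in> S" "b = w" "c \<in> S" | "a \<in> S" "b \<in> S" "c = w"
    by auto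
  then show "orient a b c \<noteq> 0"
  proof cases
    case 1 then show ?thesis using assms(1) abc(4-6) by (simp add: general_position_iff)
  next
    case 2 then show ?thesis using assms(2)[of b c] abc orient_rotate[of b c w] by simp
  next
    case 3 then show ?thesis using assms(2)[of c a] abc orient_rotate[of a w c] orient_rotate[of w c a] by simp
  next
    case 4 then show ?thesis using assms(2)[of a b] abc by simp
  qed
qed

lemma perturb_to_general_position:
  fixes z :: "nat \<Rightarrow> complex"
  assumes "finite S" "general_position S" "0 < \<delta>"
  shows "\<exists>z'. (\<forall>i<k. dist (z' i) (z i) < \<delta>) \<and> inj_on z' {..<k} \<and> z' ` {..<k} \<inter> S = {} \<and>
    general_position (S \<union> z' ` {..<k})"
proof (induction k)
  case 0 then show ?case using assms(2) by simp
next
  case (Suc k)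
  then obtain z' where z': "\<forall>i<k. dist (z' i) (z i) < \<delta>" "inj_on z' {..<k}" "z' ` {..<k} \<inter> S = {}"
    "general_position (S \<union> z' ` {..<k})" by blast
  obtain w where w: "w \<in> ball (z k) \<delta>" "w \<notin> S \<union> z' ` {..<k}"
      "\<And>a b. a \<in> S \<union> z' ` {..<k} \<Longrightarrow> b \<in> S \<union> z' ` {..<k} \<Longrightarrow> a \<noteq> b \<Longrightarrow> orient a b w \<noteq> 0"
    using exists_generic_point[of "S \<union> z' ` {..<k}" "ball (z k) \<delta>"] assms by auto
  have img: "(z'(k := w)) ` {..<Suc k} = insert w (z' ` {..<k})"
    by (auto simp: lessThan_Suc)
  have "general_position (S \<union> (z'(k := w)) ` {..<Suc k})"
    unfolding img using general_position_insert[OF z'(4) w(3)] by simp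
  moreover have "inj_on (z'(k := w)) {..<Suc k}"
    using z'(2) w(2) by (auto simp: inj_on_def lessThan_Suc)
  moreover have "(z'(k := w)) ` {..<Suc k} \<inter> S = {}" unfolding img using z'(3) w(2) by auto
  moreover have "\<forall>i<Suc k. dist ((z'(k := w)) i) (z i) < \<delta>"
    using z'(1) w(1) by (auto simp: less_Suc_eq dist_commute)
  ultimately show ?case by blast
qed

text \<open>Formulated with a filter so that finitely many triples can be treated at once.\<close>

lemma orient_sgn_stable:
  assumes "orient a b c \<noteq> 0"
  shows "\<forall>\<^sub>F \<delta> in at_right 0. \<forall>a' b' c'. dist a' a < \<delta> \<longrightarrow> dist b' b < \<delta> \<longrightarrow> dist c' c < \<delta> \<longrightarrow>
    sgn (orient a' b' c') = sgn (orient a b c)"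
proof -
  let ?O = "{p. 0 < orient a b c * orient (fst p) (fst (snd p)) (snd (snd p))}"
  have "open ?O" unfolding orient_def by (intro open_Collect_less continuous_intros)
  moreover have "(a, b, c) \<in> ?O" using assms by (cases "0 < orient a b c") (auto simp: zero_less_mult_iff)
  ultimately obtain e where "0 < e" "ball (a, b, c) e \<subseteq> ?O" by (rule openE)
  then have e: "0 < e" "\<And>p. dist p (a, b, c) < e \<Longrightarrow> p \<in> ?O"
    by (simp_all add: subset_iff dist_commute)
  have "sgn (orient a' b' c') = sgn (orient a b c)"
    if "\<delta> < e / 3" "dist a' a < \<delta>" "dist b' b < \<delta>" "dist c' c < \<delta>" for \<delta> a' b' c'
  proof -
    have "dist (a', b', c') (a, b, c) \<le> dist a' a + dist (b', c') (b, c)"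
      unfolding dist_Pair_Pair by (rule sqrt_sum_squares_le_sum) simp_all
    also have "dist (b', c') (b, c) \<le> dist b' b + dist c' c"
      unfolding dist_Pair_Pair by (rule sqrt_sum_squares_le_sum) simp_all
    finally have "(a', b', c') \<in> ?O" using that by (intro e(2)) linarith
    then show ?thesis by (auto simp: zero_less_mult_iff sgn_if)
  qed
  note stable = this
  show ?thesis
    unfolding eventually_at_right_field
  proof (intro exI[of _ "e / 3"] conjI allI impI)
    show "0 < e / 3" using e(1) by simp
  qed (rule stable)
qed

text \<open>An affine copy of \<open>gadget_points\<close> has the right orientations, and a small perturbation
of its inner points brings them into general position without changing these orientations.\<close>

lemma place_gadget:
  assumes pos: "0 < orient P Q R" and S: "finite S" "general_position S" "{P, Q, R} \<subseteq> S"
  obtains z where "realizes_grid z" "z ` {..<3} = {P, Q, R}" "z ` {3..<9} \<inter> S = {}"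
    "general_position (S \<union> z ` {..<9})"
proof -
  define w where "w i = (case gadget_points ! i of (x, y) \<Rightarrow>
      P + (of_int x / 13) *\<^sub>R (Q - P) + (of_int y / 13) *\<^sub>R (R - P))" for i
  have w012: "w 0 = P" "w 1 = Q" "w 2 = R" by (simp_all add: w_def gadget_points_def)
  have ow: "169 * orient (w i) (w j) (w k) = of_int (grid_orient i j k) * orient P Q R" for i j k
  proof -
    obtain a a' b b' c c' where "gadget_points ! i = (a, a')" "gadget_points ! j = (b, b')" "gadget_points ! k = (c, c')"
      by (metis surj_pair)
    then show ?thesis
      by (simp add: w_def grid_orient_def orient_def field_simps)
  qed
  have sw: "sgn (orient (w i) (w j) (w k)) = of_int (sgn (grid_orient i j k))" for i j k
  proof -
    have "sgn (169 * orient (w i) (w j) (w k)) = sgn (of_int (grid_orient i j k) * orient P Q R)" by (simp add: ow)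
    moreover have "sgn (of_int n :: real) = of_int (sgn n)" for n by (simp add: sgn_if)
    ultimately show ?thesis using pos by (simp add: sgn_mult)
  qed
  \<comment> \<open>Degenerate triples of labels have orientation zero in every configuration and need no stability.\<close>
  define T where "T = {(i, j, k). i < 9 \<and> j < 9 \<and> k < 9 \<and> orient (w i) (w j) (w k) \<noteq> 0}"
  have "finite T" by (rule finite_subset[of _ "{..<9} \<times> {..<9} \<times> {..<9}"]) (auto simp: T_def)
  define stab where "stab \<delta> \<longleftrightarrow> (\<forall>t\<in>T. case t of (i, j, k) \<Rightarrow>
      \<forall>a b c. dist a (w i) < \<delta> \<longrightarrow> dist b (w j) < \<delta> \<longrightarrow> dist c (w k) < \<delta> \<longrightarrow>
      sgn (orient a b c) = sgn (orient (w i) (w j) (w k)))" for \<delta>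
  have "\<forall>\<^sub>F \<delta> in at_right 0. stab \<delta>"
    unfolding stab_def using \<open>finite T\<close>
  proof (rule eventually_ball_finite, intro ballI)
    fix t assume "t \<in> T"
    then obtain i j k where t: "t = (i, j, k)" "orient (w i) (w j) (w k) \<noteq> 0" by (auto simp: T_def)
    show "\<forall>\<^sub>F \<delta> in at_right 0. case t of (i, j, k) \<Rightarrow>
      \<forall>a b c. dist a (w i) < \<delta> \<longrightarrow> dist b (w j) < \<delta> \<longrightarrow> dist c (w k) < \<delta> \<longrightarrow>
      sgn (orient a b c) = sgn (orient (w i) (w j) (w k))"
      unfolding t(1) case_prod_conv using t(2) by (rule orient_sgn_stable)
  qed
  then obtain b where b: "0 < b" "\<And>\<delta>. 0 < \<delta> \<Longrightarrow> \<delta> < b \<Longrightarrow> stab \<delta>"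
    unfolding eventually_at_right_field by blast
  have stable: "sgn (orient a b' c) = sgn (orient (w i) (w j) (w k))"
    if "0 < \<delta>" "\<delta> < b" "(i, j, k) \<in> T" "dist a (w i) < \<delta>" "dist b' (w j) < \<delta>" "dist c (w k) < \<delta>" for \<delta> i j k a b' c
    using b(2)[OF that(1,2), unfolded stab_def, THEN bspec, OF that(3), unfolded case_prod_conv] that(4-6) by simp
  have b2: "0 < b / 2" "b / 2 < b" using b by auto
  obtain z' where z': "\<forall>i<6. dist (z' i) (w (i + 3)) < b / 2" "inj_on z' {..<6}" "z' ` {..<6} \<inter> S = {}"
      "general_position (S \<union> z' ` {..<6})"
    using perturb_to_general_position[OF S(1,2) b2(1), of 6 "\<lambda>i. w (i + 3)"] by blast
  define z where "z i = (if i < 3 then w i else z' (i - 3))" for i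
  have close: "dist (z i) (w i) < b / 2" if "i < 9" for i
    using that b2(1) z'(1)[rule_format, of "i - 3"] by (auto simp: z_def)
  have z3: "z ` {..<3} = {P, Q, R}"
  proof -
    have "{..<3} = {0, 1, 2::nat}" by auto
    then show ?thesis using w012(2) by (simp add: z_def w012)
  qed
  have z9: "z ` {3..<9} = z' ` {..<6}"
  proof -
    have "{3..<9::nat} = (\<lambda>i. i + 3) ` {..<6}" by (simp add: lessThan_atLeast0)
    then have "z ` {3..<9} = (\<lambda>i. z (i + 3)) ` {..<6}" by (simp only: image_image)
    then show ?thesis by (simp add: z_def)
  qed
  have "z ` {..<9} = z ` {..<3} \<union> z ` {3..<9}" by (auto simp: image_Un[symmetric])
  then have Sz: "S \<union> z ` {..<9} = S \<union> z' ` {..<6}" using z3 z9 S(3) by auto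
  have "sgn (orient (z i) (z j) (z k)) = of_int (sgn (grid_orient i j k))" if "i < 9" "j < 9" "k < 9" for i j k
  proof (cases "(i, j, k) \<in> T")
    case True
    then show ?thesis using stable[OF b2 True close close close] that sw by simp
  next
    case False
    then have "grid_orient i j k = 0" using that sw[of i j k] by (simp add: T_def sgn_eq_0_iff)
    moreover from this have "i = j \<or> j = k \<or> k = i"
      using grid_general_position_check that unfolding less_9_iff by blast
    ultimately show ?thesis by auto
  qed
  then have "realizes_grid z" by (simp add: realizes_grid_def)
  then show thesis
    using that[of z] z3 z9 z'(3,4) Sz by simp
qed

text \<open>What gluing at \<open>t\<close> requires of a part, apart from general position. The part is
attached to its own outer triangle, so that after gluing it can belong to the branch set used when
the next part is glued elsewhere.\<close>

definition fills :: "complex set \<Rightarrow> complex set \<Rightarrow> complex set set \<Rightarrow> bool" where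
  "fills t S G \<longleftrightarrow> framed t S G \<and> attached S G t \<and>
     (\<forall>V E. saturated V E \<longrightarrow> E \<subseteq> nsets V 2 \<longrightarrow> t \<subseteq> V \<longrightarrow> nsets t 2 \<subseteq> E \<longrightarrow> attached V E t \<longrightarrow>
        S \<inter> V = t \<longrightarrow> saturated (V \<union> S) (E \<union> G))"

text \<open>Quantifying over the set \<open>V\<close> of points already placed allows several triangles to be
filled one after the other without leaving general position.\<close>

definition fillable :: "nat \<Rightarrow> nat \<Rightarrow> bool" where
  "fillable k m \<longleftrightarrow> (\<forall>P Q R V. 0 < orient P Q R \<longrightarrow> finite V \<longrightarrow> general_position V \<longrightarrow> {P, Q, R} \<subseteq> V \<longrightarrow>
     (\<exists>S G. fills {P, Q, R} S G \<and> S \<inter> V = {P, Q, R} \<and> general_position (V \<union> S) \<and>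
        card S = 3 + k \<and> m \<le> card (redrawings {P, Q, R} S G)))"

lemma orient_pos_distinct: "0 < orient a b c \<Longrightarrow> a \<noteq> b \<and> b \<noteq> c \<and> c \<noteq> a"
  by auto

lemma card_redrawings_pos: "framed H S G \<Longrightarrow> 1 \<le> card (redrawings H S G)"
  using framed_self_redrawing[of H S G] finite_redrawings[of S H G] crossing_freeD(1)[of S G]
  by (auto simp: framed_def Suc_le_eq card_gt_0_iff)

lemma framed_triangle:
  assumes "0 < orient P Q R"
  shows "framed {P, Q, R} {P, Q, R} (nsets {P, Q, R} 2)"
proof -
  note ne = orient_pos_distinct[OF assms]
  have o: "orient P Q R \<noteq> 0" "orient Q R P \<noteq> 0" "orient R P Q \<noteq> 0"
    using assms orient_rotate[of Q R P] orient_rotate[of R P Q] by auto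
  have "crossing_free {P, Q, R} (nsets {P, Q, R} 2)"
    using ne segments_common_end[OF o(1)] segments_common_end[OF o(2)] segments_common_end[OF o(3)]
    unfolding crossing_free_def simple_graph_def by (auto simp: nsets_3_2 insert_commute)
  then show ?thesis using ne by (auto simp: framed_def nsets_def hull_inc)
qed

lemma fillable_empty: "fillable 0 1"
  unfolding fillable_def
proof (intro allI impI)
  fix P Q R V assume pos: "0 < orient P Q R" and V: "finite V" "general_position V" "{P, Q, R} \<subseteq> V"
  have "fills {P, Q, R} {P, Q, R} (nsets {P, Q, R} 2)"
    unfolding fills_def
  proof (intro conjI allI impI framed_triangle[OF pos])
    fix W E assume "saturated W E" "{P, Q, R} \<subseteq> W" "nsets {P, Q, R} 2 \<subseteq> E"
    then show "saturated (W \<union> {P, Q, R}) (E \<union> nsets {P, Q, R} 2)"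
      by (simp only: Un_absorb2)
  qed (simp add: attached_def)
  moreover have "card {P, Q, R} = 3 + 0" using orient_pos_distinct[OF pos] by auto
  ultimately show "\<exists>S G. fills {P, Q, R} S G \<and> S \<inter> V = {P, Q, R} \<and> general_position (V \<union> S) \<and>
      card S = 3 + 0 \<and> 1 \<le> card (redrawings {P, Q, R} S G)"
    using V(2,3) card_redrawings_pos[OF framed_triangle[OF pos]]
    by (intro exI[of _ "{P, Q, R}"] exI[of _ "nsets {P, Q, R} 2"]) (simp only: Un_absorb2 Int_absorb2 simp_thms)
qed

lemma fillable_gadget: "fillable 6 6"
  unfolding fillable_def
proof (intro allI impI)
  fix P Q R V assume pos: "0 < orient P Q R" and V: "finite V" "general_position V" "{P, Q, R} \<subseteq> V"
  obtain z where z: "realizes_grid z" "z ` {..<3} = {P, Q, R}" "z ` {3..<9} \<inter> V = {}"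
    "general_position (V \<union> z ` {..<9})" using place_gadget[OF pos V] by blast
  interpret gadget z by unfold_locales (rule z(1))
  have un: "z ` {..<9} = {P, Q, R} \<union> z ` {3..<9}" unfolding z(2)[symmetric] by (auto simp: image_Un[symmetric])
  have disj: "{P, Q, R} \<inter> z ` {3..<9} = {}" using z(3) V(3) by blast
  have diff: "z ` {..<9} - {P, Q, R} = z ` {3..<9}" using un disj by blast
  have fr: "framed {P, Q, R} (z ` {..<9}) (gadget_graph z labels)"
    using gadget_framed[OF labels_drawing(1)] unfolding z(2) .
  have "attached (z ` {..<9}) (gadget_graph z labels) {P, Q, R}"
    unfolding attached_def diff using gadget_interior[OF order_refl] unfolding z(2) by blast
  moreover have "saturated (W \<union> z ` {..<9}) (E \<union> gadget_graph z labels)"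
    if W: "saturated W E" "E \<subseteq> nsets W 2" "{P, Q, R} \<subseteq> W" "nsets {P, Q, R} 2 \<subseteq> E" "attached W E {P, Q, R}"
      "z ` {..<9} \<inter> W = {P, Q, R}" for W E
  proof -
    have "z ` {3..<9} \<inter> W = {}" using W(6) un disj by blast
    then have "saturated (W \<union> z ` {3..<9}) (E \<union> gadget_graph z labels)"
      using W saturated_add_gadget[of W E] unfolding z(2) by blast
    moreover have "W \<union> z ` {3..<9} = W \<union> z ` {..<9}" using un W(3) by blast
    ultimately show ?thesis by simp
  qed
  ultimately have "fills {P, Q, R} (z ` {..<9}) (gadget_graph z labels)"
    using fr unfolding fills_def by blast
  moreover have "z ` {..<9} \<inter> V = {P, Q, R}" using un z(3) V(3) by blast
  moreover have "card (z ` {..<9}) = 3 + 6" using inj_z by (simp add: card_image)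
  moreover have "6 \<le> card (redrawings {P, Q, R} (z ` {..<9}) (gadget_graph z labels))"
    using card_gadget_redrawings unfolding z(2) .
  ultimately show "\<exists>S G. fills {P, Q, R} S G \<and> S \<inter> V = {P, Q, R} \<and> general_position (V \<union> S) \<and>
      card S = 3 + 6 \<and> 6 \<le> card (redrawings {P, Q, R} S G)"
    using z(4) by blast
qed

section \<open>Growing a flexible system\<close>

text \<open>The invariant of the induction: besides many redrawings, it records what is needed to glue
further parts at \<open>H\<close>.\<close>

definition flexible_system :: "complex set \<Rightarrow> complex set \<Rightarrow> complex set set \<Rightarrow> nat \<Rightarrow> bool" where
  "flexible_system H S G m \<longleftrightarrow> framed H S G \<and> general_position S \<and> saturated S G \<and> attached S G H \<and>
     m \<le> card (redrawings H S G)"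

lemma triangle_side:
  assumes "0 < orient p q r" "z \<in> convex hull {p, q, r}" "orient p q z = 0"
  shows "z \<in> convex hull {p, q}"
proof -
  obtain u v w where uvw: "0 \<le> u" "0 \<le> v" "0 \<le> w" "u + v + w = 1" "z = u *\<^sub>R p + v *\<^sub>R q + w *\<^sub>R r"
    using assms(2) by (auto simp: convex_hull_3)
  have "orient p q z = w * orient p q r" unfolding uvw(5) by (simp add: orient_affine[OF uvw(4)])
  then have "w = 0" using assms(1,3) by simp
  then show ?thesis using uvw by (auto simp: convex_hull_2)
qed

lemma opposite_triangles:
  assumes "0 < orient p q r" "0 < orient q p s"
  shows "convex hull {p, q, r} \<inter> convex hull {q, p, s} \<subseteq> convex hull {p, q}"
proof
  fix z assume z: "z \<in> convex hull {p, q, r} \<inter> convex hull {q, p, s}"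
  then have "0 \<le> orient p q z" "0 \<le> orient q p z" using in_triangle_iff assms by blast+
  then have "orient p q z = 0" using orient_swap[of q p z] by simp
  then show "z \<in> convex hull {p, q}" using triangle_side[OF assms(1)] z by blast
qed

text \<open>The shared corner \<open>h\<close> joins the two sets, since it is adjacent to the interior of the part
whenever there is one.\<close>

lemma linked_add_part:
  assumes "linked E X" "h \<in> X" "h \<in> t" "attached S G t" "G \<subseteq> E"
  shows "linked E (X \<union> (S - t))"
proof (cases "S = t")
  case False
  then obtain u where "linked G (S - t)" "u \<in> S - t" "{u, h} \<in> G"
    using assms(3,4) by (auto simp: attached_def)
  then show ?thesis
    using linked.link[OF assms(1) linked_mono[OF _ assms(5)] assms(2)] assms(5) by (auto simp: insert_commute)
qed (use assms in simp)

lemma base_difference: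
  assumes "u \<in> S" "u \<in> T" "c \<notin> S" "t' = insert c (T - {u})" "u \<notin> t'" "N \<inter> insert c S = {}" "T \<subseteq> S"
  shows "{u} \<union> (S - T) \<union> N = insert c S \<union> N - t'"
  using assms by auto

text \<open>The inductive step. The new corner \<open>C\<close> lies beyond \<open>X\<close> as seen from the side \<open>A B\<close>,
so that the old triangle and the triangles \<open>B C X\<close> and \<open>C A X\<close> form a mosaic of \<open>A B C\<close>.\<close>

lemma flexible_system_extend:
  assumes sys: "flexible_system {A, B, X} S G m" and pos: "0 < orient A B X" and fill: "fillable k l"
  obtains C S' G' where "flexible_system {A, B, C} S' G' (m * l * l)" "0 < orient A B C"
    "card S' = card S + 1 + 2 * k"
proof -
  have fr: "framed {A, B, X} S G" and gpS: "general_position S" and sat: "saturated S G"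
    and att: "attached S G {A, B, X}" and m: "m \<le> card (redrawings {A, B, X} S G)"
    using sys by (auto simp: flexible_system_def)
  have finS: "finite S" and GS: "G \<subseteq> nsets S 2" and ABX: "{A, B, X} \<subseteq> S" "nsets {A, B, X} 2 \<subseteq> G"
    and hull: "S \<subseteq> convex hull {A, B, X}"
    using fr crossing_freeD[of S G] by (auto simp: framed_def nsets_def)
  let ?U = "{C. 0 < orient A B C} \<inter> {C. 0 < orient B C X} \<inter> {C. 0 < orient C A X}"
  have op: "open ?U" unfolding orient_def by (intro open_Int open_Collect_less continuous_intros)
  \<comment> \<open>The reflection of the midpoint of AB in X is a possible position of C.\<close>
  have "2 *\<^sub>R X - (1 / 2) *\<^sub>R (A + B) \<in> ?U"
    using pos by (simp add: orient_def field_simps)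
  then have "?U \<noteq> {}" by (metis empty_iff)
  then obtain C where C: "C \<in> ?U" "C \<notin> S" "\<And>a b. a \<in> S \<Longrightarrow> b \<in> S \<Longrightarrow> a \<noteq> b \<Longrightarrow> orient a b C \<noteq> 0"
    using exists_generic_point[OF finS op] by metis
  have o: "0 < orient A B C" "0 < orient B C X" "0 < orient C A X" using C(1) by auto
  have ne: "A \<noteq> B" "B \<noteq> X" "X \<noteq> A" "C \<noteq> A" "C \<noteq> B" "C \<noteq> X"
    using pos o C(2) ABX(1) by auto
  define V1 where "V1 = S \<union> {C}"
  have gp1: "general_position V1" using general_position_insert[OF gpS C(3)] by (simp add: V1_def)
  obtain S1 G1 where S1: "fills {B, C, X} S1 G1" "S1 \<inter> V1 = {B, C, X}" "general_position (V1 \<union> S1)"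
      "card S1 = 3 + k" "l \<le> card (redrawings {B, C, X} S1 G1)"
    using fill[unfolded fillable_def, rule_format, OF o(2), of V1] gp1 finS ABX(1) by (auto simp: V1_def)
  define V2 where "V2 = V1 \<union> S1"
  have fin1: "finite S1" using S1(1) crossing_freeD(1) by (auto simp: fills_def framed_def)
  obtain S2 G2 where S2: "fills {C, A, X} S2 G2" "S2 \<inter> V2 = {C, A, X}" "general_position (V2 \<union> S2)"
      "card S2 = 3 + k" "l \<le> card (redrawings {C, A, X} S2 G2)"
    using fill[unfolded fillable_def, rule_format, OF o(3), of V2] S1(3) finS fin1 ABX(1)
    by (auto simp: V1_def V2_def)
  have fin2: "finite S2" using S2(1) crossing_freeD(1) by (auto simp: fills_def framed_def)
  have fr1: "framed {B, C, X} S1 G1" and fr2: "framed {C, A, X} S2 G2" using S1(1) S2(1) by (auto simp: fills_def)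
  have sub: "{B, C, X} \<subseteq> S1" "{C, A, X} \<subseteq> S2" "G1 \<subseteq> nsets S1 2" "G2 \<subseteq> nsets S2 2"
    "{{B, C}, {C, X}, {X, B}} \<subseteq> G1" "{{C, A}, {A, X}, {X, C}} \<subseteq> G2" "{{A, B}, {B, X}, {X, A}} \<subseteq> G"
    using fr1 fr2 ABX(2) crossing_freeD(2) ne nsets_3_2[of B C X] nsets_3_2[of C A X] nsets_3_2[of A B X]
    by (auto simp: framed_def nsets_def[of _ 3])
  define S' where "S' = S \<union> S1 \<union> S2"
  define G' where "G' = G \<union> G1 \<union> G2"
  have S'eq: "S' = V2 \<union> S2" using sub(1) by (auto simp: S'_def V1_def V2_def)
  have "card V1 = card S + 1" using finS C(2) by (simp add: V1_def)
  moreover have "card V2 + card {B, C, X} = card V1 + card S1"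
    unfolding V2_def using card_Un_Int[of V1 S1] finS fin1 S1(2) by (simp add: V1_def Int_commute)
  moreover have "card S' + card {C, A, X} = card V2 + card S2"
    unfolding S'eq using card_Un_Int[of V2 S2] finS fin1 fin2 S2(2) by (simp add: V1_def V2_def Int_commute)
  moreover have "card {B, C, X} = 3" "card {C, A, X} = 3" using ne by auto
  ultimately have card: "card S' = card S + 1 + 2 * k" using S1(4) S2(4) by simp
  \<comment> \<open>The graph grows by the vertex C and then by the two fillings. Each time the part outside of the next
    triangle is linked, because one base point (A, then B, finally X) is adjacent to all of its pieces and
    to all corners of that triangle.\<close>
  have tri: "nsets {A, B, X} 2 = {{A, B}, {B, X}, {X, A}}" "nsets {B, C, X} 2 = {{B, C}, {C, X}, {X, B}}"
     "nsets {C, A, X} 2 = {{C, A}, {A, X}, {X, C}}" "nsets {A, B, C} 2 = {{A, B}, {B, C}, {C, A}}"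
    using ne by (simp_all add: nsets_3_2)
  define E1 where "E1 = G \<union> {{C, A}, {C, B}, {C, X}}"
  have sat1: "saturated V1 E1"
    unfolding V1_def E1_def
    by (rule saturated_add_vertex[OF sat GS ABX(1) _ _ _ ABX(2) att C(2)]) (use ne in auto)
  have E1V: "E1 \<subseteq> nsets V1 2"
    using GS ABX(1) C(2) ne nsets_mono[of S V1 2] by (auto simp: E1_def V1_def nsets_def)
  have link1: "linked E1 ({A} \<union> (S - {A, B, X}))"
    by (rule linked_add_part[OF linked.single _ _ att]) (auto simp: E1_def)
  have att1: "attached V1 E1 {B, C, X}"
  proof -
    have "V1 - {B, C, X} = {A} \<union> (S - {A, B, X})" using ABX(1) C(2) ne by (auto simp: V1_def)
    moreover have "\<forall>b\<in>{B, C, X}. {A, b} \<in> E1" using sub(7) by (auto simp: E1_def insert_commute)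
    ultimately show ?thesis unfolding attached_def using link1 by auto
  qed
  define E2 where "E2 = E1 \<union> G1"
  have sat2: "saturated V2 E2"
    unfolding V2_def E2_def
  proof (rule S1(1)[unfolded fills_def, THEN conjunct2, THEN conjunct2, rule_format, OF sat1 E1V _ _ att1 S1(2)])
    show "{B, C, X} \<subseteq> V1" using ABX(1) by (auto simp: V1_def)
    show "nsets {B, C, X} 2 \<subseteq> E1" unfolding tri using sub(7) by (auto simp: E1_def insert_commute)
  qed
  have E2V: "E2 \<subseteq> nsets V2 2"
    using E1V sub(3) nsets_mono[of V1 V2 2] nsets_mono[of S1 V2 2] by (auto simp: E2_def V2_def)
  have at1: "attached S1 G1 {B, C, X}" and at2: "attached S2 G2 {C, A, X}"
    using S1(1) S2(1) by (auto simp: fills_def)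
  have V2_parts: "V2 = insert C S \<union> (S1 - {B, C, X})"
    using ABX(1) by (auto simp: V2_def V1_def)
  have new1: "(S1 - {B, C, X}) \<inter> insert C S = {}"
    using S1(2) by (auto simp: V1_def)
  have att2: "attached V2 E2 {C, A, X}"
  proof -
    have "{B} \<union> (S - {A, B, X}) \<union> (S1 - {B, C, X}) = V2 - {C, A, X}"
      unfolding V2_parts by (rule base_difference) (use ABX(1) C(2) ne new1 in auto)
    moreover have "linked E2 ({B} \<union> (S - {A, B, X}) \<union> (S1 - {B, C, X}))"
      by (rule linked_add_part[OF linked_add_part[OF linked.single _ _ att] _ _ at1]) (auto simp: E1_def E2_def)
    moreover have "\<forall>b\<in>{C, A, X}. {B, b} \<in> E2" using sub(5,7) by (auto simp: E1_def E2_def insert_commute)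
    ultimately show ?thesis unfolding attached_def by (metis (no_types, lifting) UnCI insertI1)
  qed
  have E3: "E2 \<union> G2 = G'" using sub(5,6) by (auto simp: E2_def E1_def G'_def insert_commute)
  have sat3: "saturated S' G'"
    unfolding S'eq E3[symmetric]
  proof (rule S2(1)[unfolded fills_def, THEN conjunct2, THEN conjunct2, rule_format, OF sat2 E2V _ _ att2 S2(2)])
    show "{C, A, X} \<subseteq> V2" using ABX(1) by (auto simp: V2_def V1_def)
    show "nsets {C, A, X} 2 \<subseteq> E2" unfolding tri using sub(7) by (auto simp: E2_def E1_def insert_commute)
  qed
  have S'_parts: "S' = insert C S \<union> ((S1 - {B, C, X}) \<union> (S2 - {C, A, X}))"
    using ABX(1) unfolding S'eq V2_parts by auto
  have new2: "(S2 - {C, A, X}) \<inter> insert C S = {}"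
    using S2(2) unfolding V2_parts by blast
  have att3: "attached S' G' {A, B, C}"
  proof -
    have "{X} \<union> (S - {A, B, X}) \<union> ((S1 - {B, C, X}) \<union> (S2 - {C, A, X})) = S' - {A, B, C}"
      unfolding S'_parts by (rule base_difference) (use ABX(1) C(2) ne new1 new2 in auto)
    then have "{X} \<union> (S - {A, B, X}) \<union> (S1 - {B, C, X}) \<union> (S2 - {C, A, X}) = S' - {A, B, C}"
      by (simp only: Un_assoc)
    moreover have "linked G' ({X} \<union> (S - {A, B, X}) \<union> (S1 - {B, C, X}) \<union> (S2 - {C, A, X}))"
      by (rule linked_add_part[OF linked_add_part[OF linked_add_part[OF linked.single _ _ att] _ _ at1] _ _ at2])
         (auto simp: G'_def)
    moreover have "\<forall>b\<in>{A, B, C}. {X, b} \<in> G'" using sub(5-7) by (auto simp: G'_def insert_commute)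
    ultimately show ?thesis unfolding attached_def by (metis (no_types, lifting) UnCI insertI1)
  qed
  \<comment> \<open>The only triangle on A, B, C, X that is not one of the regions is A B C, and it contains X.\<close>
  define HH where "HH = (\<lambda>i::nat. if i = 0 then {A, B, X} else if i = 1 then {B, C, X} else {C, A, X})"
  define SS where "SS = (\<lambda>i::nat. if i = 0 then S else if i = 1 then S1 else S2)"
  define GG where "GG = (\<lambda>i::nat. if i = 0 then G else if i = 1 then G1 else G2)"
  have US: "(\<Union>i\<in>{0, 1, 2}. SS i) = S'" and UG: "(\<Union>i\<in>{0, 1, 2}. GG i) = G'"
    and UH: "(\<Union>i\<in>{0, 1, 2}. HH i) = {A, B, C, X}"
    by (auto simp: SS_def GG_def HH_def S'_def G'_def)
  have orot: "0 < orient B X A" "0 < orient X B C" "0 < orient C X B" "0 < orient X C A" "0 < orient A X C" "0 < orient X A B"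
    using pos o orient_rotate by metis+
  have sides: "convex hull {A, B, X} \<inter> convex hull {B, C, X} \<subseteq> convex hull {B, X}"
     "convex hull {B, C, X} \<inter> convex hull {C, A, X} \<subseteq> convex hull {C, X}"
     "convex hull {A, B, X} \<inter> convex hull {C, A, X} \<subseteq> convex hull {X, A}"
    using opposite_triangles[OF orot(1,2)] opposite_triangles[OF orot(3,4)] opposite_triangles[OF orot(6,5)]
    by (simp_all add: insert_commute)
  have Xin: "X \<in> convex hull {A, B, C}"
    using in_triangle_iff[OF o(1), of X] pos o by simp
  interpret M: mosaic "{0, 1, 2}" HH SS GG
  proof
    show "framed (HH i) (SS i) (GG i)" if "i \<in> {0, 1, 2}" for i
      using that fr fr1 fr2 by (auto simp: HH_def SS_def GG_def)
    show "general_position (\<Union>i\<in>{0, 1, 2}. SS i)" unfolding US S'eq by (rule S2(3))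
    show "\<exists>e. e \<in> nsets (HH i) 2 \<and> e \<in> nsets (HH j) 2 \<and> convex hull HH i \<inter> convex hull HH j \<subseteq> convex hull e"
      if "i \<in> {0, 1, 2}" "j \<in> {0, 1, 2}" "i \<noteq> j" for i j
    proof -
      have "\<exists>e. e \<in> nsets {A, B, X} 2 \<and> e \<in> nsets {B, C, X} 2 \<and>
          convex hull {A, B, X} \<inter> convex hull {B, C, X} \<subseteq> convex hull e"
        using sides(1) unfolding tri by (intro exI[of _ "{B, X}"]) (auto simp: insert_commute)
      moreover have "\<exists>e. e \<in> nsets {B, C, X} 2 \<and> e \<in> nsets {C, A, X} 2 \<and>
          convex hull {B, C, X} \<inter> convex hull {C, A, X} \<subseteq> convex hull e"
        using sides(2) unfolding tri by (intro exI[of _ "{C, X}"]) (auto simp: insert_commute)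
      moreover have "\<exists>e. e \<in> nsets {A, B, X} 2 \<and> e \<in> nsets {C, A, X} 2 \<and>
          convex hull {A, B, X} \<inter> convex hull {C, A, X} \<subseteq> convex hull e"
        using sides(3) unfolding tri by (intro exI[of _ "{X, A}"]) (auto simp: insert_commute)
      ultimately show ?thesis using that by (auto simp: HH_def Int_commute)
    qed
    show "\<not> (\<Union>i\<in>{0, 1, 2}. SS i) \<inter> convex hull t \<subseteq> t"
      if t: "t \<subseteq> (\<Union>i\<in>{0, 1, 2}. HH i)" "card t = 3" "\<forall>i\<in>{0, 1, 2}. \<not> t \<subseteq> HH i" for t
    proof -
      have "t = {A, B, C} \<or> t \<subseteq> {A, B, X} \<or> t \<subseteq> {B, C, X} \<or> t \<subseteq> {C, A, X}"
      proof (cases "X \<in> t")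
        case False
        then have "t \<subseteq> {A, B, C}" using t(1) unfolding UH by auto
        moreover have "card {A, B, C} = 3" using ne by auto
        ultimately show ?thesis using t(2) card_subset_eq[of "{A, B, C}" t] by simp
      next
        case True
        then have "\<not> {A, B, C} \<subseteq> t"
        proof -
          have "card {A, B, C, X} = 4" using ne by auto
          moreover have "finite t" using t(2) card.infinite by fastforce
          ultimately show ?thesis using True t(2) card_mono[of t "{A, B, C, X}"] by auto
        qed
        then show ?thesis using t(1) unfolding UH by auto
      qed
      then have "t = {A, B, C}" using t(3) by (auto simp: HH_def)
      moreover have "X \<in> S'" using ABX(1) by (auto simp: S'_def)
      ultimately show ?thesis unfolding US using Xin ne by auto
    qed
  qed simp
  have "framed {A, B, C} S' G'"
    unfolding framed_def
  proof (intro conjI)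
    show "crossing_free S' G'" using M.crossing_free_Union unfolding US UG .
    show "{A, B, C} \<in> nsets S' 3" using ABX(1) sub(1) ne by (auto simp: nsets_def S'_def)
    show "nsets {A, B, C} 2 \<subseteq> G'" unfolding tri using sub(5-7) by (auto simp: G'_def)
    have "convex hull {A, B, X} \<subseteq> convex hull {A, B, C}" "convex hull {B, C, X} \<subseteq> convex hull {A, B, C}"
         "convex hull {C, A, X} \<subseteq> convex hull {A, B, C}"
      by (intro hull_minimal; use Xin in \<open>simp add: hull_inc\<close>)+
    then show "S' \<subseteq> convex hull {A, B, C}"
      using hull fr1 fr2 unfolding framed_def S'_def by blast
  qed
  moreover have "m * l * l \<le> card (redrawings {A, B, C} S' G')"
  proof -
    have "m * l * l \<le> (\<Prod>i\<in>{0, 1, 2}. card (redrawings (HH i) (SS i) (GG i)))"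
      using m S1(5) S2(5) by (simp add: HH_def SS_def GG_def mult_le_mono mult.assoc)
    also have "\<dots> \<le> card (redrawings {A, B, C} S' G')"
      using M.card_redrawings_Union[of "{A, B, C}"] unfolding US UG UH by blast
    finally show ?thesis .
  qed
  moreover have "general_position S'" unfolding S'eq by (rule S2(3))
  ultimately have "flexible_system {A, B, C} S' G' (m * l * l)"
    unfolding flexible_system_def using sat3 att3 by blast
  then show thesis using that o(1) card by blast
qed

text \<open>Start from a single triangle, apply the step \<open>q\<close> times with gadgets and then \<open>r\<close> times
with nothing but the new corner.\<close>

lemma flexible_system_exists:
  "\<exists>A B C S G. flexible_system {A, B, C} S G (36 ^ q) \<and> 0 < orient A B C \<and> card S = 3 + 13 * q + r"
proof (induction r)
  case 0
  show ?case
  proof (induction q)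
    case 0
    have pos: "0 < orient 0 1 \<i>" by (simp add: orient_def)
    note fr = framed_triangle[OF pos]
    have gp: "general_position {0, 1, \<i>}"
      using pos orient_rotate[of 0 1 \<i>] orient_rotate[of 1 \<i> 0] orient_swap
      by (auto simp: general_position_iff orient_def)
    have "{x, y} \<in> nsets {0, 1, \<i>} 2" if "x \<in> {0, 1, \<i>}" "y \<in> {0, 1, \<i>}" "x \<noteq> y" for x y
      using that by (auto simp: nsets_def)
    then have "saturated {0, 1, \<i>} (nsets {0, 1, \<i>} 2)" unfolding saturated_def by blast
    then have "flexible_system {0, 1, \<i>} {0, 1, \<i>} (nsets {0, 1, \<i>} 2) 1"
      unfolding flexible_system_def using fr gp card_redrawings_pos[OF fr] by (simp add: attached_def)
    then show ?case using pos by (intro exI) (auto simp: complex_eq_iff)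
  next
    case (Suc q)
    then obtain A B C S G where *: "flexible_system {A, B, C} S G (36 ^ q)" "0 < orient A B C" "card S = 3 + 13 * q"
      by auto
    obtain C' S' G' where "flexible_system {A, B, C'} S' G' (36 ^ q * 6 * 6)" "0 < orient A B C'"
        "card S' = card S + 1 + 2 * 6"
      using flexible_system_extend[OF *(1,2) fillable_gadget] by blast
    then show ?case using *(3) by (intro exI[of _ A] exI[of _ B] exI[of _ C'] exI[of _ S'] exI[of _ G']) auto
  qed
next
  case (Suc r)
  then obtain A B C S G where *: "flexible_system {A, B, C} S G (36 ^ q)" "0 < orient A B C" "card S = 3 + 13 * q + r"
    by auto
  obtain C' S' G' where "flexible_system {A, B, C'} S' G' (36 ^ q * 1 * 1)" "0 < orient A B C'"
      "card S' = card S + 1 + 2 * 0"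
    using flexible_system_extend[OF *(1,2) fillable_empty] by blast
  then show ?case using *(3) by (intro exI[of _ A] exI[of _ B] exI[of _ C'] exI[of _ S'] exI[of _ G']) auto
qed

section \<open>Numbering the vertices\<close>

lemma nsets_image:
  assumes "inj_on g V"
  shows "nsets (g ` V) k = (`) g ` nsets V k"
proof (intro equalityI subsetI)
  fix X assume "X \<in> nsets (g ` V) k"
  then obtain Y where "Y \<subseteq> V" "X = g ` Y" "finite X" "card X = k"
    by (auto simp: nsets_def subset_image_iff)
  moreover have "inj_on g Y" using assms calculation(1) by (rule inj_on_subset)
  ultimately have "Y \<in> nsets V k"
    by (auto simp: nsets_def card_image finite_image_iff)
  then show "X \<in> (`) g ` nsets V k" using \<open>X = g ` Y\<close> by blast
next
  fix X assume "X \<in> (`) g ` nsets V k"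
  then obtain Y where Y: "Y \<subseteq> V" "finite Y" "card Y = k" "X = g ` Y" by (auto simp: nsets_def)
  then show "X \<in> nsets (g ` V) k"
    using assms by (auto simp: nsets_def card_image inj_on_subset)
qed

lemma planar_image:
  assumes g: "bij_betw g V S" and E: "E \<subseteq> nsets V 2" and "planar V E"
  shows "planar S ((`) g ` E)"
proof -
  obtain p D where pd: "plane_drawing V E p D" using assms(3) by (auto simp: planar_def)
  define k where "k = inv_into V g"
  have k: "bij_betw k S V" "\<And>v. v \<in> V \<Longrightarrow> k (g v) = v"
    using g bij_betw_inv_into[OF g] by (auto simp: k_def bij_betw_def)
  have ke: "k ` g ` e = e" if "e \<subseteq> V" for e using k(2) that by (force simp: image_image)
  have eV: "e \<subseteq> V" if "e \<in> E" for e using E that by (auto simp: nsets_def)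
  have S: "S = g ` V" using g by (simp add: bij_betw_def)
  have "plane_drawing S ((`) g ` E) (p \<circ> k) (\<lambda>e. D (k ` e))"
    unfolding plane_drawing_def
  proof (intro conjI ballI impI)
    show "inj_on (p \<circ> k) S"
      using k(1) plane_drawingD(1)[OF pd] by (auto simp: bij_betw_def intro: comp_inj_on)
  next
    fix e assume "e \<in> (`) g ` E"
    then obtain d where d: "d \<in> E" "e = g ` d" by blast
    then show "\<exists>h. arc h \<and> path_image h = D (k ` e) \<and> {pathstart h, pathfinish h} = (p \<circ> k) ` e"
      using plane_drawingD(4)[OF pd d(1)] ke[OF eV[OF d(1)]] unfolding image_comp[symmetric] by simp
    show "D (k ` e) \<inter> (p \<circ> k) ` S = (p \<circ> k) ` e"
      using plane_drawingD(2)[OF pd d(1)] ke[OF eV[OF d(1)]] k(1) d(2)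
      unfolding image_comp[symmetric] by (simp add: bij_betw_def)
    fix e' assume "e' \<in> (`) g ` E" and ne: "e \<noteq> e'"
    then obtain d' where d': "d' \<in> E" "e' = g ` d'" by blast
    have "k ` (e \<inter> e') = d \<inter> d'"
    proof -
      have "g ` d \<inter> g ` d' = g ` (d \<inter> d')"
        using inj_on_image_Int[of g V d d'] g eV d(1) d'(1) by (simp add: bij_betw_def)
      then show ?thesis using ke[of "d \<inter> d'"] eV[OF d(1)] d(2) d'(2) by auto
    qed
    moreover have "D d \<inter> D d' \<subseteq> p ` (d \<inter> d')"
      using plane_drawingD(3)[OF pd d(1) d'(1)] ne d(2) d'(2) by blast
    ultimately show "D (k ` e) \<inter> D (k ` e') \<subseteq> (p \<circ> k) ` (e \<inter> e')"
      using ke[OF eV[OF d(1)]] ke[OF eV[OF d'(1)]] d(2) d'(2)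
      unfolding image_comp[symmetric] by simp
  qed
  then show ?thesis by (auto simp: planar_def)
qed

lemma saturated_image:
  assumes g: "bij_betw g V S" and E: "E \<subseteq> nsets V 2" and sat: "saturated V E"
  shows "saturated S ((`) g ` E)"
  unfolding saturated_def
proof (intro ballI impI notI)
  fix x y assume xy: "x \<in> S" "y \<in> S" "x \<noteq> y" "{x, y} \<notin> (`) g ` E" and pl: "planar S (insert {x, y} ((`) g ` E))"
  define k where "k = inv_into V g"
  have k: "bij_betw k S V" "\<And>v. v \<in> V \<Longrightarrow> k (g v) = v"
    using g bij_betw_inv_into[OF g] by (auto simp: k_def bij_betw_def)
  have gk: "s \<in> S \<Longrightarrow> g (k s) = s" for s using g by (auto simp: k_def bij_betw_def f_inv_into_f)
  have S: "S = g ` V" "inj_on g V" using g by (auto simp: bij_betw_def)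
  have ES: "insert {x, y} ((`) g ` E) \<subseteq> nsets S 2"
  proof (rule insert_subsetI)
    show "{x, y} \<in> nsets S 2" using xy by (auto simp: nsets_def)
    show "(`) g ` E \<subseteq> nsets S 2" unfolding S(1) nsets_image[OF S(2)] using E by (rule image_mono)
  qed
  have "planar V ((`) k ` insert {x, y} ((`) g ` E))" by (rule planar_image[OF k(1) ES pl])
  moreover have "(`) k ` (`) g ` E = E"
  proof -
    have "k ` g ` e = e" if "e \<in> E" for e
    proof -
      have "e \<subseteq> V" using that E by (auto simp: nsets_def)
      then show ?thesis using k(2) by (force simp: image_image)
    qed
    then show ?thesis by (simp add: image_image)
  qed
  ultimately have "planar V (insert {k x, k y} E)" by simp
  moreover have "k x \<in> V" "k y \<in> V" "k x \<noteq> k y"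
    using k(1) xy gk by (auto simp: bij_betw_def) (metis gk)
  moreover have "{k x, k y} \<notin> E"
  proof
    assume "{k x, k y} \<in> E"
    then have "g ` {k x, k y} \<in> (`) g ` E" by (rule imageI)
    then show False using xy gk by simp
  qed
  ultimately show False using sat unfolding saturated_def by blast
qed

lemma straight_line_drawing:
  assumes cf: "crossing_free S G" and gp: "general_position S" and g: "bij_betw g V S"
    and E: "E = {e \<in> nsets V 2. g ` e \<in> G}"
  shows "plane_drawing V E g (\<lambda>e. convex hull (g ` e))"
  unfolding plane_drawing_def
proof (intro conjI ballI impI)
  have S: "S = g ` V" and inj: "inj_on g V" using g by (auto simp: bij_betw_def)
  show "inj_on g V" by (rule inj)
  fix e assume "e \<in> E"
  then obtain a b where ab: "e = {a, b}" "a \<noteq> b" "a \<in> V" "b \<in> V" and eG: "g ` e \<in> G"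
    unfolding E by (auto simp: nsets_def card_2_iff)
  have gab: "g a \<noteq> g b" "g a \<in> S" "g b \<in> S" using ab inj S by (auto simp: inj_on_def)
  show "\<exists>h. arc h \<and> path_image h = convex hull (g ` e) \<and> {pathstart h, pathfinish h} = g ` e"
    using gab(1) ab(1) by (intro exI[of _ "linepath (g a) (g b)"]) (simp add: segment_convex_hull)
  have "convex hull (g ` e) \<inter> S \<subseteq> g ` e"
    using general_position_segment[OF gp _ gab(2,3,1)] ab(1) by auto
  moreover have "g ` e \<subseteq> S" using ab(1) gab by auto
  ultimately show "convex hull (g ` e) \<inter> g ` V = g ` e"
    unfolding S[symmetric] using hull_subset[of "g ` e" convex] by blast
  fix e' assume e': "e' \<in> E" and ne: "e \<noteq> e'"
  then have eV: "e' \<subseteq> V" "e \<subseteq> V" "g ` e' \<in> G" using ab unfolding E by (auto simp: nsets_def)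
  then have "g ` e \<noteq> g ` e'" using ne inj_on_image_eq_iff[OF inj] by blast
  then have "convex hull (g ` e) \<inter> convex hull (g ` e') \<subseteq> g ` e \<inter> g ` e'"
    using crossing_freeD(3)[OF cf eG eV(3)] by blast
  then show "convex hull (g ` e) \<inter> convex hull (g ` e') \<subseteq> g ` (e \<inter> e')"
    using inj_on_image_Int[OF inj eV(2,1)] by simp
qed

lemma straight_line_planar: "crossing_free S G \<Longrightarrow> general_position S \<Longrightarrow> planar S G"
proof -
  assume cf: "crossing_free S G" and gp: "general_position S"
  have "plane_drawing S G id (\<lambda>e. convex hull (id ` e))"
    by (rule straight_line_drawing[OF cf gp]) (use crossing_freeD(2)[OF cf] in auto)
  then show "planar S G" unfolding planar_def by blast
qed

text \<open>Maximality among straight-line graphs follows from maximality among planar graphs, which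
depends only on the isomorphism type.\<close>

lemma geometric_triangulation_of_redrawing:
  assumes fr: "framed H S G" and gp: "general_position S" and sat: "saturated S G" and G': "G' \<in> redrawings H S G"
  shows "geometric_triangulation S G'"
proof -
  have cf: "crossing_free S G'" using G' by (simp add: redrawings_def)
  obtain f where f: "bij_betw f S S" "(`) f ` G = G'" using G' by (auto simp: redrawings_def)
  have "G \<subseteq> nsets S 2" using fr crossing_freeD(2) by (auto simp: framed_def)
  then have "saturated S G'" using saturated_image[OF f(1) _ sat] f(2) by simp
  then have "maximal_planar S G'"
    using cf straight_line_planar[OF cf gp] by (intro maximal_planarI) (simp_all add: crossing_free_def)
  then show ?thesis
    using cf straight_line_planar[OF _ gp] unfolding geometric_triangulation_def maximal_planar_def
    by (metis crossing_free_def)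
qed

text \<open>The straight-line drawing itself serves as the required plane embedding; its unbounded
face is the complement of the hull triangle.\<close>

lemma combinatorial_triangulation_of_system:
  assumes fr: "framed H S G" and gp: "general_position S" and sat: "saturated S G"
    and g: "bij_betw g {1..n} S" and gH: "g ` {1, 2, 3} = H" and n: "3 \<le> n"
  defines "T \<equiv> \<lparr>verts = {1..n}, edges = {e \<in> nsets {1..n} 2. g ` e \<in> G},
    faces = {t \<in> nsets {1..n} 3. g ` t \<in> geometric_faces S G}\<rparr>"
  shows "combinatorial_triangulation n T"
proof -
  let ?V = "{1..n}" and ?E = "{e \<in> nsets {1..n} 2. g ` e \<in> G}" and ?D = "\<lambda>e. convex hull (g ` e)"
  have cf: "crossing_free S G" and H: "H \<in> nsets S 3" "nsets H 2 \<subseteq> G" "S \<subseteq> convex hull H"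
    using fr by (auto simp: framed_def)
  have S: "g ` ?V = S" and inj: "inj_on g ?V" using g by (auto simp: bij_betw_def)
  have gE: "(`) g ` ?E = G"
  proof (intro equalityI subsetI)
    fix e assume e: "e \<in> G"
    then have "e \<in> (`) g ` nsets ?V 2"
      unfolding nsets_image[OF inj, symmetric] S using crossing_freeD(2)[OF cf] by (rule subsetD[rotated])
    then show "e \<in> (`) g ` ?E" using e by auto
  qed auto
  have pd: "plane_drawing ?V ?E g ?D" by (rule straight_line_drawing[OF cf gp g]) simp
  have "saturated ?V ?E"
  proof -
    have k: "bij_betw (inv_into ?V g) S ?V" by (rule bij_betw_inv_into[OF g])
    have "saturated ?V ((`) (inv_into ?V g) ` G)"
      by (rule saturated_image[OF k crossing_freeD(2)[OF cf] sat])
    moreover have "(`) (inv_into ?V g) ` (`) g ` ?E = ?E"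
    proof -
      have "(\<lambda>e. inv_into ?V g ` g ` e) ` ?E = (\<lambda>e. e) ` ?E"
        by (rule image_cong[OF refl], rule inv_into_image_cancel[OF inj]) (simp add: nsets_def)
      then show ?thesis by (simp only: image_image image_ident)
    qed
    ultimately have "saturated ?V ?E" unfolding gE by simp
    then show ?thesis .
  qed
  then have mp: "maximal_planar ?V ?E"
    using pd by (intro maximal_planarI) (auto simp: simple_graph_def planar_def)
  have faces: "drawing_faces ?V ?E g ?D = components (- (S \<union> (\<Union>e\<in>G. convex hull e)))"
  proof -
    have "?D ` ?E = (hull) convex ` (`) g ` ?E" by (simp add: image_image)
    then show ?thesis by (simp only: drawing_faces_def S gE)
  qed
  have bounds: "bounds_face ?V ?E ?D t C \<longleftrightarrow> g ` t \<in> nsets S 3 \<and> nsets (g ` t) 2 \<subseteq> G \<and>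
      frontier C = (\<Union>e\<in>nsets (g ` t) 2. convex hull e)" if t: "t \<in> nsets ?V 3" for t C
  proof -
    have tV: "t \<subseteq> ?V" and injt: "inj_on g t" using t inj by (auto simp: nsets_def inj_on_subset)
    have n2: "nsets (g ` t) 2 = (`) g ` nsets t 2" by (rule nsets_image[OF injt])
    have "nsets t 2 \<subseteq> ?E \<longleftrightarrow> nsets (g ` t) 2 \<subseteq> G"
      unfolding n2 using tV by (auto simp: nsets_def)
    moreover have "g ` t \<in> nsets S 3" using t nsets_image[OF inj, of 3] unfolding S by blast
    moreover have "\<Union> (?D ` nsets t 2) = (\<Union>e\<in>nsets (g ` t) 2. convex hull e)" unfolding n2 by (simp add: image_image)
    ultimately show ?thesis using t by (simp add: bounds_face_def)
  qed
  have gf: "geometric_faces S G = {t. \<exists>C\<in>components (- (S \<union> (\<Union>e\<in>G. convex hull e))). t \<in> nsets S 3 \<and>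
      nsets t 2 \<subseteq> G \<and> frontier C = (\<Union>e\<in>nsets t 2. convex hull e)}"
    by (simp add: geometric_faces_def triangular_faces_def drawing_faces_def bounds_face_def)
  have "{t \<in> nsets ?V 3. g ` t \<in> geometric_faces S G} = triangular_faces ?V ?E g ?D"
  proof -
    have "t \<in> triangular_faces ?V ?E g ?D \<longleftrightarrow> t \<in> nsets ?V 3 \<and> g ` t \<in> geometric_faces S G" for t
    proof (cases "t \<in> nsets ?V 3")
      case True then show ?thesis unfolding triangular_faces_def faces gf using bounds[OF True] by simp
    next
      case False then show ?thesis by (auto simp: triangular_faces_def bounds_face_def)
    qed
    then show ?thesis by blast
  qed
  moreover have "\<exists>C\<in>drawing_faces ?V ?E g ?D. \<not> bounded C \<and> bounds_face ?V ?E ?D {1, 2, 3} C"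
  proof (intro bexI conjI)
    show "- (convex hull H) \<in> drawing_faces ?V ?E g ?D"
      unfolding faces by (rule geometric_faces_eq(2)[OF cf gp H])
    have "finite H" using H(1) by (simp add: nsets_def)
    then have "bounded (convex hull H)" by (simp add: bounded_convex_hull finite_imp_bounded)
    then show "\<not> bounded (- (convex hull H))"
      using bounded_Un[of "convex hull H" "- (convex hull H)"] not_bounded_UNIV by auto
    have "{1, 2, 3} \<in> nsets ?V 3" using n by (auto simp: nsets_def)
    then show "bounds_face ?V ?E ?D {1, 2, 3} (- (convex hull H))"
      using bounds gH H geometric_faces_eq(3)[OF cf gp H] by simp
  qed
  ultimately show ?thesis
    unfolding combinatorial_triangulation_def T_def using n mp pd by (auto intro!: exI)
qed

lemma redrawings_are_drawings:
  assumes fr: "framed H S G" and gp: "general_position S" and sat: "saturated S G"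
    and g: "bij_betw g {1..n} S" and gH: "g ` {1, 2, 3} = H" and n: "3 \<le> n"
  defines "T \<equiv> \<lparr>verts = {1..n}, edges = {e \<in> nsets {1..n} 2. g ` e \<in> G},
    faces = {t \<in> nsets {1..n} 3. g ` t \<in> geometric_faces S G}\<rparr>"
  shows "redrawings H S G \<subseteq> drawings T S g"
proof
  fix G' assume G': "G' \<in> redrawings H S G"
  then obtain f where f: "bij_betw f S S" "\<forall>x\<in>H. f x = x" "(`) f ` G = G'"
    "(`) f ` empty_triangles S G = empty_triangles S G'" by (auto simp: redrawings_def)
  have fr': "framed H S G'" by (rule framed_redrawing[OF fr G'])
  have cf: "crossing_free S G" "crossing_free S G'" and H: "H \<in> nsets S 3" "nsets H 2 \<subseteq> G" "nsets H 2 \<subseteq> G'" "S \<subseteq> convex hull H"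
    using fr fr' by (auto simp: framed_def)
  have S: "g ` {1..n} = S" using g by (simp add: bij_betw_def)
  have injf: "inj_on f S" using f(1) by (simp add: bij_betw_def)
  have fH: "f ` H = H" using f(2) by simp
  have faces: "(`) f ` geometric_faces S G = geometric_faces S G'"
    using geometric_faces_eq(1)[OF cf(1) gp H(1,2,4)] geometric_faces_eq(1)[OF cf(2) gp H(1,3,4)] f(4) fH by simp
  have mem: "f ` X \<in> (`) f ` F \<longleftrightarrow> X \<in> F" if "X \<subseteq> S" "F \<subseteq> Pow S" for X F
    using inj_on_image_mem_iff[OF inj_on_image_Pow[OF injf], of X F] that by blast
  have GS: "G \<subseteq> Pow S" using crossing_freeD(2)[OF cf(1)] by (auto simp: nsets_def)
  have FS: "geometric_faces S G \<subseteq> Pow S"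
    using geometric_faces_eq(1)[OF cf(1) gp H(1,2,4)] H(1) by (auto simp: empty_triangles_def nsets_def)
  have "is_drawing T S g G'"
    unfolding is_drawing_def
  proof (intro conjI exI[of _ "f \<circ> g"] ballI)
    show "geometric_triangulation S G'" by (rule geometric_triangulation_of_redrawing[OF fr gp sat G'])
    show "bij_betw (f \<circ> g) (verts T) S" using bij_betw_trans[OF g f(1)] by (simp add: T_def)
    show "(f \<circ> g) i = g i" if "i \<in> {1, 2, 3}" for i using that f(2) gH by auto
    show "e \<in> edges T \<longleftrightarrow> (f \<circ> g) ` e \<in> G'" if "e \<in> nsets (verts T) 2" for e
    proof -
      have "g ` e \<subseteq> S" using that S by (auto simp: T_def nsets_def)
      then show ?thesis using mem[OF _ GS] that f(3)
        unfolding image_comp[symmetric] by (simp add: T_def)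
    qed
    show "t \<in> faces T \<longleftrightarrow> (f \<circ> g) ` t \<in> geometric_faces S G'" if "t \<in> nsets (verts T) 3" for t
    proof -
      have "g ` t \<subseteq> S" using that S by (auto simp: T_def nsets_def)
      then show ?thesis using mem[OF _ FS] that faces
        unfolding image_comp[symmetric] by (simp add: T_def)
    qed
  qed
  then show "G' \<in> drawings T S g" by (simp add: drawings_def)
qed

lemma exists_numbering:
  assumes "finite S" "card S = n" "A \<in> S" "B \<in> S" "C \<in> S" "A \<noteq> B" "B \<noteq> C" "C \<noteq> A"
  obtains g :: "nat \<Rightarrow> complex" where "bij_betw g {1..n} S" "g 1 = A" "g 2 = B" "g 3 = C"
proof -
  have "card {A, B, C} = 3" "{A, B, C} \<subseteq> S" using assms by auto
  then have "3 \<le> n" "card (S - {A, B, C}) = n - 3"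
    using assms(1,2) card_mono[of S "{A, B, C}"] card_Diff_subset[of "{A, B, C}" S] by auto
  then obtain h where h: "bij_betw h {4..n} (S - {A, B, C})"
    using finite_same_card_bij[of "{4..n}" "S - {A, B, C}"] assms(1) by auto
  define g where "g i = (if i = 1 then A else if i = 2 then B else if i = 3 then C else h i)" for i :: nat
  have "bij_betw g {1, 2, 3} {A, B, C}" using assms by (auto simp: bij_betw_def inj_on_def g_def)
  moreover have "bij_betw g {4..n} (S - {A, B, C})"
    using h by (rule bij_betw_cong[THEN iffD1, rotated]) (auto simp: g_def)
  ultimately have "bij_betw g ({1, 2, 3} \<union> {4..n}) ({A, B, C} \<union> (S - {A, B, C}))"
    by (rule bij_betw_combine) auto
  moreover have "{1, 2, 3} \<union> {4..n} = {1..n}" using \<open>3 \<le> n\<close> by auto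
  moreover have "{A, B, C} \<union> (S - {A, B, C}) = S" using assms by auto
  ultimately show thesis using that[of g] by (simp add: g_def)
qed

theorem theorem1:
  "\<exists>c::real. c > 0 \<and>
     (\<forall>n::nat. n \<ge> 3 \<longrightarrow>
       (\<exists>T S l. combinatorial_triangulation n T \<and>
          finite S \<and> card S = n \<and> general_position S \<and> hull_labelling S l \<and>
          real (card (drawings T S l)) \<ge> c * 1.31 ^ n))"
  \<comment> \<open>With n = 3 + 13 q + r there are at least 36 ^ q drawings; the constant pays for 3 + r, at most 15.\<close>
proof (intro exI[of _ "1 / 1.31 ^ 15 :: real"] conjI allI impI)
  fix n :: nat assume n: "3 \<le> n"
  define q r where "q = (n - 3) div 13" and "r = (n - 3) mod 13"
  have nqr: "n = 3 + 13 * q + r" "r \<le> 12" using n by (simp_all add: q_def r_def)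
  obtain A B C S G where sys: "flexible_system {A, B, C} S G (36 ^ q)" and pos: "0 < orient A B C" and card: "card S = n"
    using flexible_system_exists[of q r] nqr(1) by auto
  then have fr: "framed {A, B, C} S G" and gp: "general_position S" and sat: "saturated S G"
    and m: "36 ^ q \<le> card (redrawings {A, B, C} S G)" by (auto simp: flexible_system_def)
  have finS: "finite S" using fr crossing_freeD(1) by (auto simp: framed_def)
  have ABC: "A \<in> S" "B \<in> S" "C \<in> S" "A \<noteq> B" "B \<noteq> C" "C \<noteq> A"
    using fr orient_pos_distinct[OF pos] by (auto simp: framed_def nsets_def)
  obtain g where g: "bij_betw g {1..n} S" "g 1 = A" "g 2 = B" "g 3 = C"
    using exists_numbering[OF finS card ABC] by blast
  have gH: "g ` {1, 2, 3} = {A, B, C}" using g by simp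
  define T where "T = \<lparr>verts = {1..n}, edges = {e \<in> nsets {1..n} 2. g ` e \<in> G},
    faces = {t \<in> nsets {1..n} 3. g ` t \<in> geometric_faces S G}\<rparr>"
  have "combinatorial_triangulation n T"
    unfolding T_def by (rule combinatorial_triangulation_of_system[OF fr gp sat g(1) gH n])
  moreover have "hull_labelling S g"
  proof -
    have "convex hull S = convex hull {A, B, C}"
      by (rule equalityI; rule hull_minimal) (use fr ABC in \<open>auto simp: framed_def hull_inc\<close>)
    moreover have "\<not> collinear {A, B, C}" using pos by (simp add: collinear_iff_orient)
    then have "\<not> affine_dependent {A, B, C}" using ABC collinear_3_eq_affine_dependent by metis
    ultimately have "{x. x extreme_point_of (convex hull S)} = {A, B, C}"
      using extreme_point_of_convex_hull_affine_independent[of "{A, B, C}"] by auto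
    moreover have "bij_betw g {1, 2, 3} {A, B, C}" using gH g ABC by (auto simp: bij_betw_def inj_on_def)
    ultimately show ?thesis by (simp add: hull_labelling_def)
  qed
  moreover have "real (card (drawings T S g)) \<ge> 1 / 1.31 ^ 15 * 1.31 ^ n"
  proof -
    have "card (redrawings {A, B, C} S G) \<le> card (drawings T S g)"
      unfolding T_def using redrawings_are_drawings[OF fr gp sat g(1) gH n] finite_drawings[OF finS] by (intro card_mono)
    then have "36 ^ q \<le> real (card (drawings T S g))" using m by (metis order_trans of_nat_le_iff of_nat_numeral of_nat_power)
    moreover have "(1.31::real) ^ 13 \<le> 36" by (simp add: power_divide)
    then have "((1.31::real) ^ 13) ^ q \<le> 36 ^ q" by (rule power_mono) simp
    moreover have "(1.31::real) ^ n \<le> 1.31 ^ 15 * (1.31 ^ 13) ^ q"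
    proof -
      have "(1.31::real) ^ n \<le> 1.31 ^ (15 + 13 * q)" using nqr by (intro power_increasing) auto
      then show ?thesis by (simp only: power_add power_mult)
    qed
    ultimately have "(1.31::real) ^ n \<le> 1.31 ^ 15 * real (card (drawings T S g))"
      by (meson mult_left_mono order_trans zero_le_power zero_le_divide_iff zero_le_numeral)
    then show ?thesis by (simp add: field_simps)
  qed
  ultimately show "\<exists>T S l. combinatorial_triangulation n T \<and> finite S \<and> card S = n \<and> general_position S \<and>
      hull_labelling S l \<and> real (card (drawings T S l)) \<ge> 1 / 1.31 ^ 15 * 1.31 ^ n"
    using finS card gp by blast
qed simp

end
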